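(* Let $\lambda>0$ be a constant, let $F$ be a probability distribution on $\mathbb{R}$ and let $M\sim CP(\lambda,F)$ be a homogeneous compound Poisson process. Let $f\not\equiv 0$ be a Bernstein function $$f(x)=a+bx+\int_0^\infty(1-e^{-xw})\,\bar\nu_f(dw),\quad x\ge0,$$ and let $\mathcal{H}_f$ be the corresponding Bernstein subordinator, independent of $M$. Set $$a_k=\frac{1}{f(\lambda)}\frac{\lambda^k}{k!}\int_0^\infty e^{-\lambda w}w^k\,\bar\nu_f(dw),\ k\ge1,\qquad a'_1=a_1+\frac{b\lambda}{f(\lambda)},\quad a'_k=a_k,\ k\ge2,\qquad F_f=\sum_{k\ge1}a'_kF^{(k)},$$ where $F^{(k)}$ is the $k$-fold convolution of $F$ with itself. (i) $a=0$ if and only if $F_f$ is a probability distribution and $M\circ\mathcal{H}_f\sim CP\big(f(\lambda),F_f\big)$. In this case the jumps of $M\circ\mathcal{H}_f$ are distributed as $Y=\sum_{h=1}^A X_h$, where $X_1,X_2,\dots$ are i.i.d. with distribution $F$ and $A$ is independent of $X_1,X_2,\dots$ and of $M$, with $P\{A=k\}=a'_k$, $k\ge1$. (ii) Let $a=0$. The probability law $p(t,dx)=P\{M(\mathcal{H}_f(t))\in dx\}$ satisfies $$\frac{d}{dt}p(t,dx)=-f\big(\lambda(I-C_F)\big)p(t,dx),\quad t\ge0,\ x\in\mathbb{R},\qquad p(0,dx)=\delta_0(dx).$$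
   Context: $M\sim CP(\lambda,F)$ means that $M$ has the law, on the càdlàg space $\mathcal D[0,\infty)$, of $\{\sum_{k=1}^{N(t)}X_k\}_{t\ge0}$ with $N$ a Poisson process of rate $\lambda$ and $X_k$ i.i.d. with distribution $F$, independent of $N$. In the Bernstein function, $a,b\ge0$ and $\bar\nu_f$ is a measure on $(0,\infty)$ with $\int_0^\infty(s\wedge1)\,\bar\nu_f(ds)<\infty$. The Bernstein subordinator $\mathcal{H}_f$ is the non-decreasing Lévy process with $\mathbb{E}e^{-\mu\mathcal{H}_f(t)}=e^{-tf(\mu)}$, $\mu,t\ge0$ (if $a>0$ it is killed, i.e. sent to $+\infty$, at rate $a$, with the convention $e^{-\infty}=0$, and then $M\circ\mathcal{H}_f$ is killed as well). $I$ is the identity and $C_F$ is the convolution operator $C_Fg(x)=\int_{\mathbb{R}}g(x-y)F(dy)$ (acting on finite signed measures, $C_Fp=F\ast p$). The operator $f(\lambda(I-C_F))$ is $aI+b\lambda(I-C_F)+\int_0^\infty\big(I-e^{-\lambda w}\sum_{k\ge0}\frac{(\lambda w)^k}{k!}C_F^k\big)\bar\nu_f(dw)$. The equation for $p(t,dx)$ is an identity between signed measures on $\mathbb{R}$ (evaluated on each Borel set). *)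

theory Defs
  imports "HOL-Probability.Probability"
begin

section \<open>Compound Poisson processes\<close>

definition cadlag :: "(real \<Rightarrow> real) \<Rightarrow> bool" where
  "cadlag x \<longleftrightarrow>
     (\<forall>t\<ge>0. continuous (at_right t) x) \<and>
     (\<forall>t>0. \<exists>l. (x \<longlongrightarrow> l) (at_left t))"

text \<open>The space D[0,\<infinity>) with the sigma-algebra generated by the coordinate projections, which is
  the Borel sigma-algebra of the Skorokhod topology. Elements of a product space over {0..} are
  extensional, so a path enters it through its restriction to {0..}.\<close>

definition cadlag_space :: "(real \<Rightarrow> real) measure" where
  "cadlag_space = restrict_space (\<Pi>\<^sub>M t\<in>{0..}. borel) {x. cadlag x}"

definition trajectory :: "(real \<Rightarrow> 'a \<Rightarrow> 'b) \<Rightarrow> 'a \<Rightarrow> real \<Rightarrow> 'b" where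
  "trajectory Z \<omega> = (\<lambda>t\<in>{0..}. Z t \<omega>)"

text \<open>The library's \<^const>\<open>prob_space.indep_var\<close> needs both random variables to have
  the same type; this is the same notion for two types.\<close>

definition indep_rv ::
    "'q measure \<Rightarrow> 'b measure \<Rightarrow> ('q \<Rightarrow> 'b) \<Rightarrow> 'c measure \<Rightarrow> ('q \<Rightarrow> 'c) \<Rightarrow> bool" where
  "indep_rv Q S X T Y \<longleftrightarrow>
     X \<in> measurable Q S \<and> Y \<in> measurable Q T \<and>
     prob_space.indep_set Q {X -` B \<inter> space Q |B. B \<in> sets S} {Y -` B \<inter> space Q |B. B \<in> sets T}"

definition poisson_process :: "'q measure \<Rightarrow> real \<Rightarrow> (real \<Rightarrow> 'q \<Rightarrow> nat) \<Rightarrow> bool" where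
  "poisson_process Q lam N \<longleftrightarrow>
     (\<forall>t\<ge>0. N t \<in> measurable Q (count_space UNIV)) \<and>
     (\<forall>\<omega>\<in>space Q. N 0 \<omega> = 0 \<and> mono_on {0..} (\<lambda>t. N t \<omega>) \<and>
        (\<forall>t\<ge>0. continuous (at_right t) (\<lambda>s. N s \<omega>))) \<and>
     (\<forall>(\<tau> :: nat \<Rightarrow> real) n. 0 \<le> \<tau> 0 \<and> (\<forall>i<n. \<tau> i \<le> \<tau> (Suc i)) \<longrightarrow>
        prob_space.indep_vars Q (\<lambda>_. count_space UNIV)
          (\<lambda>i \<omega>. N (\<tau> (Suc i)) \<omega> - N (\<tau> i) \<omega>) {..<n}) \<and>
     (\<forall>s\<ge>0. \<forall>t>s. distr Q (count_space UNIV) (\<lambda>\<omega>. N t \<omega> - N s \<omega>) =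
        measure_pmf (poisson_pmf (lam * (t - s))))"

definition iid :: "'q measure \<Rightarrow> real measure \<Rightarrow> (nat \<Rightarrow> 'q \<Rightarrow> real) \<Rightarrow> bool" where
  "iid Q F X \<longleftrightarrow>
     prob_space.indep_vars Q (\<lambda>_. borel) X {1..} \<and> (\<forall>k\<ge>1. distr Q borel (X k) = F)"

text \<open>Only the law of the random sum matters, so the Poisson process and the summands may live on
  an auxiliary probability space. An existential quantifier over it needs a fixed type; sequences
  of pairs of reals can carry the inter-arrival times together with the summands.\<close>

definition compound_poisson_law :: "(real \<Rightarrow> real) measure \<Rightarrow> real \<Rightarrow> real measure \<Rightarrow> bool" where
  "compound_poisson_law L lam F \<longleftrightarrow>
     (\<exists>(Q :: (nat \<Rightarrow> real \<times> real) measure) N X.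
        prob_space Q \<and> poisson_process Q lam N \<and> iid Q F X \<and>
        indep_rv Q
          (\<Pi>\<^sub>M t\<in>{0..}. count_space UNIV) (trajectory N)
          (\<Pi>\<^sub>M k\<in>{1..}. borel) (\<lambda>\<omega>. \<lambda>k\<in>{1..}. X k \<omega>) \<and>
        L = distr Q cadlag_space (trajectory (\<lambda>t \<omega>. \<Sum>k=1..N t \<omega>. X k \<omega>)))"

definition compound_poisson ::
    "'a measure \<Rightarrow> (real \<Rightarrow> 'a \<Rightarrow> real) \<Rightarrow> real \<Rightarrow> real measure \<Rightarrow> bool" where
  "compound_poisson P M lam F \<longleftrightarrow>
     trajectory M \<in> measurable P cadlag_space \<and>
     compound_poisson_law (distr P cadlag_space (trajectory M)) lam F"

text \<open>For a process that may be killed (\<^const>\<open>None\<close> is the cemetery): to be compound Poisson,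
  it must almost surely never be killed, and its real-valued cadlag version must have the right law.\<close>

definition killed_compound_poisson ::
    "'a measure \<Rightarrow> (real \<Rightarrow> 'a \<Rightarrow> real option) \<Rightarrow> real \<Rightarrow> real measure \<Rightarrow> bool" where
  "killed_compound_poisson P Y lam F \<longleftrightarrow>
     (\<exists>M. compound_poisson P M lam F \<and> (AE \<omega> in P. \<forall>t\<ge>0. Y t \<omega> = Some (M t \<omega>)))"


section \<open>Bernstein functions and subordinators\<close>

definition bernstein_triplet :: "real \<Rightarrow> real \<Rightarrow> real measure \<Rightarrow> bool" where
  "bernstein_triplet a b \<nu> \<longleftrightarrow>
     0 \<le> a \<and> 0 \<le> b \<and> sets \<nu> = sets borel \<and> emeasure \<nu> {..0} = 0 \<and>
     (\<integral>\<^sup>+s. ennreal (min s 1) \<partial>\<nu>) < \<infinity>"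

definition bernstein :: "real \<Rightarrow> real \<Rightarrow> real measure \<Rightarrow> real \<Rightarrow> real" where
  "bernstein a b \<nu> x = a + b * x + (LINT w|\<nu>. 1 - exp (- x * w))"

text \<open>Killing is absorption in \<infinity>. The fourth clause is the Markov form of independent stationary
  increments: given that the process is alive at time s, its later increments are independent of
  its past and distributed as the process started afresh. The last clause uses the convention
  exp (- \<infinity>) = 0 also for \<mu> = 0, where it says that the process is alive at time t with
  probability exp (- t * a), that is, killing happens at rate a.\<close>

definition bernstein_subordinator ::
    "'a measure \<Rightarrow> real \<Rightarrow> real \<Rightarrow> real measure \<Rightarrow> (real \<Rightarrow> 'a \<Rightarrow> ennreal) \<Rightarrow> bool" where
  "bernstein_subordinator P a b \<nu> H \<longleftrightarrow>
     (\<forall>t\<ge>0. H t \<in> borel_measurable P) \<and>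
     (\<forall>\<omega>\<in>space P. H 0 \<omega> = 0 \<and> mono_on {0..} (\<lambda>t. H t \<omega>)) \<and>
     (\<forall>\<omega>\<in>space P. \<forall>t\<ge>0. continuous (at_right t) (\<lambda>s. H s \<omega>)) \<and>
     (\<forall>s\<ge>0. \<forall>t\<ge>0. \<forall>C\<in>sets (\<Pi>\<^sub>M u\<in>{0..s}. borel). \<forall>B\<in>sets borel.
        measure P {\<omega>\<in>space P. (\<lambda>u\<in>{0..s}. H u \<omega>) \<in> C \<and> H s \<omega> < \<infinity> \<and> H (s + t) \<omega> - H s \<omega> \<in> B} =
        measure P {\<omega>\<in>space P. (\<lambda>u\<in>{0..s}. H u \<omega>) \<in> C \<and> H s \<omega> < \<infinity>} *
        measure P {\<omega>\<in>space P. H t \<omega> \<in> B}) \<and>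
     (\<forall>t\<ge>0. \<forall>\<mu>\<ge>0.
        (LINT \<omega>|P. (if H t \<omega> = \<infinity> then 0 else exp (- \<mu> * enn2real (H t \<omega>)))) =
        exp (- t * bernstein a b \<nu> \<mu>))"

definition subordinate ::
    "(real \<Rightarrow> 'a \<Rightarrow> real) \<Rightarrow> (real \<Rightarrow> 'a \<Rightarrow> ennreal) \<Rightarrow> real \<Rightarrow> 'a \<Rightarrow> real option" where
  "subordinate M H t \<omega> = (if H t \<omega> = \<infinity> then None else Some (M (enn2real (H t \<omega>)) \<omega>))"

definition subordinate_law ::
    "'a measure \<Rightarrow> (real \<Rightarrow> 'a \<Rightarrow> real) \<Rightarrow> (real \<Rightarrow> 'a \<Rightarrow> ennreal) \<Rightarrow> real \<Rightarrow> real set \<Rightarrow> real" where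
  "subordinate_law P M H t B = measure P {\<omega>\<in>space P. subordinate M H t \<omega> \<in> Some ` B}"


section \<open>The jump distribution of the subordinated process\<close>

fun convolution_power :: "real measure \<Rightarrow> nat \<Rightarrow> real measure" where
  "convolution_power F 0 = return borel 0"
| "convolution_power F (Suc k) = convolution F (convolution_power F k)"

definition jump_coeff :: "real \<Rightarrow> real \<Rightarrow> real measure \<Rightarrow> real \<Rightarrow> nat \<Rightarrow> real" where
  "jump_coeff a b \<nu> lam k =
     1 / bernstein a b \<nu> lam * (lam ^ k / fact k) * (LINT w|\<nu>. exp (- lam * w) * w ^ k)"

definition jump_coeff' :: "real \<Rightarrow> real \<Rightarrow> real measure \<Rightarrow> real \<Rightarrow> nat \<Rightarrow> real" where
  "jump_coeff' a b \<nu> lam k =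
     (if k = 1 then jump_coeff a b \<nu> lam 1 + b * lam / bernstein a b \<nu> lam
      else jump_coeff a b \<nu> lam k)"

definition jump_measure :: "real \<Rightarrow> real \<Rightarrow> real measure \<Rightarrow> real \<Rightarrow> real measure \<Rightarrow> real measure" where
  "jump_measure a b \<nu> lam F =
     measure_of UNIV (sets borel)
       (\<lambda>B. \<Sum>k. ennreal (jump_coeff' a b \<nu> lam (Suc k)) * emeasure (convolution_power F (Suc k)) B)"

definition random_sum ::
    "(nat \<Rightarrow> 'q \<Rightarrow> real) \<Rightarrow> ('q \<Rightarrow> nat) \<Rightarrow> 'q \<Rightarrow> real" where
  "random_sum X A \<omega> = (\<Sum>h=1..A \<omega>. X h \<omega>)"


section \<open>The generator\<close>

text \<open>A finite signed measure is represented by its values on Borel sets. The first operator is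
  p \<mapsto> F * p (convolution), the second one is f(\<lambda>(I - C_F)) for the Bernstein function f.\<close>

definition convolution_operator :: "real measure \<Rightarrow> (real set \<Rightarrow> real) \<Rightarrow> real set \<Rightarrow> real" where
  "convolution_operator F p B = (LINT y|F. p {x. x + y \<in> B})"

definition bernstein_operator ::
    "real \<Rightarrow> real \<Rightarrow> real measure \<Rightarrow> real \<Rightarrow> real measure \<Rightarrow> (real set \<Rightarrow> real) \<Rightarrow> real set \<Rightarrow> real" where
  "bernstein_operator a b \<nu> lam F p B =
     a * p B + b * lam * (p B - convolution_operator F p B) +
     (LINT w|\<nu>. p B -
        exp (- lam * w) * (\<Sum>k. (lam * w) ^ k / fact k * (convolution_operator F ^^ k) p B))"

end

theory Submission
  imports Defs
begin

text \<open>Given H, the increments of M at the times H are independent with laws that are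
  Poisson mixtures of the convolution powers of F; integrating out H, the increments of
  M(H(t)) are independent, and that over a time t is a mixture of the F^{(n)} with weights
  E(e^{-\<lambda>H(t)} (\<lambda>H(t))^n / n!). The generating function of these weights at s is
  E e^{-\<lambda>(1-s)H(t)} = e^{-t f(\<lambda>(1-s))} = e^{-t f(\<lambda>) (1 - G(s))} with G(s) = \<Sum> a'_k s^k, because
  f(\<lambda>) - f(\<lambda>(1-s)) = f(\<lambda>) G(s). So the weights are those of A_1 + ... + A_N with N Poisson of
  parameter t f(\<lambda>), and the mixture is the compound Poisson law with jump law \<Sum> a'_k F^{(k)}. The
  law on the space of cadlag paths is determined by the laws of the increments. For (ii), the law
  at time t is e^{-ct} \<Sum> (ct)^n/n! F_f^{(n)} with c = f(\<lambda>); its derivative c (F_f * p - p) is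
  -f(\<lambda>(I - C_F)) p after exchanging series and Levy integral. Conversely, a process that is almost
  surely never killed has a = 0, since it is alive at time t with probability e^{-ta}.\<close>

section \<open>Mixtures of convolution powers\<close>

text \<open>Two transforms are used because each has a limited domain. The Laplace transform of H is
  given at real arguments only, so it can identify the Poisson mixing weights through generating
  functions at real s. Laws on the line are compared afterwards by characteristic functions, once no
  expectation over H is left. Using characteristic functions throughout would require E e^{-zH(t)}
  at the complex points z = \<lambda>(1 - \<phi>_F(\<theta>)). Being compound Poisson is an
  existential statement about a process on some other probability space. The property
  \<open>has_increments\<close> replaces it: it depends on the path law alone, so it can be read off
  from a witness; it carries over to an independent time change; and it fixes the path law, so that
  a comparison with a new witness is enough at the end.\<close>

lemma integral_bind_bounded_real:
  fixes f :: "'b \<Rightarrow> real"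
  assumes M: "prob_space M" and K: "K \<in> measurable M (prob_algebra N)"
    and f [measurable]: "f \<in> borel_measurable N" and B: "\<And>x. \<bar>f x\<bar> \<le> B"
  shows "(LINT x|(M \<bind> K). f x) = (LINT y|M. LINT x|K y. f x)"
    and "(\<lambda>y. LINT x|K y. f x) \<in> borel_measurable M"
    and "\<And>y. y \<in> space M \<Longrightarrow> \<bar>LINT x|K y. f x\<bar> \<le> B"
proof -
  interpret M: prob_space M by fact
  have K' [measurable]: "K \<in> measurable M (subprob_algebra N)"
    using K by (rule measurable_prob_algebraD)
  have KP: "prob_space (K y)" "sets (K y) = sets N" if "y \<in> space M" for y
    using measurable_space[OF K that] by (auto simp: space_prob_algebra)
  have bind: "prob_space (M \<bind> K)" "sets (M \<bind> K) = sets N"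
    using M.prob_space_axioms K
    by (auto intro!: M.prob_space_bind[where S=N] sets_bind[OF _ M.not_empty] AE_I2 KP)
  interpret B: prob_space "M \<bind> K" by fact
  have int: "integrable L f" "integrable L (\<lambda>x. f x + B)" if "prob_space L" "sets L = sets N" for L
  proof -
    interpret prob_space L by fact
    have m: "f \<in> borel_measurable L" using f that(2) by (simp cong: measurable_cong_sets)
    show "integrable L f" by (rule integrable_const_bound[of _ B]) (use m B in auto)
    then show "integrable L (\<lambda>x. f x + B)" by auto
  qed
  \<comment> \<open>Adding the bound B makes the integrand nonnegative, so measurability and the
    bind formula come from the nonnegative integral. The constant can be subtracted again at the end
    because all measures involved are probability measures.\<close>
  have nn: "(\<integral>\<^sup>+x. ennreal (f x + B) \<partial>L) = ennreal ((LINT x|L. f x) + B)"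
    and ge: "(LINT x|L. f x) + B \<ge> 0" if "prob_space L" "sets L = sets N" for L
  proof -
    interpret prob_space L by fact
    have nonneg: "f x + B \<ge> 0" for x using B[of x] by (simp add: abs_le_iff)
    have "(LINT x|L. f x + B) = (LINT x|L. f x) + B"
      using int[OF that] by (simp add: prob_space)
    then show "(\<integral>\<^sup>+x. ennreal (f x + B) \<partial>L) = ennreal ((LINT x|L. f x) + B)"
      using nn_integral_eq_integral[OF int(2)[OF that]] nonneg by simp
    have "(LINT x|L. f x + B) \<ge> 0" by (intro integral_nonneg_AE) (use nonneg in auto)
    then show "(LINT x|L. f x) + B \<ge> 0" using \<open>(LINT x|L. f x + B) = _\<close> by simp
  qed
  have meas: "(\<lambda>y. \<integral>\<^sup>+x. ennreal (f x + B) \<partial>K y) \<in> borel_measurable M"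
    by (rule measurable_compose[OF K'])
       (auto intro!: nn_integral_measurable_subprob_algebra)
  have "(\<lambda>y. enn2real (\<integral>\<^sup>+x. ennreal (f x + B) \<partial>K y) - B) \<in> borel_measurable M"
    using meas by measurable
  also have "?this \<longleftrightarrow> (\<lambda>y. LINT x|K y. f x) \<in> borel_measurable M"
    by (intro measurable_cong) (use nn ge KP in auto)
  finally show m: "(\<lambda>y. LINT x|K y. f x) \<in> borel_measurable M" .
  show bd: "\<bar>LINT x|K y. f x\<bar> \<le> B" if y: "y \<in> space M" for y
  proof -
    interpret prob_space "K y" by (rule KP[OF y])
    have "\<bar>LINT x|K y. f x\<bar> \<le> (LINT x|K y. \<bar>f x\<bar>)" by (rule integral_abs_bound)
    also have "\<dots> \<le> (LINT x|K y. B)"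
      by (intro integral_mono integrable_abs int KP y) (use B in auto)
    finally show ?thesis by (simp add: prob_space)
  qed
  have mint: "integrable M (\<lambda>y. LINT x|K y. f x)"
    by (rule M.integrable_const_bound[of _ B]) (use bd m in auto)
  have "ennreal ((LINT x|(M \<bind> K). f x) + B) = (\<integral>\<^sup>+x. ennreal (f x + B) \<partial>(M \<bind> K))"
    using nn[OF bind] by simp
  also have "\<dots> = (\<integral>\<^sup>+y. \<integral>\<^sup>+x. ennreal (f x + B) \<partial>K y \<partial>M)"
    by (rule nn_integral_bind[OF _ K']) auto
  also have "\<dots> = (\<integral>\<^sup>+y. ennreal ((LINT x|K y. f x) + B) \<partial>M)"
    by (intro nn_integral_cong nn KP)
  also have "\<dots> = ennreal (LINT y|M. (LINT x|K y. f x) + B)"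
    by (intro nn_integral_eq_integral) (use mint ge KP in auto)
  also have "(LINT y|M. (LINT x|K y. f x) + B) = (LINT y|M. LINT x|K y. f x) + B"
    using mint by (simp add: M.prob_space)
  finally have "(LINT x|(M \<bind> K). f x) + B = (LINT y|M. LINT x|K y. f x) + B"
  proof (subst (asm) ennreal_inj)
    show "0 \<le> (LINT x|(M \<bind> K). f x) + B" by (rule ge[OF bind])
    have "0 \<le> (LINT y|M. (LINT x|K y. f x) + B)" by (intro integral_nonneg_AE) (use ge KP in auto)
    then show "0 \<le> (LINT y|M. LINT x|K y. f x) + B"
      using mint by (simp add: M.prob_space)
  qed
  then show "(LINT x|(M \<bind> K). f x) = (LINT y|M. LINT x|K y. f x)" by simp
qed

lemma integral_bind_bounded:
  fixes f :: "'b \<Rightarrow> complex"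
  assumes M: "prob_space M" and K: "K \<in> measurable M (prob_algebra N)"
    and f [measurable]: "f \<in> borel_measurable N" and B: "\<And>x. norm (f x) \<le> B"
  shows "(LINT x|(M \<bind> K). f x) = (LINT y|M. LINT x|K y. f x)"
proof -
  interpret M: prob_space M by fact
  have KP: "prob_space (K y)" "sets (K y) = sets N" if "y \<in> space M" for y
    using measurable_space[OF K that] by (auto simp: space_prob_algebra)
  have bind: "prob_space (M \<bind> K)" "sets (M \<bind> K) = sets N"
    using M.prob_space_axioms K
    by (auto intro!: M.prob_space_bind[where S=N] sets_bind[OF _ M.not_empty] AE_I2 KP measurable_prob_algebraD)
  have int: "integrable L f" if "prob_space L" "sets L = sets N" for L
  proof -
    interpret prob_space L by fact
    have m: "f \<in> borel_measurable L" using f that(2) by (simp cong: measurable_cong_sets)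
    show "integrable L f" by (rule integrable_const_bound[of _ B]) (use m B in auto)
  qed
  have Bre: "\<bar>Re (f x)\<bar> \<le> B" "\<bar>Im (f x)\<bar> \<le> B" for x
    using B[of x] abs_Re_le_cmod[of "f x"] abs_Im_le_cmod[of "f x"] by linarith+
  note re = integral_bind_bounded_real[where f="\<lambda>x. Re (f x)", OF M K _ Bre(1)]
    and im = integral_bind_bounded_real[where f="\<lambda>x. Im (f x)", OF M K _ Bre(2)]
  have m: "(\<lambda>y. LINT x|K y. f x) \<in> borel_measurable M"
  proof -
    have "(\<lambda>y. Re (LINT x|K y. f x)) \<in> borel_measurable M \<longleftrightarrow> (\<lambda>y. LINT x|K y. Re (f x)) \<in> borel_measurable M"
      "(\<lambda>y. Im (LINT x|K y. f x)) \<in> borel_measurable M \<longleftrightarrow> (\<lambda>y. LINT x|K y. Im (f x)) \<in> borel_measurable M"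
      by (auto intro!: measurable_cong simp: int KP)
    then show ?thesis using re(2) im(2) by (simp add: borel_measurable_complex_iff)
  qed
  have mint: "integrable M (\<lambda>y. LINT x|K y. f x)"
  proof (rule M.integrable_const_bound[of _ "B + B"])
    show "AE y in M. norm (LINT x|K y. f x) \<le> B + B"
    proof (rule AE_I2)
      fix y assume y: "y \<in> space M"
      have "norm (LINT x|K y. f x) \<le> \<bar>Re (LINT x|K y. f x)\<bar> + \<bar>Im (LINT x|K y. f x)\<bar>"
        by (rule cmod_le)
      also have "\<dots> \<le> B + B"
        using re(3)[OF _ y] im(3)[OF _ y] int[OF KP[OF y]] by (intro add_mono) auto
      finally show "norm (LINT x|K y. f x) \<le> B + B" .
    qed
  qed (rule m)
  show ?thesis
  proof (rule complex_eqI)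
    show "Re (LINT x|(M \<bind> K). f x) = Re (LINT y|M. LINT x|K y. f x)"
      using re(1) int[OF bind] mint int[OF KP]
      by (auto intro!: Bochner_Integration.integral_cong simp flip: integral_Re)
    show "Im (LINT x|(M \<bind> K). f x) = Im (LINT y|M. LINT x|K y. f x)"
      using im(1) int[OF bind] mint int[OF KP]
      by (auto intro!: Bochner_Integration.integral_cong simp flip: integral_Im)
  qed
qed

section \<open>Generating functions of laws on the natural numbers\<close>

lemma integral_pmf_nat_sums:
  fixes f :: "nat \<Rightarrow> 'b :: {banach, second_countable_topology}"
  assumes "\<And>n. norm (f n) \<le> B"
  shows "(\<lambda>n. pmf p n *\<^sub>R f n) sums (LINT n|measure_pmf p. f n)"
proof -
  have "integrable (measure_pmf p) f"
    by (rule measure_pmf.integrable_const_bound[where B=B]) (use assms in auto)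
  then have "integrable (count_space UNIV) (\<lambda>n. pmf p n *\<^sub>R f n)"
    unfolding measure_pmf_eq_density by (subst (asm) integrable_density) auto
  then have "(\<lambda>n. pmf p n *\<^sub>R f n) sums (LINT n|count_space UNIV. pmf p n *\<^sub>R f n)"
    by (rule sums_integral_count_space_nat)
  then show ?thesis
    unfolding measure_pmf_eq_density by (subst integral_density) auto
qed

lemma nn_integral_pmf_nat:
  "(\<integral>\<^sup>+n. f n \<partial>measure_pmf p) = (\<Sum>n::nat. ennreal (pmf p n) * f n)"
  by (simp add: nn_integral_measure_pmf nn_integral_count_space_nat)

text \<open>The argument is complex because generating functions are evaluated both at real s, to identify
  weights, and at values of a characteristic function, to identify mixtures.\<close>

definition pgf :: "nat pmf \<Rightarrow> complex \<Rightarrow> complex" where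
  "pgf p z = (LINT n|measure_pmf p. z ^ n)"

lemma pgf_sums:
  assumes "norm z \<le> 1"
  shows "(\<lambda>n. of_real (pmf p n) * z ^ n) sums pgf p z"
  using integral_pmf_nat_sums[of "\<lambda>n. z ^ n" 1 p] assms
  by (simp add: pgf_def norm_power power_le_one scaleR_conv_of_real)

text \<open>Once the coefficients below n vanish, dividing by x^n leaves a power series that is 0 at
  all small x \<noteq> 0, and its limit at 0 is the coefficient a n.\<close>

lemma powser_eq_0:
  fixes a :: "nat \<Rightarrow> real"
  assumes "0 < s" and "\<And>x. \<bar>x\<bar> < s \<Longrightarrow> (\<lambda>n. a n * x ^ n) sums 0"
  shows "a n = 0"
proof (induction n rule: less_induct)
  case (less n)
  have "(\<lambda>k. a (k + n) * x ^ k) sums 0" if "x \<noteq> 0" "norm x < s" for x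
  proof -
    have "(\<lambda>k. a (k + n) * x ^ (k + n)) sums (0 - (\<Sum>i<n. a i * x ^ i))"
      using that assms(2)[of x] by (subst sums_iff_shift) auto
    then have "(\<lambda>k. a (k + n) * x ^ (k + n) / x ^ n) sums ((0 - (\<Sum>i<n. a i * x ^ i)) / x ^ n)"
      by (rule sums_divide)
    then show ?thesis using that less by (simp add: power_add field_simps)
  qed
  then have "((\<lambda>x::real. 0) \<longlongrightarrow> a (0 + n)) (at 0)"
    by (rule powser_limit_0_strong[OF assms(1)])
  then show ?case by (simp add: tendsto_const_iff)
qed

lemma pgf_inject:
  assumes "\<And>s. \<bar>s\<bar> < 1 \<Longrightarrow> pgf p (of_real s) = pgf q (of_real s)"
  shows "p = q"
proof (rule pmf_eqI)
  fix n
  have "pmf p n - pmf q n = 0"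
  proof (rule powser_eq_0[of 1])
    fix x :: real assume x: "\<bar>x\<bar> < 1"
    have "(\<lambda>n. complex_of_real (pmf p n) * of_real x ^ n - of_real (pmf q n) * of_real x ^ n) sums 0"
      using sums_diff[OF pgf_sums[of "of_real x" p] pgf_sums[of "of_real x" q]] x assms[OF x] by simp
    then have "(\<lambda>n. complex_of_real ((pmf p n - pmf q n) * x ^ n)) sums of_real 0"
      by (simp add: algebra_simps)
    then show "(\<lambda>n. (pmf p n - pmf q n) * x ^ n) sums 0"
      by (simp only: sums_of_real_iff)
  qed simp
  then show "pmf p n = pmf q n" by simp
qed

lemma norm_pgf_le_1: assumes "norm z \<le> 1" shows "norm (pgf p z) \<le> 1"
proof -
  have "norm (pgf p z) \<le> (LINT n|measure_pmf p. norm (z ^ n))"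
    unfolding pgf_def by (rule integral_norm_bound)
  also have "\<dots> \<le> (LINT n|measure_pmf p. 1)"
    using assms by (intro integral_mono measure_pmf.integrable_const_bound[where B=1])
      (auto simp: norm_power power_le_one)
  finally show ?thesis by simp
qed

lemma pgf_bind:
  assumes "norm z \<le> 1"
  shows "pgf (bind_pmf p K) z = (LINT i|measure_pmf p. pgf (K i) z)"
  unfolding pgf_def measure_pmf_bind
  by (rule integral_bind_bounded[where N="count_space UNIV" and B=1])
     (use assms in \<open>auto simp: norm_power power_le_one space_prob_algebra measure_pmf.prob_space_axioms\<close>)

text \<open>The n-fold convolution power of p. With n drawn from a Poisson law it yields the law of
  A_1 + ... + A_N, the integer-valued counterpart of the compound Poisson law.\<close>

primrec sum_pmf :: "nat pmf \<Rightarrow> nat \<Rightarrow> nat pmf" where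
  "sum_pmf p 0 = return_pmf 0"
| "sum_pmf p (Suc n) = bind_pmf p (\<lambda>i. map_pmf ((+) i) (sum_pmf p n))"

lemma pgf_sum_pmf: "norm z \<le> 1 \<Longrightarrow> pgf (sum_pmf p n) z = pgf p z ^ n"
proof (induction n)
  case 0 then show ?case by (simp add: pgf_def)
next
  case (Suc n)
  have "pgf (map_pmf ((+) i) (sum_pmf p n)) z = z ^ i * pgf (sum_pmf p n) z" for i
    by (simp add: pgf_def power_add)
  with Suc show ?case
    by (simp add: pgf_bind) (simp add: pgf_def)
qed

text \<open>\<^const>\<open>poisson_pmf\<close> is only specified for a positive parameter.\<close>

definition poisson0 :: "real \<Rightarrow> nat pmf" where
  "poisson0 c = (if c > 0 then poisson_pmf c else return_pmf 0)"

lemma pmf_poisson0: "c \<ge> 0 \<Longrightarrow> pmf (poisson0 c) n = c ^ n / fact n * exp (- c)"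
  by (cases "c = 0") (auto simp: poisson0_def indicator_def power_0_left)

lemma pgf_poisson0:
  assumes "c \<ge> 0" "norm z \<le> 1"
  shows "pgf (poisson0 c) z = exp (- of_real c * (1 - z))"
proof -
  have "(\<lambda>n. exp (- of_real c) * ((of_real c * z) ^ n /\<^sub>R fact n)) sums (exp (- of_real c) * exp (of_real c * z))"
    by (intro sums_mult exp_converges)
  also have "exp (- of_real c) * exp (of_real c * z) = exp (- of_real c * (1 - z))"
    by (simp add: exp_add[symmetric] algebra_simps)
  also have "(\<lambda>n. exp (- of_real c) * ((of_real c * z) ^ n /\<^sub>R fact n))
    = (\<lambda>n. of_real (pmf (poisson0 c) n) * z ^ n)"
    using assms by (auto simp: pmf_poisson0 fun_eq_iff scaleR_conv_of_real power_mult_distrib divide_inverse exp_of_real[symmetric])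
  finally show ?thesis using pgf_sums[OF assms(2)] sums_unique2 by blast
qed

text \<open>Generating functions compose under random summation: for n summands the value is
  \<open>pgf p z ^ n\<close>, and averaging over n evaluates the Poisson generating function at
  \<open>pgf p z\<close>, which stays in the unit disc.\<close>

lemma pgf_poisson0_sum:
  assumes "c \<ge> 0" "norm z \<le> 1"
  shows "pgf (bind_pmf (poisson0 c) (sum_pmf p)) z = exp (- of_real c * (1 - pgf p z))"
proof -
  have "pgf (bind_pmf (poisson0 c) (sum_pmf p)) z = pgf (poisson0 c) (pgf p z)"
    using assms by (simp add: pgf_bind pgf_sum_pmf) (simp add: pgf_def)
  then show ?thesis using assms norm_pgf_le_1 by (simp add: pgf_poisson0)
qed

section \<open>Convolution powers, their mixtures and characteristic functions\<close>

lemma real_distribution_convolution: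
  assumes "real_distribution F" "real_distribution G"
  shows "real_distribution (convolution F G)"
proof -
  interpret F: real_distribution F by fact
  interpret G: real_distribution G by fact
  interpret FG: pair_prob_space F G ..
  have "prob_space (convolution F G)"
    unfolding convolution_def by (intro FG.prob_space_distr) simp
  then show ?thesis by (simp add: real_distribution_def real_distribution_axioms_def)
qed

lemma real_distribution_return: "real_distribution (return borel x)"
  by (simp add: real_distribution_def real_distribution_axioms_def prob_space_return)

lemma real_distribution_convolution_power:
  "real_distribution F \<Longrightarrow> real_distribution (convolution_power F k)"
  by (induction k) (auto intro: real_distribution_convolution real_distribution_return)

lemma char_convolution:
  assumes "real_distribution F" "real_distribution G"
  shows "char (convolution F G) t = char F t * char G t"
proof -
  interpret F: real_distribution F by fact
  interpret G: real_distribution G by fact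
  interpret FG: pair_prob_space F G ..
  have "char (convolution F G) t = (LINT z|(F \<Otimes>\<^sub>M G). iexp (t * (fst z + snd z)))"
    unfolding char_def convolution_def by (subst integral_distr) (auto simp: case_prod_beta')
  also have "\<dots> = (LINT z|(F \<Otimes>\<^sub>M G). iexp (t * fst z) * iexp (t * snd z))"
    by (simp add: algebra_simps exp_add)
  also have "\<dots> = (LINT x|F. LINT y|G. iexp (t * x) * iexp (t * y))"
    by (subst FG.integral_fst'[symmetric])
       (auto intro!: FG.integrable_const_bound[of _ 1] simp: norm_mult)
  also have "\<dots> = char F t * char G t"
    by (simp add: char_def)
  finally show ?thesis .
qed

lemma char_convolution_power:
  assumes "real_distribution F"
  shows "char (convolution_power F k) t = char F t ^ k"
proof (induction k)
  case 0 show ?case by (simp add: char_def integral_return)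
next
  case (Suc k) then show ?case
    by (simp add: char_convolution real_distribution_convolution_power assms)
qed

text \<open>The law of X_1 + ... + X_K, with K of law p independent of the i.i.d. X_i of law F. Both
  the jump law F_f (p given by the weights a'_k) and the time marginals of a compound Poisson
  process (p Poisson) have this form.\<close>

definition mixture :: "nat pmf \<Rightarrow> real measure \<Rightarrow> real measure" where
  "mixture p F = measure_pmf p \<bind> convolution_power F"

context
  fixes F assumes F: "real_distribution F"
begin

lemma convolution_power_kernel:
  "convolution_power F \<in> measurable (measure_pmf p) (prob_algebra borel)"
  using real_distribution_convolution_power[OF F]
  by (auto simp: measurable_def space_prob_algebra real_distribution_def real_distribution_axioms_def)

lemma real_distribution_mixture: "real_distribution (mixture p F)"
  unfolding real_distribution_def real_distribution_axioms_def mixture_def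
  using convolution_power_kernel real_distribution_convolution_power[OF F]
  by (auto intro!: measure_pmf.prob_space_bind[where S=borel] measurable_prob_algebraD sets_bind[where N=borel]
        simp: real_distribution_def real_distribution_axioms_def)

lemma emeasure_mixture:
  "B \<in> sets borel \<Longrightarrow> emeasure (mixture p F) B = (\<integral>\<^sup>+n. emeasure (convolution_power F n) B \<partial>measure_pmf p)"
  unfolding mixture_def
  by (rule emeasure_bind[where N=borel, OF _ measurable_prob_algebraD[OF convolution_power_kernel]]) simp_all

lemma emeasure_mixture_suminf:
  "B \<in> sets borel \<Longrightarrow>
    emeasure (mixture p F) B = (\<Sum>n. ennreal (pmf p n) * emeasure (convolution_power F n) B)"
  by (simp add: emeasure_mixture nn_integral_pmf_nat)

lemma measure_mixture_sums:
  assumes B: "B \<in> sets borel"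
  shows "(\<lambda>n. pmf p n * measure (convolution_power F n) B) sums measure (mixture p F) B"
proof -
  interpret real_distribution "mixture p F" by (rule real_distribution_mixture)
  have *: "emeasure (convolution_power F n) B = ennreal (measure (convolution_power F n) B)" for n
  proof -
    interpret c: real_distribution "convolution_power F n" by (rule real_distribution_convolution_power[OF F])
    show ?thesis by (rule c.emeasure_eq_measure)
  qed
  have "(\<Sum>n. ennreal (pmf p n * measure (convolution_power F n) B)) = ennreal (measure (mixture p F) B)"
    using emeasure_mixture_suminf[OF B, of p] by (simp add: * emeasure_eq_measure ennreal_mult')
  moreover have "(\<lambda>n. ennreal (pmf p n * measure (convolution_power F n) B)) sums
     (\<Sum>n. ennreal (pmf p n * measure (convolution_power F n) B))" by (rule summable_sums) auto
  ultimately show ?thesis by (simp add: sums_ennreal)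
qed

lemma char_mixture: "char (mixture p F) t = pgf p (char F t)"
proof -
  have "char (mixture p F) t = (LINT n|measure_pmf p. char (convolution_power F n) t)"
    unfolding char_def mixture_def
    by (rule integral_bind_bounded[OF measure_pmf.prob_space_axioms convolution_power_kernel, where B=1]) auto
  then show ?thesis by (simp add: char_convolution_power F pgf_def)
qed

end

text \<open>Both characteristic functions are exp (-c (1 - G(\<phi>))), with G the generating
  function of p and \<phi> the characteristic function of F. This links the two descriptions of the
  result: averaging over H yields a mixture of powers of F, while the target is a Poisson mixture of
  powers of F_f.\<close>

lemma mixture_poisson0_mixture:
  assumes F: "real_distribution F" and c: "c \<ge> 0"
  shows "mixture (poisson0 c) (mixture p F) = mixture (bind_pmf (poisson0 c) (sum_pmf p)) F"
proof (rule Levy_uniqueness)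
  show "char (mixture (poisson0 c) (mixture p F)) = char (mixture (bind_pmf (poisson0 c) (sum_pmf p)) F)"
  proof
    fix t
    interpret real_distribution F by fact
    show "char (mixture (poisson0 c) (mixture p F)) t = char (mixture (bind_pmf (poisson0 c) (sum_pmf p)) F) t"
      using c by (simp add: char_mixture F real_distribution_mixture pgf_poisson0 pgf_poisson0_sum
        cmod_char_le_1 norm_pgf_le_1)
  qed
qed (auto intro!: real_distribution_mixture F)

section \<open>Processes with stationary independent increments\<close>

lemma indep_rv_distr_pair:
  assumes Q: "prob_space Q" and ind: "indep_rv Q S X T Y"
  shows "distr Q (S \<Otimes>\<^sub>M T) (\<lambda>\<omega>. (X \<omega>, Y \<omega>)) = distr Q S X \<Otimes>\<^sub>M distr Q T Y"
proof -
  interpret prob_space Q by fact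
  have X [measurable]: "X \<in> measurable Q S" and Y [measurable]: "Y \<in> measurable Q T"
    and iset: "indep_set {X -` B \<inter> space Q |B. B \<in> sets S} {Y -` B \<inter> space Q |B. B \<in> sets T}"
    using ind by (auto simp: indep_rv_def)
  interpret X: prob_space "distr Q S X" by (rule prob_space_distr) simp
  interpret Y: prob_space "distr Q T Y" by (rule prob_space_distr) simp
  show ?thesis
  proof (rule pair_measure_eqI[symmetric])
    fix A B assume "A \<in> sets (distr Q S X)" "B \<in> sets (distr Q T Y)"
    then have [measurable]: "A \<in> sets S" "B \<in> sets T" by auto
    have "prob ((X -` A \<inter> space Q) \<inter> (Y -` B \<inter> space Q)) = prob (X -` A \<inter> space Q) * prob (Y -` B \<inter> space Q)"
      by (rule indep_setD[OF iset]) auto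
    moreover have "(X -` A \<inter> space Q) \<inter> (Y -` B \<inter> space Q) = (\<lambda>\<omega>. (X \<omega>, Y \<omega>)) -` (A \<times> B) \<inter> space Q"
      by auto
    ultimately show "emeasure (distr Q S X) A * emeasure (distr Q T Y) B =
        emeasure (distr Q (S \<Otimes>\<^sub>M T) (\<lambda>\<omega>. (X \<omega>, Y \<omega>))) (A \<times> B)"
      by (simp add: emeasure_distr emeasure_eq_measure ennreal_mult')
  qed (auto intro: X.sigma_finite_measure Y.sigma_finite_measure cong: sets_pair_measure_cong)
qed

lemma indep_rvI:
  assumes Q: "prob_space Q" and X: "X \<in> measurable Q S" and Y: "Y \<in> measurable Q T"
    and eq: "\<And>A B. A \<in> sets S \<Longrightarrow> B \<in> sets T \<Longrightarrow>
      measure Q {\<omega>\<in>space Q. X \<omega> \<in> A \<and> Y \<omega> \<in> B} =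
      measure Q {\<omega>\<in>space Q. X \<omega> \<in> A} * measure Q {\<omega>\<in>space Q. Y \<omega> \<in> B}"
  shows "indep_rv Q S X T Y"
proof -
  interpret prob_space Q by fact
  note [measurable] = X Y
  show ?thesis
    unfolding indep_rv_def
  proof (intro conjI indep_setI X Y)
    fix a b assume "a \<in> {X -` B \<inter> space Q |B. B \<in> sets S}" "b \<in> {Y -` B \<inter> space Q |B. B \<in> sets T}"
    then obtain A B where AB: "a = X -` A \<inter> space Q" "A \<in> sets S" "b = Y -` B \<inter> space Q" "B \<in> sets T" by auto
    have "a \<inter> b = {\<omega>\<in>space Q. X \<omega> \<in> A \<and> Y \<omega> \<in> B}" "a = {\<omega>\<in>space Q. X \<omega> \<in> A}" "b = {\<omega>\<in>space Q. Y \<omega> \<in> B}"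
      using AB by auto
    then show "prob (a \<inter> b) = prob a * prob b" using eq[OF AB(2,4)] by simp
  qed auto
qed

lemma indep_rv_compose:
  assumes Q: "prob_space Q" and ind: "indep_rv Q S X T Y"
    and f: "f \<in> measurable S S'" and g: "g \<in> measurable T T'"
  shows "indep_rv Q S' (\<lambda>\<omega>. f (X \<omega>)) T' (\<lambda>\<omega>. g (Y \<omega>))"
proof -
  interpret prob_space Q by fact
  note [measurable] = f g
  have X [measurable]: "X \<in> measurable Q S" and Y [measurable]: "Y \<in> measurable Q T"
    and iset: "indep_set {X -` B \<inter> space Q |B. B \<in> sets S} {Y -` B \<inter> space Q |B. B \<in> sets T}"
    using ind by (auto simp: indep_rv_def)
  show ?thesis
  proof (rule indep_rvI[OF Q])
    fix A B assume [measurable]: "A \<in> sets S'" "B \<in> sets T'"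
    have "prob ((X -` (f -` A \<inter> space S) \<inter> space Q) \<inter> (Y -` (g -` B \<inter> space T) \<inter> space Q)) =
      prob (X -` (f -` A \<inter> space S) \<inter> space Q) * prob (Y -` (g -` B \<inter> space T) \<inter> space Q)"
      by (rule indep_setD[OF iset]) ((rule CollectI, rule exI, rule conjI, rule refl, rule measurable_sets, fact, fact)+)
    moreover have "X -` (f -` A \<inter> space S) \<inter> space Q = {\<omega>\<in>space Q. f (X \<omega>) \<in> A}"
      "Y -` (g -` B \<inter> space T) \<inter> space Q = {\<omega>\<in>space Q. g (Y \<omega>) \<in> B}"
      using measurable_space[OF X] measurable_space[OF Y] by auto
    moreover have "{\<omega>\<in>space Q. f (X \<omega>) \<in> A} \<inter> {\<omega>\<in>space Q. g (Y \<omega>) \<in> B} = {\<omega>\<in>space Q. f (X \<omega>) \<in> A \<and> g (Y \<omega>) \<in> B}"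
      by auto
    ultimately show "prob {\<omega>\<in>space Q. f (X \<omega>) \<in> A \<and> g (Y \<omega>) \<in> B} =
      prob {\<omega>\<in>space Q. f (X \<omega>) \<in> A} * prob {\<omega>\<in>space Q. g (Y \<omega>) \<in> B}" by simp
  qed auto
qed

lemma indep_rv_emeasure:
  assumes Q: "prob_space Q" and ind: "indep_rv Q S X T Y" and E [measurable]: "E \<in> sets (S \<Otimes>\<^sub>M T)"
  shows "emeasure Q {\<omega>\<in>space Q. (X \<omega>, Y \<omega>) \<in> E} =
    (\<integral>\<^sup>+\<omega>. emeasure Q {\<omega>'\<in>space Q. (X \<omega>, Y \<omega>') \<in> E} \<partial>Q)"
proof -
  interpret prob_space Q by fact
  have X [measurable]: "X \<in> measurable Q S" and Y [measurable]: "Y \<in> measurable Q T"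
    using ind by (auto simp: indep_rv_def)
  interpret Y: prob_space "distr Q T Y" by (rule prob_space_distr) simp
  have "emeasure Q {\<omega>\<in>space Q. (X \<omega>, Y \<omega>) \<in> E} = emeasure (distr Q (S \<Otimes>\<^sub>M T) (\<lambda>\<omega>. (X \<omega>, Y \<omega>))) E"
    by (subst emeasure_distr) (auto intro!: arg_cong[where f="emeasure Q"])
  also have "\<dots> = (\<integral>\<^sup>+x. emeasure (distr Q T Y) (Pair x -` E) \<partial>distr Q S X)"
    unfolding indep_rv_distr_pair[OF Q ind]
    by (rule Y.emeasure_pair_measure_alt) (simp cong: sets_pair_measure_cong)
  also have "\<dots> = (\<integral>\<^sup>+\<omega>. emeasure (distr Q T Y) (Pair (X \<omega>) -` E) \<partial>Q)"
  proof -
    have "(\<lambda>x. emeasure (distr Q T Y) (Pair x -` E)) \<in> borel_measurable S"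
      by (rule Y.measurable_emeasure_Pair) (simp cong: sets_pair_measure_cong)
    then show ?thesis by (subst nn_integral_distr[OF X]) auto
  qed
  also have "\<dots> = (\<integral>\<^sup>+\<omega>. emeasure Q {\<omega>'\<in>space Q. (X \<omega>, Y \<omega>') \<in> E} \<partial>Q)"
  proof (rule nn_integral_cong)
    fix \<omega>
    have "emeasure (distr Q T Y) (Pair (X \<omega>) -` E) = emeasure Q (Y -` (Pair (X \<omega>) -` E) \<inter> space Q)"
      by (rule emeasure_distr[OF Y sets_Pair1[OF E]])
    also have "Y -` (Pair (X \<omega>) -` E) \<inter> space Q = {\<omega>'\<in>space Q. (X \<omega>, Y \<omega>') \<in> E}" by auto
    finally show "emeasure (distr Q T Y) (Pair (X \<omega>) -` E) = emeasure Q {\<omega>'\<in>space Q. (X \<omega>, Y \<omega>') \<in> E}" .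
  qed
  finally show ?thesis .
qed

section \<open>Path space and the laws of increments\<close>

lemma measurable_cadlag_space_iff:
  "trajectory Z \<in> measurable Q cadlag_space \<longleftrightarrow>
    (\<forall>t\<ge>0. Z t \<in> borel_measurable Q) \<and> (\<forall>\<omega>\<in>space Q. cadlag (trajectory Z \<omega>))"
proof -
  have "trajectory Z \<in> measurable Q (\<Pi>\<^sub>M t\<in>{0..}. borel) \<longleftrightarrow> (\<forall>t\<ge>0. Z t \<in> borel_measurable Q)"
  proof
    assume *: "trajectory Z \<in> measurable Q (\<Pi>\<^sub>M t\<in>{0..}. borel)"
    show "\<forall>t\<ge>0. Z t \<in> borel_measurable Q"
    proof (intro allI impI)
      fix t :: real assume "t \<ge> 0"
      then have "(\<lambda>\<omega>. trajectory Z \<omega> t) \<in> borel_measurable Q"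
        by (intro measurable_compose[OF * measurable_component_singleton]) auto
      with \<open>t \<ge> 0\<close> show "Z t \<in> borel_measurable Q" by (simp add: trajectory_def)
    qed
  next
    assume "\<forall>t\<ge>0. Z t \<in> borel_measurable Q"
    then show "trajectory Z \<in> measurable Q (\<Pi>\<^sub>M t\<in>{0..}. borel)"
      unfolding trajectory_def by (intro measurable_restrict) auto
  qed
  then show ?thesis by (auto simp: cadlag_space_def measurable_restrict_space2_iff)
qed

lemma measurable_trajectory:
  assumes "\<And>t. t \<ge> 0 \<Longrightarrow> Z t \<in> measurable Q N"
  shows "trajectory Z \<in> measurable Q (\<Pi>\<^sub>M t\<in>{0..}. N)"
  unfolding trajectory_def by (intro measurable_restrict) (use assms in auto)

lemma measurable_eval_cadlag:
  "t \<ge> 0 \<Longrightarrow> (\<lambda>x. x t) \<in> borel_measurable cadlag_space"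
  unfolding cadlag_space_def by (intro measurable_restrict_space1 measurable_component_singleton) auto

text \<open>\<open>\<kappa> u\<close> is the law of an increment over a time of length u.\<close>

definition has_increments :: "'q measure \<Rightarrow> (real \<Rightarrow> 'q \<Rightarrow> real) \<Rightarrow> (real \<Rightarrow> real measure) \<Rightarrow> bool" where
  "has_increments Q Z \<kappa> \<longleftrightarrow>
     (\<forall>t\<ge>0. Z t \<in> borel_measurable Q) \<and> (AE \<omega> in Q. Z 0 \<omega> = 0) \<and>
     (\<forall>\<tau> n A. 0 \<le> \<tau> 0 \<and> (\<forall>i<n. \<tau> i \<le> \<tau> (Suc i)) \<and> (\<forall>i<n. A i \<in> sets borel) \<longrightarrow>
        emeasure Q {\<omega>\<in>space Q. \<forall>i<n. Z (\<tau> (Suc i)) \<omega> - Z (\<tau> i) \<omega> \<in> A i} =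
        (\<Prod>i<n. emeasure (\<kappa> (\<tau> (Suc i) - \<tau> i)) (A i)))"

lemma times_nonneg:
  fixes \<tau> :: "nat \<Rightarrow> real"
  assumes "0 \<le> \<tau> 0" "\<And>i. i < n \<Longrightarrow> \<tau> i \<le> \<tau> (Suc i)"
  shows "i \<le> n \<Longrightarrow> 0 \<le> \<tau> i"
  using assms
proof (induction i)
  case (Suc i)
  then have "0 \<le> \<tau> i" "\<tau> i \<le> \<tau> (Suc i)" by auto
  then show ?case by linarith
qed simp

lemma has_increments_distr:
  assumes Q: "prob_space Q" and Z: "has_increments Q Z \<kappa>" and \<kappa>: "\<And>u. real_distribution (\<kappa> u)"
    and \<tau>: "0 \<le> \<tau> 0" "\<And>i. i < n \<Longrightarrow> \<tau> i \<le> \<tau> (Suc i)"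
  shows "distr Q (\<Pi>\<^sub>M i\<in>{..<n}. borel) (\<lambda>\<omega>. \<lambda>i\<in>{..<n}. Z (\<tau> (Suc i)) \<omega> - Z (\<tau> i) \<omega>) =
    (\<Pi>\<^sub>M i\<in>{..<n}. \<kappa> (\<tau> (Suc i) - \<tau> i))"
proof -
  interpret \<kappa>: real_distribution "\<kappa> u" for u by (rule \<kappa>)
  interpret product_sigma_finite "\<lambda>i. \<kappa> (\<tau> (Suc i) - \<tau> i)" ..
  have [measurable]: "Z (\<tau> i) \<in> borel_measurable Q" if "i \<le> n" for i
    using Z times_nonneg[of \<tau> n i] \<tau> that by (auto simp: has_increments_def)
  show ?thesis
  proof (rule PiM_eqI)
    fix A assume A: "\<And>i. i \<in> {..<n} \<Longrightarrow> A i \<in> sets (\<kappa> (\<tau> (Suc i) - \<tau> i))"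
    have "emeasure (distr Q (\<Pi>\<^sub>M i\<in>{..<n}. borel) (\<lambda>\<omega>. \<lambda>i\<in>{..<n}. Z (\<tau> (Suc i)) \<omega> - Z (\<tau> i) \<omega>)) (Pi\<^sub>E {..<n} A)
       = emeasure Q {\<omega>\<in>space Q. \<forall>i<n. Z (\<tau> (Suc i)) \<omega> - Z (\<tau> i) \<omega> \<in> A i}"
      using A by (subst emeasure_distr)
        (auto intro!: arg_cong[where f="emeasure Q"] measurable_restrict sets_PiM_I_finite simp: PiE_iff)
    also have "\<dots> = (\<Prod>i<n. emeasure (\<kappa> (\<tau> (Suc i) - \<tau> i)) (A i))"
      using Z A \<tau> by (auto simp: has_increments_def)
    finally show "emeasure (distr Q (\<Pi>\<^sub>M i\<in>{..<n}. borel) (\<lambda>\<omega>. \<lambda>i\<in>{..<n}. Z (\<tau> (Suc i)) \<omega> - Z (\<tau> i) \<omega>)) (Pi\<^sub>E {..<n} A)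
       = (\<Prod>i<n. emeasure (\<kappa> (\<tau> (Suc i) - \<tau> i)) (A i))" .
  qed (auto intro!: sets_PiM_cong)
qed

text \<open>Events alone are not enough for the time change: there each factor is the function x
  \<mapsto> \<kappa> x (A i) of an increment of the subordinator.\<close>

lemma has_increments_nn_integral:
  assumes Q: "prob_space Q" and Z: "has_increments Q Z \<kappa>" and \<kappa>: "\<And>u. real_distribution (\<kappa> u)"
    and \<tau>: "0 \<le> \<tau> 0" "\<And>i. i < n \<Longrightarrow> \<tau> i \<le> \<tau> (Suc i)"
    and g [measurable]: "\<And>i. g i \<in> borel_measurable borel"
  shows "(\<integral>\<^sup>+\<omega>. (\<Prod>i<n. g i (Z (\<tau> (Suc i)) \<omega> - Z (\<tau> i) \<omega>)) \<partial>Q) =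
    (\<Prod>i<n. \<integral>\<^sup>+x. g i x \<partial>\<kappa> (\<tau> (Suc i) - \<tau> i))"
proof -
  interpret \<kappa>: real_distribution "\<kappa> u" for u by (rule \<kappa>)
  interpret product_sigma_finite "\<lambda>i. \<kappa> (\<tau> (Suc i) - \<tau> i)" ..
  have [measurable]: "Z (\<tau> i) \<in> borel_measurable Q" if "i \<le> n" for i
    using Z times_nonneg[of \<tau> n i] \<tau> that by (auto simp: has_increments_def)
  have "(\<integral>\<^sup>+\<omega>. (\<Prod>i<n. g i (Z (\<tau> (Suc i)) \<omega> - Z (\<tau> i) \<omega>)) \<partial>Q) =
     (\<integral>\<^sup>+x. (\<Prod>i<n. g i (x i)) \<partial>distr Q (\<Pi>\<^sub>M i\<in>{..<n}. borel) (\<lambda>\<omega>. \<lambda>i\<in>{..<n}. Z (\<tau> (Suc i)) \<omega> - Z (\<tau> i) \<omega>))"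
    by (subst nn_integral_distr) (auto intro!: measurable_restrict)
  also have "distr Q (\<Pi>\<^sub>M i\<in>{..<n}. borel) (\<lambda>\<omega>. \<lambda>i\<in>{..<n}. Z (\<tau> (Suc i)) \<omega> - Z (\<tau> i) \<omega>) =
      (\<Pi>\<^sub>M i\<in>{..<n}. \<kappa> (\<tau> (Suc i) - \<tau> i))"
    by (rule has_increments_distr[where \<tau>=\<tau> and n=n, OF Q Z \<kappa> \<tau>])
  also have "(\<integral>\<^sup>+x. (\<Prod>i<n. g i (x i)) \<partial>(\<Pi>\<^sub>M i\<in>{..<n}. \<kappa> (\<tau> (Suc i) - \<tau> i))) =
      (\<Prod>i<n. \<integral>\<^sup>+x. g i x \<partial>\<kappa> (\<tau> (Suc i) - \<tau> i))"
    by (rule product_nn_integral_prod) (auto simp: measurable_cong_sets[OF \<kappa>.events_eq_borel refl])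
  finally show ?thesis .
qed

lemma sets_increments:
  assumes \<tau>: "0 \<le> \<tau> 0" "\<And>i. i < n \<Longrightarrow> \<tau> i \<le> \<tau> (Suc i)" and A: "\<And>i. i < n \<Longrightarrow> A i \<in> sets borel"
  shows "{x\<in>space cadlag_space. \<forall>i<n. x (\<tau> (Suc i)) - x (\<tau> i) \<in> A i} \<in> sets cadlag_space"
proof -
  have "{x\<in>space cadlag_space. \<forall>i\<in>{..<n}. x (\<tau> (Suc i)) - x (\<tau> i) \<in> A i} \<in> sets cadlag_space"
  proof (rule sets.sets_Collect_finite_All)
    fix i assume i: "i \<in> {..<n}"
    then have [measurable]: "A i \<in> sets borel" "(\<lambda>x. x (\<tau> i)) \<in> borel_measurable cadlag_space"
      "(\<lambda>x. x (\<tau> (Suc i))) \<in> borel_measurable cadlag_space"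
      using A times_nonneg[of \<tau> n, OF \<tau>] by (auto intro!: measurable_eval_cadlag)
    show "{x \<in> space cadlag_space. x (\<tau> (Suc i)) - x (\<tau> i) \<in> A i} \<in> sets cadlag_space" by measurable
  qed simp
  then show ?thesis by (simp only: Ball_def lessThan_iff)
qed

lemma emeasure_increments:
  assumes \<tau>: "0 \<le> \<tau> 0" "\<And>i. i < n \<Longrightarrow> \<tau> i \<le> \<tau> (Suc i)" and A: "\<And>i. i < n \<Longrightarrow> A i \<in> sets borel"
    and Z: "trajectory Z \<in> measurable Q cadlag_space"
  shows "emeasure Q {\<omega>\<in>space Q. \<forall>i<n. Z (\<tau> (Suc i)) \<omega> - Z (\<tau> i) \<omega> \<in> A i} =
    emeasure (distr Q cadlag_space (trajectory Z))
      {x\<in>space cadlag_space. \<forall>i<n. x (\<tau> (Suc i)) - x (\<tau> i) \<in> A i}"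
proof (subst emeasure_distr[OF Z sets_increments[of \<tau> n A, OF \<tau> A]])
  have "trajectory Z \<omega> (\<tau> i) = Z (\<tau> i) \<omega>" if "i \<le> n" for i \<omega>
    using times_nonneg[of \<tau> n i, OF \<tau>] that by (auto simp: trajectory_def)
  then show "emeasure Q {\<omega>\<in>space Q. \<forall>i<n. Z (\<tau> (Suc i)) \<omega> - Z (\<tau> i) \<omega> \<in> A i} =
    emeasure Q (trajectory Z -` {x\<in>space cadlag_space. \<forall>i<n. x (\<tau> (Suc i)) - x (\<tau> i) \<in> A i} \<inter> space Q)"
    using measurable_space[OF Z] by (intro arg_cong[where f="emeasure Q"]) (auto simp: Suc_le_eq)
qed auto

text \<open>Increment events and the event x 0 = 0 are measurable in path space, so the property
  depends on the path law alone. It thus passes from the witness of a compound Poisson law to M on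
  its own probability space.\<close>

lemma has_increments_transfer:
  assumes eq: "distr Q cadlag_space (trajectory Z) = distr Q' cadlag_space (trajectory Z')"
    and Z: "has_increments Q Z \<kappa>"
    and m: "trajectory Z \<in> measurable Q cadlag_space" "trajectory Z' \<in> measurable Q' cadlag_space"
  shows "has_increments Q' Z' \<kappa>"
  unfolding has_increments_def
proof (intro conjI allI impI)
  have [measurable]: "{x\<in>space cadlag_space. x 0 = (0::real)} \<in> sets cadlag_space"
    using measurable_eval_cadlag[of 0] by measurable
  show "Z' t \<in> borel_measurable Q'" if "t \<ge> 0" for t
    using m(2) that by (auto simp: measurable_cadlag_space_iff)
  have "AE \<omega> in Q. trajectory Z \<omega> 0 = 0"
    using Z by (auto simp: has_increments_def trajectory_def)
  then have "AE x in distr Q cadlag_space (trajectory Z). x 0 = 0"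
    by (subst AE_distr_iff) (use m in auto)
  then show "AE \<omega> in Q'. Z' 0 \<omega> = 0"
    unfolding eq by (subst (asm) AE_distr_iff) (use m in \<open>auto simp: trajectory_def\<close>)
next
  fix \<tau> :: "nat \<Rightarrow> real" and n A
  assume *: "0 \<le> \<tau> 0 \<and> (\<forall>i<n. \<tau> i \<le> \<tau> (Suc i)) \<and> (\<forall>i<n. A i \<in> sets (borel :: real measure))"
  then show "emeasure Q' {\<omega>\<in>space Q'. \<forall>i<n. Z' (\<tau> (Suc i)) \<omega> - Z' (\<tau> i) \<omega> \<in> A i} =
     (\<Prod>i<n. emeasure (\<kappa> (\<tau> (Suc i) - \<tau> i)) (A i))"
    using Z emeasure_increments[of \<tau> n A Z Q] emeasure_increments[of \<tau> n A Z' Q'] m eq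
    by (auto simp: has_increments_def)
qed

text \<open>Starting the times at 0 makes the value at each time a partial sum of increments. The
  initial value is 0 only almost surely, so the two events are compared up to a null set.\<close>

lemma emeasure_marginals:
  assumes Q: "prob_space Q" and Z: "has_increments Q Z \<kappa>" and \<kappa>: "\<And>u. real_distribution (\<kappa> u)"
    and \<tau>: "\<tau> 0 = 0" "\<And>i. i < n \<Longrightarrow> \<tau> i \<le> \<tau> (Suc i)" and A: "\<And>i. i < n \<Longrightarrow> A i \<in> sets borel"
  shows "emeasure Q {\<omega>\<in>space Q. \<forall>i<n. Z (\<tau> (Suc i)) \<omega> \<in> A i} =
    emeasure (\<Pi>\<^sub>M i\<in>{..<n}. \<kappa> (\<tau> (Suc i) - \<tau> i))
      {w\<in>space (\<Pi>\<^sub>M i\<in>{..<n}. borel). \<forall>i<n. (\<Sum>k<Suc i. w k) \<in> A i}"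
proof -
  let ?W = "{w\<in>space (\<Pi>\<^sub>M i\<in>{..<n}. borel). \<forall>i<n. (\<Sum>k<Suc i. w k) \<in> A i}"
  let ?V = "\<lambda>\<omega>. \<lambda>i\<in>{..<n}. Z (\<tau> (Suc i)) \<omega> - Z (\<tau> i) \<omega>"
  have \<tau>0: "0 \<le> \<tau> 0" using \<tau> by simp
  have [measurable]: "Z (\<tau> i) \<in> borel_measurable Q" if "i \<le> n" for i
    using Z times_nonneg[of \<tau> n i, OF \<tau>0 \<tau>(2)] that by (auto simp: has_increments_def)
  have W: "?W \<in> sets (\<Pi>\<^sub>M i\<in>{..<n}. borel)"
  proof -
    have "{w\<in>space (\<Pi>\<^sub>M i\<in>{..<n}. borel). \<forall>i\<in>{..<n}. (\<Sum>k<Suc i. w k) \<in> A i} \<in> sets (\<Pi>\<^sub>M i\<in>{..<n}. borel)"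
    proof (rule sets.sets_Collect_finite_All)
      fix i assume i: "i \<in> {..<n}"
      then have [measurable]: "A i \<in> sets borel" using A by auto
      have [measurable]: "(\<lambda>w. \<Sum>k<Suc i. w k :: real) \<in> borel_measurable (\<Pi>\<^sub>M i\<in>{..<n}. borel)"
        by (rule borel_measurable_sum, rule measurable_component_singleton) (use i in auto)
      show "{w\<in>space (\<Pi>\<^sub>M i\<in>{..<n}. borel). (\<Sum>k<Suc i. w k) \<in> A i} \<in> sets (\<Pi>\<^sub>M i\<in>{..<n}. borel)"
        by measurable
    qed simp
    then show ?thesis by (simp only: Ball_def lessThan_iff)
  qed
  have V: "?V \<in> measurable Q (\<Pi>\<^sub>M i\<in>{..<n}. borel)"
    by (rule measurable_restrict) auto
  have m: "{\<omega>\<in>space Q. \<forall>i<n. Z (\<tau> (Suc i)) \<omega> \<in> A i} \<in> sets Q"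
  proof -
    have "{\<omega>\<in>space Q. \<forall>i\<in>{..<n}. Z (\<tau> (Suc i)) \<omega> \<in> A i} \<in> sets Q"
      by (rule sets.sets_Collect_finite_All) (use A in auto)
    then show ?thesis by (simp only: Ball_def lessThan_iff)
  qed
  have "AE \<omega> in Q. Z 0 \<omega> = 0" using Z by (auto simp: has_increments_def)
  then have ae: "AE \<omega> in Q. \<omega> \<in> {\<omega>\<in>space Q. \<forall>i<n. Z (\<tau> (Suc i)) \<omega> \<in> A i} \<longleftrightarrow> \<omega> \<in> ?V -` ?W \<inter> space Q"
  proof eventually_elim
    case (elim \<omega>)
    have "(\<Sum>k<Suc i. ?V \<omega> k) = Z (\<tau> (Suc i)) \<omega>" if "i < n" for i
    proof -
      have "(\<Sum>k<Suc i. ?V \<omega> k) = (\<Sum>k<Suc i. Z (\<tau> (Suc k)) \<omega> - Z (\<tau> k) \<omega>)"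
        by (intro sum.cong) (use that in auto)
      also have "\<dots> = Z (\<tau> (Suc i)) \<omega>"
        using elim \<tau>(1) by (subst sum_lessThan_telescope) simp
      finally show ?thesis .
    qed
    then show ?case using measurable_space[OF V] by auto
  qed
  have "emeasure Q {\<omega>\<in>space Q. \<forall>i<n. Z (\<tau> (Suc i)) \<omega> \<in> A i} = emeasure Q (?V -` ?W \<inter> space Q)"
    by (rule emeasure_eq_AE[OF ae m measurable_sets[OF V W]])
  also have "\<dots> = emeasure (distr Q (\<Pi>\<^sub>M i\<in>{..<n}. borel) ?V) ?W"
    by (rule emeasure_distr[OF V W, symmetric])
  also have "distr Q (\<Pi>\<^sub>M i\<in>{..<n}. borel) ?V = (\<Pi>\<^sub>M i\<in>{..<n}. \<kappa> (\<tau> (Suc i) - \<tau> i))"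
    by (rule has_increments_distr[where \<tau>=\<tau> and n=n, OF Q Z \<kappa> \<tau>0 \<tau>(2)])
  finally show ?thesis .
qed

lemma has_increments_cylinder:
  assumes Q: "prob_space Q" "prob_space Q'" and Z: "has_increments Q Z \<kappa>" "has_increments Q' Z' \<kappa>"
    and \<kappa>: "\<And>u. real_distribution (\<kappa> u)"
    and J: "finite J" "J \<subseteq> {0..}" and A: "\<And>j. j \<in> J \<Longrightarrow> A j \<in> sets borel"
  shows "emeasure Q {\<omega>\<in>space Q. \<forall>j\<in>J. Z j \<omega> \<in> A j} = emeasure Q' {\<omega>\<in>space Q'. \<forall>j\<in>J. Z' j \<omega> \<in> A j}"
proof -
  define ts where "ts = sorted_list_of_set J"
  define n where "n = length ts"
  \<comment> \<open>The time 0 is put in front of the sorted elements of J, so that the first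
    increment starts at the known value 0. If 0 already lies in J, this only creates an increment
    over a time of length 0.\<close>
  define \<tau> where "\<tau> i = (case i of 0 \<Rightarrow> 0 | Suc k \<Rightarrow> ts ! k)" for i
  have ts: "set ts = J" "sorted ts" using J by (auto simp: ts_def)
  have \<tau>: "\<tau> 0 = 0" by (simp add: \<tau>_def)
  have tsJ: "ts ! i \<in> J" if "i < n" for i using that ts by (auto simp: n_def)
  have mono: "\<tau> i \<le> \<tau> (Suc i)" if "i < n" for i
  proof (cases i)
    case 0 then show ?thesis using tsJ[OF that] J by (auto simp: \<tau>_def)
  next
    case (Suc k) then show ?thesis using that ts(2) sorted_nth_mono[of ts k "Suc k"] by (auto simp: \<tau>_def n_def)
  qed
  have *: "(\<forall>j\<in>J. P j) \<longleftrightarrow> (\<forall>i<n. P (\<tau> (Suc i)))" for P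
    unfolding ts(1)[symmetric] by (simp add: \<tau>_def n_def all_set_conv_all_nth)
  have A': "A (\<tau> (Suc i)) \<in> sets borel" if "i < n" for i using A tsJ that by (auto simp: \<tau>_def)
  note em = emeasure_marginals[where \<tau>=\<tau> and n=n and A="\<lambda>i. A (\<tau> (Suc i))", OF _ _ \<kappa> \<tau> mono A']
  show ?thesis
    unfolding * using em[OF Q(1) Z(1)] em[OF Q(2) Z(2)] by simp
qed

text \<open>Finite-dimensional cylinders determine a finite measure on the full product space, and
  their probabilities are computable from the increments. The passage to \<open>cadlag_space\<close>
  costs nothing because its sets are traces of product sets.\<close>

lemma has_increments_law:
  assumes Q: "prob_space Q" "prob_space Q'" and Z: "has_increments Q Z \<kappa>" "has_increments Q' Z' \<kappa>"
    and \<kappa>: "\<And>u. real_distribution (\<kappa> u)"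
    and m: "trajectory Z \<in> measurable Q cadlag_space" "trajectory Z' \<in> measurable Q' cadlag_space"
  shows "distr Q cadlag_space (trajectory Z) = distr Q' cadlag_space (trajectory Z')"
proof -
  let ?S = "\<Pi>\<^sub>M t\<in>{0::real..}. (borel :: real measure)"
  have m': "trajectory Z \<in> measurable Q ?S" "trajectory Z' \<in> measurable Q' ?S"
    using m by (auto simp: cadlag_space_def measurable_restrict_space2_iff)
  have eq: "distr Q ?S (trajectory Z) = distr Q' ?S (trajectory Z')"
  proof (rule measure_eqI_PiM_infinite)
    show "finite_measure (distr Q ?S (trajectory Z))"
      using Q(1) m' by (intro finite_measure.finite_measure_distr prob_space.finite_measure)
    fix A :: "real \<Rightarrow> real set" and J assume J: "finite J" "J \<subseteq> {0..}" and A: "\<And>j. j \<in> J \<Longrightarrow> A j \<in> sets borel"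
    have ev1: "trajectory Z -` prod_emb {0..} (\<lambda>t. borel) J (Pi\<^sub>E J A) \<inter> space Q = {\<omega>\<in>space Q. \<forall>j\<in>J. Z j \<omega> \<in> A j}"
      using J by (auto simp: prod_emb_def trajectory_def space_PiM PiE_iff subset_eq)
    have ev2: "trajectory Z' -` prod_emb {0..} (\<lambda>t. borel) J (Pi\<^sub>E J A) \<inter> space Q' = {\<omega>\<in>space Q'. \<forall>j\<in>J. Z' j \<omega> \<in> A j}"
      using J by (auto simp: prod_emb_def trajectory_def space_PiM PiE_iff subset_eq)
    have "prod_emb {0..} (\<lambda>t. borel) J (Pi\<^sub>E J A) \<in> sets ?S"
      using J A by (intro sets_PiM_I) auto
    then show "emeasure (distr Q ?S (trajectory Z)) (prod_emb {0..} (\<lambda>t. borel) J (Pi\<^sub>E J A)) =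
      emeasure (distr Q' ?S (trajectory Z')) (prod_emb {0..} (\<lambda>t. borel) J (Pi\<^sub>E J A))"
      using has_increments_cylinder[OF Q Z \<kappa> J A] m' by (simp add: emeasure_distr ev1 ev2)
  qed auto
  show ?thesis
  proof (rule measure_eqI)
    fix B assume "B \<in> sets (distr Q cadlag_space (trajectory Z))"
    then have B: "B \<in> sets cadlag_space" by simp
    then obtain B' where B': "B' \<in> sets ?S" "B = {x. cadlag x} \<inter> B'"
      by (auto simp: cadlag_space_def sets_restrict_space)
    \<comment> \<open>All trajectories are cadlag, so intersecting B' with the set of cadlag paths
      does not change preimages.\<close>
    have "trajectory Z -` B \<inter> space Q = trajectory Z -` B' \<inter> space Q"
      "trajectory Z' -` B \<inter> space Q' = trajectory Z' -` B' \<inter> space Q'"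
      using m unfolding B' by (auto simp: measurable_cadlag_space_iff)
    moreover have "emeasure (distr Q ?S (trajectory Z)) B' = emeasure (distr Q' ?S (trajectory Z')) B'"
      by (simp add: eq)
    ultimately show "emeasure (distr Q cadlag_space (trajectory Z)) B =
       emeasure (distr Q' cadlag_space (trajectory Z')) B"
      using m m' B B'(1) by (simp add: emeasure_distr)
  qed simp
qed

section \<open>Step paths and time-changed paths are cadlag\<close>

lemma cadlag_step:
  fixes n :: "real \<Rightarrow> nat" and \<phi> :: "nat \<Rightarrow> real"
  assumes mono: "mono_on {0..} n" and cont: "\<And>t. t \<ge> 0 \<Longrightarrow> continuous (at_right t) n"
  shows "cadlag (\<lambda>t\<in>{0..}. \<phi> (n t))"
  unfolding cadlag_def
proof (intro conjI allI impI)
  fix t :: real assume t: "t \<ge> 0"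
  have "(n \<longlongrightarrow> n t) (at_right t)" using cont[OF t] by (simp add: continuous_within)
  then have "eventually (\<lambda>s. n s = n t) (at_right t)" by (simp add: tendsto_discrete)
  then have "eventually (\<lambda>s. (\<lambda>t\<in>{0..}. \<phi> (n t)) s = \<phi> (n t)) (at_right t)"
    using eventually_at_right_less[of t] by eventually_elim (use t in auto)
  then have "((\<lambda>t\<in>{0..}. \<phi> (n t)) \<longlongrightarrow> \<phi> (n t)) (at_right t)" by (rule tendsto_eventually)
  then show "continuous (at_right t) (\<lambda>t\<in>{0..}. \<phi> (n t))" using t by (simp add: continuous_within)
next
  fix t :: real assume t: "t > 0"
  \<comment> \<open>On [0,t) the monotone integer path takes finitely many values, all at most n t.
    After the point s0 where the largest of them is attained it is constant up to t, so a left limit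
    exists whatever \<phi> is.\<close>
  have fin: "finite (n ` {0..<t})"
    by (rule finite_subset[of _ "{..n t}"]) (use mono in \<open>auto simp: mono_on_def\<close>)
  have ne: "n ` {0..<t} \<noteq> {}" using t by auto
  obtain s0 where s0: "s0 \<in> {0..<t}" "n s0 = Max (n ` {0..<t})"
    using Max_in[OF fin ne] by auto
  have "n s = n s0" if "s0 < s" "s < t" for s
  proof (rule antisym)
    show "n s \<le> n s0" using s0 that fin by auto
    show "n s0 \<le> n s" using mono_onD[OF mono, of s0 s] s0(1) that by auto
  qed
  moreover have "eventually (\<lambda>s. s \<in> {s0<..<t}) (at_left t)"
    using s0 by (intro eventually_at_leftI) auto
  ultimately have "eventually (\<lambda>s. (\<lambda>t\<in>{0..}. \<phi> (n t)) s = \<phi> (n s0)) (at_left t)"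
    by (elim eventually_mono) (use s0(1) in simp)
  then show "\<exists>l. ((\<lambda>t\<in>{0..}. \<phi> (n t)) \<longlongrightarrow> l) (at_left t)"
    by (intro exI[of _ "\<phi> (n s0)"] tendsto_eventually)
qed

text \<open>To the right of t, h may stay at h t or exceed it; right continuity of x at h t covers
  both. To the left there are two cases: either h is constant just before t, and the limit is the
  value of x there, or h stays strictly below its left limit L while tending to it, and the limit is
  the left limit of x at L.\<close>

lemma cadlag_time_change:
  fixes h x :: "real \<Rightarrow> real"
  assumes x: "cadlag x" and mono: "mono_on {0..} h" and h0: "0 \<le> h 0"
    and cont: "\<And>t. t \<ge> 0 \<Longrightarrow> continuous (at_right t) h"
  shows "cadlag (\<lambda>t\<in>{0..}. x (h t))"
  unfolding cadlag_def
proof (intro conjI allI impI)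
  have nonneg: "h t \<ge> 0" if "t \<ge> 0" for t using mono h0 that by (force simp: mono_on_def)
  fix t :: real assume t: "t \<ge> 0"
  have ht: "(h \<longlongrightarrow> h t) (at_right t)" using cont[OF t] by (simp add: continuous_within)
  have xt: "(x \<longlongrightarrow> x (h t)) (at_right (h t))"
    using x nonneg[OF t] by (simp add: cadlag_def continuous_within)
  have "((\<lambda>s. x (h s)) \<longlongrightarrow> x (h t)) (at_right t)"
  proof (rule topological_tendstoI)
    fix S assume S: "open S" "x (h t) \<in> S"
    then have "eventually (\<lambda>u. x u \<in> S) (at_right (h t))" using xt by (rule topological_tendstoD[rotated 1])
    then obtain b where b: "b > h t" "\<And>u. h t < u \<Longrightarrow> u < b \<Longrightarrow> x u \<in> S"
      by (auto simp: eventually_at_right_field)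
    have "eventually (\<lambda>s. h s < b) (at_right t)" using ht b(1) by (rule order_tendstoD)
    then show "eventually (\<lambda>s. x (h s) \<in> S) (at_right t)"
      using eventually_at_right_less[of t]
    proof eventually_elim
      case (elim s)
      have "h t \<le> h s" using mono t elim by (auto simp: mono_on_def)
      then show ?case using b(2)[of "h s"] S(2) elim by (cases "h s = h t") auto
    qed
  qed
  then have "((\<lambda>t\<in>{0..}. x (h t)) \<longlongrightarrow> x (h t)) (at_right t)"
    by (rule Lim_transform_eventually)
       (use eventually_at_right_less[of t] in eventually_elim, use t in auto)
  then show "continuous (at_right t) (\<lambda>t\<in>{0..}. x (h t))" using t by (simp add: continuous_within)
next
  fix t :: real assume t: "t > 0"
  have left: "eventually (\<lambda>s. s \<in> {s0<..<t}) (at_left t)" if "s0 < t" for s0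
    using that by (intro eventually_at_leftI) auto
  show "\<exists>l. ((\<lambda>t\<in>{0..}. x (h t)) \<longlongrightarrow> l) (at_left t)"
  proof (cases "\<exists>s0\<in>{0..<t}. \<forall>s\<in>{s0<..<t}. h s = h s0")
    case True
    then obtain s0 where s0: "s0 \<in> {0..<t}" "\<And>s. s \<in> {s0<..<t} \<Longrightarrow> h s = h s0" by blast
    have "eventually (\<lambda>s. (\<lambda>t\<in>{0..}. x (h t)) s = x (h s0)) (at_left t)"
      by (rule eventually_mono[OF left[of s0]]) (use s0 in auto)
    then show ?thesis by (intro exI[of _ "x (h s0)"] tendsto_eventually)
  next
    case False
    define L where "L = Sup (h ` {0..<t})"
    have bdd: "bdd_above (h ` {0..<t})"
      by (rule bdd_aboveI2[of _ _ "h t"]) (use mono in \<open>auto simp: mono_on_def\<close>)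
    have le: "h s \<le> L" if "s \<in> {0..<t}" for s
      unfolding L_def using that bdd by (intro cSUP_upper)
    have less: "h s < L" if s: "s \<in> {0..<t}" for s
    proof (rule ccontr)
      assume "\<not> h s < L"
      then have "L \<le> h s" by simp
      have "h s' = h s" if "s' \<in> {s<..<t}" for s'
      proof (rule antisym)
        show "h s' \<le> h s" using le[of s'] that s \<open>L \<le> h s\<close> by auto
        show "h s \<le> h s'" using mono that s by (auto simp: mono_on_def)
      qed
      with False s show False by blast
    qed
    \<comment> \<open>\<open>cadlag\<close> grants left limits at positive times only; here 0 \<le>
      h 0 < L.\<close>
    have "L > 0" using less[of 0] h0 t by auto
    then obtain l where l: "(x \<longlongrightarrow> l) (at_left L)" using x by (auto simp: cadlag_def)
    have "filterlim h (at_left L) (at_left t)"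
      unfolding filterlim_at
    proof (intro conjI)
      show "eventually (\<lambda>s. h s \<in> {..<L} \<and> h s \<noteq> L) (at_left t)"
              proof (rule eventually_mono[OF left[of 0]])
        fix s assume "s \<in> {0<..<t}"
        then show "h s \<in> {..<L} \<and> h s \<noteq> L" using less[of s] by auto
      qed (use t in auto)
      show "(h \<longlongrightarrow> L) (at_left t)"
      proof (rule order_tendstoI)
        fix b assume "b < L"
        then obtain s1 where s1: "s1 \<in> {0..<t}" "b < h s1"
          unfolding L_def using t bdd by (subst (asm) less_cSUP_iff) auto
        show "eventually (\<lambda>s. b < h s) (at_left t)"
        proof (rule eventually_mono[OF left[of s1]])
          fix s assume "s \<in> {s1<..<t}"
          then have "h s1 \<le> h s" using mono s1 by (auto simp: mono_on_def)
          then show "b < h s" using s1 by simp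
        qed (use s1 in auto)
      next
        fix b assume "L < b"
        show "eventually (\<lambda>s. h s < b) (at_left t)"
        proof (rule eventually_mono[OF left[of 0]])
          fix s assume "s \<in> {0<..<t}"
          then show "h s < b" using less[of s] \<open>L < b\<close> by auto
        qed (use t in auto)
      qed
    qed
    then have "((\<lambda>s. x (h s)) \<longlongrightarrow> l) (at_left t)" by (rule filterlim_compose[OF l])
    then have "((\<lambda>t\<in>{0..}. x (h t)) \<longlongrightarrow> l) (at_left t)"
      by (rule Lim_transform_eventually)
         (rule eventually_mono[OF left[of 0]], use t in auto)
    then show ?thesis ..
  qed
qed

section \<open>The compound Poisson process\<close>

lemma mono_upto:
  fixes \<eta> :: "nat \<Rightarrow> 'a :: order"
  assumes "\<And>i. i < n \<Longrightarrow> \<eta> i \<le> \<eta> (Suc i)" "j \<le> n" "i \<le> j"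
  shows "\<eta> i \<le> \<eta> j"
  using assms(3,2)
proof (induction j rule: dec_induct)
  case (step j)
  then show ?case using assms(1)[of j] by (auto intro: order_trans)
qed simp

lemma emeasure_indep_vars:
  fixes n :: nat
  assumes Q: "prob_space Q" and ind: "prob_space.indep_vars Q (\<lambda>_. borel) Y {..<n}"
    and A: "\<And>i. i < n \<Longrightarrow> A i \<in> sets borel"
  shows "emeasure Q {\<omega>\<in>space Q. \<forall>i<n. Y i \<omega> \<in> A i} = (\<Prod>i<n. emeasure (distr Q borel (Y i)) (A i))"
proof (cases "n = 0")
  case True
  then show ?thesis using prob_space.emeasure_space_1[OF Q] by simp
next
  case False
  interpret prob_space Q by fact
  have Y: "Y i \<in> borel_measurable Q" if "i < n" for i
    using ind that by (auto simp: indep_vars_def)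
  have "prob (\<Inter>i\<in>{..<n}. Y i -` A i \<inter> space Q) = (\<Prod>i<n. prob (Y i -` A i \<inter> space Q))"
    by (rule indep_varsD[OF ind]) (use False A in auto)
  moreover have "(\<Inter>i\<in>{..<n}. Y i -` A i \<inter> space Q) = {\<omega>\<in>space Q. \<forall>i<n. Y i \<omega> \<in> A i}"
    using False by auto
  moreover have "emeasure (distr Q borel (Y i)) (A i) = prob (Y i -` A i \<inter> space Q)" if "i < n" for i
    using Y[OF that] A[OF that] by (simp add: emeasure_distr emeasure_eq_measure)
  ultimately show ?thesis by (simp add: emeasure_eq_measure prod_ennreal)
qed

lemma iid_measurable:
  assumes Q: "prob_space Q" and X: "iid Q F X" and k: "k \<ge> 1"
  shows "X k \<in> borel_measurable Q"
proof -
  interpret prob_space Q by fact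
  show ?thesis using X k by (auto simp: iid_def indep_vars_def)
qed

lemma distr_block_sum:
  assumes Q: "prob_space Q" and X: "iid Q F X"
  shows "distr Q borel (\<lambda>\<omega>. \<Sum>k\<in>{m<..m + d}. X k \<omega>) = convolution_power F d"
proof (induction d)
  case 0
  interpret prob_space Q by fact
  show ?case by (simp add: distr_const)
next
  case (Suc d)
  interpret prob_space Q by fact
  have X1: "indep_vars (\<lambda>_. borel) X {1..}" and X2: "\<And>k. k \<ge> 1 \<Longrightarrow> distr Q borel (X k) = F"
    using X by (auto simp: iid_def)
  have [measurable]: "X k \<in> borel_measurable Q" if "k \<ge> 1" for k
    by (rule iid_measurable[OF Q X that])
  have ins: "{m<..m + Suc d} = insert (Suc (m + d)) {m<..m + d}" by auto
  have "indep_var borel (X (Suc (m + d))) borel (\<lambda>\<omega>. \<Sum>k\<in>{m<..m + d}. X k \<omega>)"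
    by (rule indep_vars_sum) (auto intro: indep_vars_subset[OF X1])
  then have "distr Q borel (\<lambda>\<omega>. X (Suc (m + d)) \<omega> + (\<Sum>k\<in>{m<..m + d}. X k \<omega>)) =
      convolution (distr Q borel (X (Suc (m + d)))) (distr Q borel (\<lambda>\<omega>. \<Sum>k\<in>{m<..m + d}. X k \<omega>))"
    by (rule sum_indep_random_variable) auto
  then show ?case unfolding ins by (simp add: Suc X2)
qed

text \<open>Monotonicity of \<eta> makes the index blocks disjoint, so the block sums are functions
  of disjoint groups of independent variables.\<close>

lemma emeasure_block_sums:
  assumes Q: "prob_space Q" and X: "iid Q F X"
    and \<eta>: "\<And>i. i < n \<Longrightarrow> \<eta> i \<le> \<eta> (Suc i)" and A: "\<And>i. i < n \<Longrightarrow> A i \<in> sets borel"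
  shows "emeasure Q {\<omega>\<in>space Q. \<forall>i<n. (\<Sum>k\<in>{\<eta> i<..\<eta> (Suc i)}. X k \<omega>) \<in> A i} =
    (\<Prod>i<n. emeasure (convolution_power F (\<eta> (Suc i) - \<eta> i)) (A i))"
proof -
  interpret prob_space Q by fact
  let ?K = "\<lambda>i. {\<eta> i<..\<eta> (Suc i)}"
  have X1: "indep_vars (\<lambda>_. borel) X {1..}" using X by (auto simp: iid_def)
  have disj: "disjoint_family_on ?K {..<n}"
    unfolding disjoint_family_on_def
  proof (intro ballI impI)
    fix i j assume ij: "i \<in> {..<n}" "j \<in> {..<n}" "i \<noteq> j"
    have *: "?K i \<inter> ?K j = {}" if "i < j" "j < n" for i j
      using mono_upto[of n \<eta> j "Suc i", OF \<eta>] that by auto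
    show "?K i \<inter> ?K j = {}"
      using *[of i j] *[of j i] ij by (cases "i < j") auto
  qed
  have "indep_vars (\<lambda>j. \<Pi>\<^sub>M k\<in>?K j. borel) (\<lambda>j \<omega>. \<lambda>k\<in>?K j. X k \<omega>) {..<n}"
    by (rule indep_vars_restrict[OF X1 _ disj]) auto
  then have "indep_vars (\<lambda>_. borel) (\<lambda>j \<omega>. (\<lambda>x. \<Sum>k\<in>?K j. x k :: real) (\<lambda>k\<in>?K j. X k \<omega>)) {..<n}"
    by (rule indep_vars_compose2) (auto intro!: borel_measurable_sum measurable_component_singleton)
  then have ind: "indep_vars (\<lambda>_. borel) (\<lambda>j \<omega>. \<Sum>k\<in>?K j. X k \<omega>) {..<n}"
    by simp
  have "distr Q borel (\<lambda>\<omega>. \<Sum>k\<in>?K i. X k \<omega>) = convolution_power F (\<eta> (Suc i) - \<eta> i)" if "i < n" for i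
    using distr_block_sum[OF Q X, of "\<eta> i" "\<eta> (Suc i) - \<eta> i"] \<eta>[OF that] by simp
  then show ?thesis by (simp add: emeasure_indep_vars[OF Q ind A])
qed

lemma sum_blocks:
  fixes X :: "nat \<Rightarrow> real"
  assumes "a \<le> b"
  shows "(\<Sum>k=1..b. X k) - (\<Sum>k=1..a. X k) = (\<Sum>k\<in>{a<..b}. X k)"
proof -
  have "{1..b} - {1..a} = {a<..b}" by auto
  then show ?thesis using sum_diff[of "{1..b}" "{1..a}" X] assms by simp
qed

lemma nn_integral_indep_nat:
  fixes D :: "nat \<Rightarrow> 'q \<Rightarrow> nat" and g :: "nat \<Rightarrow> nat \<Rightarrow> ennreal"
  assumes Q: "prob_space Q" and ind: "prob_space.indep_vars Q (\<lambda>_. count_space UNIV) D {..<n}"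
    and D: "\<And>i. i < n \<Longrightarrow> distr Q (count_space UNIV) (D i) = measure_pmf (p i)"
  shows "(\<integral>\<^sup>+\<omega>. (\<Prod>i<n. g i (D i \<omega>)) \<partial>Q) = (\<Prod>i<n. \<integral>\<^sup>+k. g i k \<partial>measure_pmf (p i))"
proof -
  interpret prob_space Q by fact
  have "indep_vars (\<lambda>_. borel) (\<lambda>i \<omega>. g i (D i \<omega>)) {..<n}"
    by (rule indep_vars_compose2[OF ind]) simp
  then have "(\<integral>\<^sup>+\<omega>. (\<Prod>i<n. g i (D i \<omega>)) \<partial>Q) = (\<Prod>i<n. \<integral>\<^sup>+\<omega>. g i (D i \<omega>) \<partial>Q)"
    by (intro indep_vars_nn_integral) auto
  also have "\<dots> = (\<Prod>i<n. \<integral>\<^sup>+k. g i k \<partial>measure_pmf (p i))"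
  proof (rule prod.cong[OF refl])
    fix i assume "i \<in> {..<n}"
    then have "D i \<in> measurable Q (count_space UNIV)" "distr Q (count_space UNIV) (D i) = measure_pmf (p i)"
      using ind D by (auto simp: indep_vars_def)
    then show "(\<integral>\<^sup>+\<omega>. g i (D i \<omega>) \<partial>Q) = (\<integral>\<^sup>+k. g i k \<partial>measure_pmf (p i))"
      using nn_integral_distr[of "D i" Q "count_space UNIV" "g i"] by simp
  qed
  finally show ?thesis .
qed

context
  fixes Q :: "'q measure" and lam F N X
  assumes Q: "prob_space Q" and lam: "lam > 0" and N: "poisson_process Q lam N" and X: "iid Q F X"
    and F: "real_distribution F"
    and ind: "indep_rv Q (\<Pi>\<^sub>M t\<in>{0..}. count_space UNIV) (trajectory N)
                (\<Pi>\<^sub>M k\<in>{1..}. borel) (\<lambda>\<omega>. \<lambda>k\<in>{1..}. X k \<omega>)"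
begin

lemma compound_sum_measurable:
  assumes "t \<ge> 0"
  shows "(\<lambda>\<omega>. \<Sum>k=1..N t \<omega>. X k \<omega>) \<in> borel_measurable Q"
proof (rule measurable_compose_countable)
  show "N t \<in> measurable Q (count_space UNIV)" using N assms by (auto simp: poisson_process_def)
  show "(\<lambda>\<omega>. \<Sum>k=1..i. X k \<omega>) \<in> borel_measurable Q" for i
    by (intro borel_measurable_sum iid_measurable[OF Q X]) auto
qed

lemma compound_sum_trajectory:
  "trajectory (\<lambda>t \<omega>. \<Sum>k=1..N t \<omega>. X k \<omega>) \<in> measurable Q cadlag_space"
  unfolding measurable_cadlag_space_iff
proof (intro conjI allI impI ballI compound_sum_measurable)
  fix \<omega> assume "\<omega> \<in> space Q"
  then show "cadlag (trajectory (\<lambda>t \<omega>. \<Sum>k=1..N t \<omega>. X k \<omega>) \<omega>)"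
    unfolding trajectory_def
    using N by (intro cadlag_step[where n="\<lambda>t. N t \<omega>" and \<phi>="\<lambda>m. \<Sum>k=1..m. X k \<omega>"])
      (auto simp: poisson_process_def)
qed

lemma distr_poisson_increment:
  assumes "0 \<le> s" "s \<le> t"
  shows "distr Q (count_space UNIV) (\<lambda>\<omega>. N t \<omega> - N s \<omega>) = measure_pmf (poisson0 (lam * (t - s)))"
proof (cases "s = t")
  case True
  interpret prob_space Q by fact
  show ?thesis using True by (simp add: distr_const poisson0_def return_pmf.rep_eq)
next
  case False
  then show ?thesis using N assms lam by (simp add: poisson_process_def poisson0_def)
qed

text \<open>Independence of N and X lets the counting path be frozen. For fixed counts the
  increments are sums over disjoint blocks, whose joint probability is a product of convolution
  powers; averaging over the independent Poisson count increments turns each factor into a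
  mixture.\<close>

lemma compound_sum_increments:
  "has_increments Q (\<lambda>t \<omega>. \<Sum>k=1..N t \<omega>. X k \<omega>) (\<lambda>u. mixture (poisson0 (lam * u)) F)"
  unfolding has_increments_def
proof (intro conjI allI impI compound_sum_measurable)
  show "AE \<omega> in Q. (\<Sum>k=1..N 0 \<omega>. X k \<omega>) = 0"
    using N by (intro AE_I2) (simp add: poisson_process_def)
  fix \<tau> :: "nat \<Rightarrow> real" and n and A :: "nat \<Rightarrow> real set"
  assume *: "0 \<le> \<tau> 0 \<and> (\<forall>i<n. \<tau> i \<le> \<tau> (Suc i)) \<and> (\<forall>i<n. A i \<in> sets borel)"
  then have \<tau>: "0 \<le> \<tau> 0" "\<And>i. i < n \<Longrightarrow> \<tau> i \<le> \<tau> (Suc i)" and A: "\<And>i. i < n \<Longrightarrow> A i \<in> sets borel" by auto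
  have nn: "0 \<le> \<tau> i" if "i \<le> n" for i by (rule times_nonneg[of \<tau> n, OF \<tau> that])
  have mono: "N (\<tau> i) \<omega> \<le> N (\<tau> (Suc i)) \<omega>" if "i < n" "\<omega> \<in> space Q" for i \<omega>
    using N that nn[of i] nn[of "Suc i"] \<tau>(2)[of i] by (auto simp: poisson_process_def mono_on_def)
  let ?S = "\<Pi>\<^sub>M t\<in>{0::real..}. count_space (UNIV :: nat set)" and ?T = "\<Pi>\<^sub>M k\<in>{1::nat..}. (borel :: real measure)"
  let ?V = "\<lambda>\<omega>. \<lambda>k\<in>{1..}. X k \<omega>"
  define E where "E = {z\<in>space (?S \<Otimes>\<^sub>M ?T). \<forall>i<n. (\<Sum>k\<in>{fst z (\<tau> i)<..fst z (\<tau> (Suc i))}. snd z k) \<in> A i}"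
  have E: "E \<in> sets (?S \<Otimes>\<^sub>M ?T)"
  proof -
    have "{z\<in>space (?S \<Otimes>\<^sub>M ?T). \<forall>i\<in>{..<n}. (\<Sum>k\<in>{fst z (\<tau> i)<..fst z (\<tau> (Suc i))}. snd z k) \<in> A i} \<in> sets (?S \<Otimes>\<^sub>M ?T)"
    proof (rule sets.sets_Collect_finite_All)
      fix i assume i: "i \<in> {..<n}"
      then have [measurable]: "A i \<in> sets borel" using A by auto
      have fm: "(\<lambda>z. fst z (\<tau> j)) \<in> measurable (?S \<Otimes>\<^sub>M ?T) (count_space UNIV)" if "j \<le> n" for j
        using nn[OF that] by (intro measurable_compose[OF measurable_fst measurable_component_singleton]) auto
      have sm: "(\<lambda>z. \<Sum>k\<in>{a<..b}. snd z k) \<in> borel_measurable (?S \<Otimes>\<^sub>M ?T)" for a b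
        by (intro borel_measurable_sum measurable_compose[OF measurable_snd measurable_component_singleton]) auto
      \<comment> \<open>The bounds of the sum are random but range over a countable set, so
        measurability for fixed bounds suffices, one bound at a time.\<close>
      have [measurable]: "(\<lambda>z. \<Sum>k\<in>{fst z (\<tau> i)<..fst z (\<tau> (Suc i))}. snd z k) \<in> borel_measurable (?S \<Otimes>\<^sub>M ?T)"
        by (rule measurable_compose_countable[OF measurable_compose_countable[OF sm fm] fm]) (use i in auto)
      show "{z\<in>space (?S \<Otimes>\<^sub>M ?T). (\<Sum>k\<in>{fst z (\<tau> i)<..fst z (\<tau> (Suc i))}. snd z k) \<in> A i} \<in> sets (?S \<Otimes>\<^sub>M ?T)"
        by measurable
    qed simp
    then show ?thesis by (simp only: Ball_def lessThan_iff E_def)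
  qed
  have in_E: "(trajectory N \<omega>, ?V \<omega>') \<in> E \<longleftrightarrow> (\<forall>i<n. (\<Sum>k\<in>{N (\<tau> i) \<omega><..N (\<tau> (Suc i)) \<omega>}. X k \<omega>') \<in> A i)"
    if "\<omega> \<in> space Q" "\<omega>' \<in> space Q" for \<omega> \<omega>'
  proof -
    have sp: "trajectory N \<omega> \<in> space ?S" "?V \<omega>' \<in> space ?T"
      using ind that by (auto simp: indep_rv_def dest: measurable_space)
    have "(\<Sum>k\<in>{trajectory N \<omega> (\<tau> i)<..trajectory N \<omega> (\<tau> (Suc i))}. ?V \<omega>' k) =
       (\<Sum>k\<in>{N (\<tau> i) \<omega><..N (\<tau> (Suc i)) \<omega>}. X k \<omega>')" if "i < n" for i
      using nn[of i] nn[of "Suc i"] that by (auto simp: trajectory_def intro!: sum.cong)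
    then show ?thesis using sp by (simp add: E_def space_pair_measure)
  qed
  have "emeasure Q {\<omega>\<in>space Q. \<forall>i<n. (\<Sum>k=1..N (\<tau> (Suc i)) \<omega>. X k \<omega>) - (\<Sum>k=1..N (\<tau> i) \<omega>. X k \<omega>) \<in> A i} =
    emeasure Q {\<omega>\<in>space Q. (trajectory N \<omega>, ?V \<omega>) \<in> E}"
    by (intro arg_cong[where f="emeasure Q"] Collect_cong conj_cong refl)
       (auto simp: in_E sum_blocks mono simp del: One_nat_def)
  also have "\<dots> = (\<integral>\<^sup>+\<omega>. emeasure Q {\<omega>'\<in>space Q. (trajectory N \<omega>, ?V \<omega>') \<in> E} \<partial>Q)"
    by (rule indep_rv_emeasure[OF Q ind E])
  also have "\<dots> = (\<integral>\<^sup>+\<omega>. (\<Prod>i<n. emeasure (convolution_power F (N (\<tau> (Suc i)) \<omega> - N (\<tau> i) \<omega>)) (A i)) \<partial>Q)"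
  proof (rule nn_integral_cong)
    fix \<omega> assume \<omega>: "\<omega> \<in> space Q"
    have "{\<omega>'\<in>space Q. (trajectory N \<omega>, ?V \<omega>') \<in> E} =
      {\<omega>'\<in>space Q. \<forall>i<n. (\<Sum>k\<in>{N (\<tau> i) \<omega><..N (\<tau> (Suc i)) \<omega>}. X k \<omega>') \<in> A i}"
      by (intro Collect_cong conj_cong refl, rule in_E[OF \<omega>], assumption)
    then show "emeasure Q {\<omega>'\<in>space Q. (trajectory N \<omega>, ?V \<omega>') \<in> E} =
      (\<Prod>i<n. emeasure (convolution_power F (N (\<tau> (Suc i)) \<omega> - N (\<tau> i) \<omega>)) (A i))"
      using emeasure_block_sums[of Q F X n "\<lambda>i. N (\<tau> i) \<omega>" A, OF Q X mono A] \<omega> by simp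
  qed
  also have "\<dots> = (\<Prod>i<n. \<integral>\<^sup>+k. emeasure (convolution_power F k) (A i) \<partial>measure_pmf (poisson0 (lam * (\<tau> (Suc i) - \<tau> i))))"
  proof (rule nn_integral_indep_nat[OF Q])
    show "prob_space.indep_vars Q (\<lambda>_. count_space UNIV) (\<lambda>i \<omega>. N (\<tau> (Suc i)) \<omega> - N (\<tau> i) \<omega>) {..<n}"
      using N \<tau> by (simp add: poisson_process_def)
    show "distr Q (count_space UNIV) (\<lambda>\<omega>. N (\<tau> (Suc i)) \<omega> - N (\<tau> i) \<omega>) = measure_pmf (poisson0 (lam * (\<tau> (Suc i) - \<tau> i)))"
      if "i < n" for i
      using nn[of i] that \<tau>(2)[of i] by (intro distr_poisson_increment) auto
  qed
  also have "\<dots> = (\<Prod>i<n. emeasure (mixture (poisson0 (lam * (\<tau> (Suc i) - \<tau> i))) F) (A i))"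
    using A by (intro prod.cong refl) (simp add: emeasure_mixture[OF F])
  finally show "emeasure Q {\<omega>\<in>space Q. \<forall>i<n. (\<Sum>k=1..N (\<tau> (Suc i)) \<omega>. X k \<omega>) - (\<Sum>k=1..N (\<tau> i) \<omega>. X k \<omega>) \<in> A i} =
    (\<Prod>i<n. emeasure (mixture (poisson0 (lam * (\<tau> (Suc i) - \<tau> i))) F) (A i))" .
qed

end

lemma compound_poisson_increments:
  assumes lam: "lam > 0" and F: "real_distribution F" and M: "compound_poisson P M lam F"
  shows "has_increments P M (\<lambda>u. mixture (poisson0 (lam * u)) F)"
proof -
  from M have m: "trajectory M \<in> measurable P cadlag_space"
    and "compound_poisson_law (distr P cadlag_space (trajectory M)) lam F"
    by (auto simp: compound_poisson_def)
  then obtain Q :: "(nat \<Rightarrow> real \<times> real) measure" and N X where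
    Q: "prob_space Q" "poisson_process Q lam N" "iid Q F X"
      "indep_rv Q (\<Pi>\<^sub>M t\<in>{0..}. count_space UNIV) (trajectory N)
          (\<Pi>\<^sub>M k\<in>{1..}. borel) (\<lambda>\<omega>. \<lambda>k\<in>{1..}. X k \<omega>)"
    and eq: "distr P cadlag_space (trajectory M) =
      distr Q cadlag_space (trajectory (\<lambda>t \<omega>. \<Sum>k=1..N t \<omega>. X k \<omega>))"
    unfolding compound_poisson_law_def by blast
  note * = Q(1) lam Q(2,3) F Q(4)
  show ?thesis
    by (rule has_increments_transfer[OF eq[symmetric] compound_sum_increments[OF *] compound_sum_trajectory[OF *] m])
qed

section \<open>Random time change and subordinators\<close>

text \<open>A right-continuous path is the limit of its values at \<open>(\<lfloor>n u\<rfloor> + 1) / n\<close>, which lie strictly to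
  the right of u; the truncation at 0 avoids the arbitrary values of a path at negative times.\<close>

lemma measurable_eval_joint:
  "(\<lambda>z. fst z (max 0 (snd z))) \<in> borel_measurable (cadlag_space \<Otimes>\<^sub>M borel)"
proof (rule borel_measurable_LIMSEQ_real)
  let ?r = "\<lambda>n u. real_of_int (\<lfloor>real (Suc n) * u\<rfloor> + 1) / real (Suc n)"
  show "(\<lambda>z. fst z (max 0 (?r n (max 0 (snd z))))) \<in> borel_measurable (cadlag_space \<Otimes>\<^sub>M borel)" for n
  proof (rule measurable_compose_countable[where g="\<lambda>z. \<lfloor>real (Suc n) * max 0 (snd z)\<rfloor>"])
    show "(\<lambda>z. fst z (max 0 (real_of_int (i + 1) / real (Suc n)))) \<in> borel_measurable (cadlag_space \<Otimes>\<^sub>M borel)" for i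
      by (intro measurable_compose[OF measurable_fst measurable_eval_cadlag]) simp
    show "(\<lambda>z. \<lfloor>real (Suc n) * max 0 (snd z)\<rfloor>) \<in> measurable (cadlag_space \<Otimes>\<^sub>M borel) (count_space UNIV)"
      by measurable
  qed
  fix z assume "z \<in> space (cadlag_space \<Otimes>\<^sub>M (borel :: real measure))"
  then have x: "cadlag (fst z)" by (auto simp: space_pair_measure cadlag_space_def space_restrict_space)
  define v where "v = max 0 (snd z)"
  have v: "v \<ge> 0" by (simp add: v_def)
  have gt: "v < ?r n v" for n
  proof -
    have "real (Suc n) * v < real_of_int (\<lfloor>real (Suc n) * v\<rfloor> + 1)" by linarith
    then show ?thesis by (simp add: field_simps)
  qed
  have le: "?r n v \<le> v + inverse (real (Suc n))" for n
  proof -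
    have "real_of_int (\<lfloor>real (Suc n) * v\<rfloor> + 1) \<le> real (Suc n) * v + 1" by linarith
    then have "?r n v \<le> (real (Suc n) * v + 1) / real (Suc n)" by (rule divide_right_mono) simp
    also have "\<dots> = v + inverse (real (Suc n))" by (simp add: field_simps)
    finally show ?thesis .
  qed
  have "(\<lambda>n. v + inverse (real (Suc n))) \<longlonglongrightarrow> v + 0"
    by (intro tendsto_add tendsto_const LIMSEQ_inverse_real_of_nat)
  then have "(\<lambda>n. ?r n v) \<longlonglongrightarrow> v"
    by (intro tendsto_sandwich[of "\<lambda>_. v" "\<lambda>n. ?r n v" sequentially "\<lambda>n. v + inverse (real (Suc n))"] always_eventually allI le less_imp_le[OF gt]) auto
  moreover have "?r n v \<in> {v<..} \<and> ?r n v \<noteq> v" for n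
    using gt[of n] by (simp only: greaterThan_iff less_imp_neq[symmetric] simp_thms)
  ultimately have "filterlim (\<lambda>n. ?r n v) (at_right v) sequentially"
    unfolding filterlim_at by (intro conjI always_eventually allI) blast+
  moreover have "(fst z \<longlongrightarrow> fst z v) (at_right v)"
    using x v by (auto simp: cadlag_def continuous_within)
  ultimately have "(\<lambda>n. fst z (?r n v)) \<longlonglongrightarrow> fst z v" by (rule filterlim_compose[rotated])
  moreover have "max 0 (?r n v) = ?r n v" for n using gt[of n] v by (simp add: max_def)
  ultimately show "(\<lambda>n. fst z (max 0 (?r n (max 0 (snd z))))) \<longlonglongrightarrow> fst z (max 0 (snd z))"
    unfolding v_def by simp
qed

text \<open>With the path of h frozen, the times h (\<tau> i) are deterministic and nondecreasing,
  so the increments of M have the product law given by \<kappa> at the increments of h. These are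
  independent in turn, so the expectation of the product splits, and each factor is \<kappa>
  averaged over \<sigma>, which is \<kappa>'.\<close>

lemma has_increments_time_change:
  assumes P: "prob_space P"
    and M: "has_increments P M \<kappa>" "trajectory M \<in> measurable P cadlag_space"
    and \<kappa>: "\<And>B. B \<in> sets borel \<Longrightarrow> (\<lambda>u. emeasure (\<kappa> u) B) \<in> borel_measurable borel"
    and h: "has_increments P h \<sigma>" "\<And>u. real_distribution (\<sigma> u)"
    and mono: "\<And>\<omega>. \<omega> \<in> space P \<Longrightarrow> mono_on {0..} (\<lambda>t. h t \<omega>)" and h0: "\<And>\<omega>. \<omega> \<in> space P \<Longrightarrow> h 0 \<omega> = 0"
    and ind: "indep_rv P (\<Pi>\<^sub>M t\<in>{0..}. borel) (trajectory h) cadlag_space (trajectory M)"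
    and \<kappa>': "\<And>u B. u \<ge> 0 \<Longrightarrow> B \<in> sets borel \<Longrightarrow> emeasure (\<kappa>' u) B = (\<integral>\<^sup>+x. emeasure (\<kappa> x) B \<partial>\<sigma> u)"
  shows "has_increments P (\<lambda>t \<omega>. M (h t \<omega>) \<omega>) \<kappa>'"
  unfolding has_increments_def
proof (intro conjI allI impI)
  have nonneg: "h t \<omega> \<ge> 0" if "t \<ge> 0" "\<omega> \<in> space P" for t \<omega>
    using mono[OF that(2)] h0[OF that(2)] that by (force simp: mono_on_def)
  let ?S = "\<Pi>\<^sub>M t\<in>{0::real..}. (borel :: real measure)"
  show "(\<lambda>\<omega>. M (h t \<omega>) \<omega>) \<in> borel_measurable P" if t: "t \<ge> 0" for t
  proof -
    have "h t \<in> borel_measurable P" using h(1) t by (simp add: has_increments_def)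
    then have "(\<lambda>\<omega>. (\<lambda>z. fst z (max 0 (snd z))) (trajectory M \<omega>, h t \<omega>)) \<in> borel_measurable P"
      by (intro measurable_compose[OF measurable_Pair measurable_eval_joint] M)
    also have "?this \<longleftrightarrow> ?thesis"
      by (intro measurable_cong) (use nonneg[OF t] in \<open>simp add: trajectory_def max_def\<close>)
    finally show ?thesis .
  qed
  have "AE \<omega> in P. M 0 \<omega> = 0" using M(1) by (simp add: has_increments_def)
  then show "AE \<omega> in P. M (h 0 \<omega>) \<omega> = 0"
    by (rule AE_mp) (use h0 in \<open>auto intro!: AE_I2\<close>)
  fix \<tau> :: "nat \<Rightarrow> real" and n and A :: "nat \<Rightarrow> real set"
  assume *: "0 \<le> \<tau> 0 \<and> (\<forall>i<n. \<tau> i \<le> \<tau> (Suc i)) \<and> (\<forall>i<n. A i \<in> sets borel)"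
  then have \<tau>: "0 \<le> \<tau> 0" "\<And>i. i < n \<Longrightarrow> \<tau> i \<le> \<tau> (Suc i)" and A: "\<And>i. i < n \<Longrightarrow> A i \<in> sets borel" by auto
  have nn: "0 \<le> \<tau> i" if "i \<le> n" for i by (rule times_nonneg[of \<tau> n, OF \<tau> that])
  \<comment> \<open>The truncation is invisible on actual paths of h, which are nonnegative. It is
    present because E has to be measurable in the whole product space, where the first component may
    take negative values.\<close>
  let ?e = "\<lambda>z t. snd z (max 0 (fst z t)) :: real"
  define E where "E = {z\<in>space (?S \<Otimes>\<^sub>M cadlag_space). \<forall>i<n. ?e z (\<tau> (Suc i)) - ?e z (\<tau> i) \<in> A i}"
  have E: "E \<in> sets (?S \<Otimes>\<^sub>M cadlag_space)"
  proof -
    have "{z\<in>space (?S \<Otimes>\<^sub>M cadlag_space). \<forall>i\<in>{..<n}. ?e z (\<tau> (Suc i)) - ?e z (\<tau> i) \<in> A i} \<in> sets (?S \<Otimes>\<^sub>M cadlag_space)"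
    proof (rule sets.sets_Collect_finite_All)
      fix i assume i: "i \<in> {..<n}"
      have em: "(\<lambda>z. ?e z (\<tau> j)) \<in> borel_measurable (?S \<Otimes>\<^sub>M cadlag_space)" if "j \<le> n" for j
      proof -
        have "(\<lambda>z. (snd z, fst z (\<tau> j))) \<in> measurable (?S \<Otimes>\<^sub>M cadlag_space) (cadlag_space \<Otimes>\<^sub>M borel)"
          using nn[OF that]
          by (intro measurable_Pair measurable_snd measurable_compose[OF measurable_fst measurable_component_singleton]) auto
        from measurable_compose[OF this measurable_eval_joint] show ?thesis by simp
      qed
      have [measurable]: "A i \<in> sets borel" "(\<lambda>z. ?e z (\<tau> i)) \<in> borel_measurable (?S \<Otimes>\<^sub>M cadlag_space)"
        "(\<lambda>z. ?e z (\<tau> (Suc i))) \<in> borel_measurable (?S \<Otimes>\<^sub>M cadlag_space)"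
        using A i em by auto
      show "{z\<in>space (?S \<Otimes>\<^sub>M cadlag_space). ?e z (\<tau> (Suc i)) - ?e z (\<tau> i) \<in> A i} \<in> sets (?S \<Otimes>\<^sub>M cadlag_space)"
        by measurable
    qed simp
    then show ?thesis by (simp only: Ball_def lessThan_iff E_def)
  qed
  have in_E: "(trajectory h \<omega>, trajectory M \<omega>') \<in> E \<longleftrightarrow>
      (\<forall>i<n. M (h (\<tau> (Suc i)) \<omega>) \<omega>' - M (h (\<tau> i) \<omega>) \<omega>' \<in> A i)"
    if "\<omega> \<in> space P" "\<omega>' \<in> space P" for \<omega> \<omega>'
  proof -
    have sp: "trajectory h \<omega> \<in> space ?S" "trajectory M \<omega>' \<in> space cadlag_space"
      using ind that by (auto simp: indep_rv_def dest: measurable_space)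
    have "?e (trajectory h \<omega>, trajectory M \<omega>') (\<tau> i) = M (h (\<tau> i) \<omega>) \<omega>'" if "i \<le> n" for i
      using nn[OF that] nonneg[OF nn[OF that] \<open>\<omega> \<in> space P\<close>] by (simp add: trajectory_def max_def)
    then show ?thesis using sp by (auto simp: E_def space_pair_measure Suc_le_eq)
  qed
  have "emeasure P {\<omega>\<in>space P. \<forall>i<n. M (h (\<tau> (Suc i)) \<omega>) \<omega> - M (h (\<tau> i) \<omega>) \<omega> \<in> A i} =
    emeasure P {\<omega>\<in>space P. (trajectory h \<omega>, trajectory M \<omega>) \<in> E}"
    by (intro arg_cong[where f="emeasure P"] Collect_cong conj_cong refl) (simp add: in_E)
  also have "\<dots> = (\<integral>\<^sup>+\<omega>. emeasure P {\<omega>'\<in>space P. (trajectory h \<omega>, trajectory M \<omega>') \<in> E} \<partial>P)"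
    by (rule indep_rv_emeasure[OF P ind E])
  \<comment> \<open>The guard i < n inside the product changes no factor. It makes the factor
    function measurable for every index, as \<open>has_increments_nn_integral\<close> demands,
    although A i is known to be Borel for i < n only.\<close>
  also have "\<dots> = (\<integral>\<^sup>+\<omega>. (\<Prod>i<n. (if i < n then emeasure (\<kappa> (h (\<tau> (Suc i)) \<omega> - h (\<tau> i) \<omega>)) (A i) else 0)) \<partial>P)"
  proof (rule nn_integral_cong)
    fix \<omega> assume \<omega>: "\<omega> \<in> space P"
    have "{\<omega>'\<in>space P. (trajectory h \<omega>, trajectory M \<omega>') \<in> E} =
      {\<omega>'\<in>space P. \<forall>i<n. M (h (\<tau> (Suc i)) \<omega>) \<omega>' - M (h (\<tau> i) \<omega>) \<omega>' \<in> A i}"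
      by (intro Collect_cong conj_cong refl, rule in_E[OF \<omega>], assumption)
    moreover have "h (\<tau> i) \<omega> \<le> h (\<tau> (Suc i)) \<omega>" if "i < n" for i
      using mono[OF \<omega>] nn[of i] nn[of "Suc i"] that \<tau>(2)[OF that] by (auto simp: mono_on_def)
    ultimately show "emeasure P {\<omega>'\<in>space P. (trajectory h \<omega>, trajectory M \<omega>') \<in> E} =
      (\<Prod>i<n. (if i < n then emeasure (\<kappa> (h (\<tau> (Suc i)) \<omega> - h (\<tau> i) \<omega>)) (A i) else 0))"
      using M(1)[unfolded has_increments_def, THEN conjunct2, THEN conjunct2, rule_format, of "\<lambda>i. h (\<tau> i) \<omega>" n A]
        A nonneg[OF \<tau>(1) \<omega>] by simp
  qed
  also have "\<dots> = (\<Prod>i<n. \<integral>\<^sup>+x. (if i < n then emeasure (\<kappa> x) (A i) else 0) \<partial>\<sigma> (\<tau> (Suc i) - \<tau> i))"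
  proof (rule has_increments_nn_integral[where \<tau>=\<tau> and n=n and g="\<lambda>i x. if i < n then emeasure (\<kappa> x) (A i) else 0", OF P h \<tau>])
    show "(\<lambda>x. if i < n then emeasure (\<kappa> x) (A i) else 0) \<in> borel_measurable borel" for i
      using \<kappa>[OF A] by (cases "i < n") auto
  qed
  also have "\<dots> = (\<Prod>i<n. emeasure (\<kappa>' (\<tau> (Suc i) - \<tau> i)) (A i))"
    using \<tau>(2) A by (intro prod.cong refl) (simp add: \<kappa>')
  finally show "emeasure P {\<omega>\<in>space P. \<forall>i<n. M (h (\<tau> (Suc i)) \<omega>) \<omega> - M (h (\<tau> i) \<omega>) \<omega> \<in> A i} =
    (\<Prod>i<n. emeasure (\<kappa>' (\<tau> (Suc i) - \<tau> i)) (A i))" .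
qed

section \<open>The subordinator and its real-valued version\<close>

lemma bernstein_0 [simp]: "bernstein a b \<nu> 0 = a"
  by (simp add: bernstein_def)

text \<open>Setting the whole path to 0 when it is ever killed keeps every path monotone and
  right-continuous, so that time-changed paths are cadlag without exceptional set.\<close>

definition real_version :: "(real \<Rightarrow> 'a \<Rightarrow> ennreal) \<Rightarrow> real \<Rightarrow> 'a \<Rightarrow> real" where
  "real_version H t \<omega> = (if \<forall>n. H (real n) \<omega> < \<infinity> then enn2real (H t \<omega>) else 0)"

lemma real_version_nonneg [simp]: "0 \<le> real_version H t \<omega>"
  by (simp add: real_version_def)

context
  fixes P :: "'a measure" and a b \<nu> H
  assumes P: "prob_space P" and H: "bernstein_subordinator P a b \<nu> H"
begin

lemma subordinator_measurable [measurable]: "t \<ge> 0 \<Longrightarrow> H t \<in> borel_measurable P"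
  using H by (simp add: bernstein_subordinator_def)

lemma subordinator_alive:
  assumes "t \<ge> 0"
  shows "measure P {\<omega>\<in>space P. H t \<omega> < \<infinity>} = exp (- t * a)"
proof -
  have "(LINT \<omega>|P. (if H t \<omega> = \<infinity> then 0 else exp (- 0 * enn2real (H t \<omega>)))) = exp (- t * bernstein a b \<nu> 0)"
    using H assms unfolding bernstein_subordinator_def by blast
  also have "(LINT \<omega>|P. (if H t \<omega> = \<infinity> then 0 else exp (- 0 * enn2real (H t \<omega>)))) =
    (LINT \<omega>|P. indicator {\<omega>\<in>space P. H t \<omega> < \<infinity>} \<omega>)"
    by (intro Bochner_Integration.integral_cong) (auto simp: indicator_def less_top)
  also have "\<dots> = measure P {\<omega>\<in>space P. H t \<omega> < \<infinity>}"
    using assms by (auto intro!: arg_cong[where f="measure P"])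
  finally show ?thesis by simp
qed

lemma subordinator_mono: "\<omega> \<in> space P \<Longrightarrow> 0 \<le> s \<Longrightarrow> s \<le> t \<Longrightarrow> H s \<omega> \<le> H t \<omega>"
  using H by (auto simp: bernstein_subordinator_def mono_on_def)

lemma subordinator_markov:
  assumes "s \<ge> 0" "t \<ge> 0" "C \<in> sets (\<Pi>\<^sub>M u\<in>{0..s}. borel)" "B \<in> sets borel"
  shows "measure P {\<omega>\<in>space P. (\<lambda>u\<in>{0..s}. H u \<omega>) \<in> C \<and> H s \<omega> < \<infinity> \<and> H (s + t) \<omega> - H s \<omega> \<in> B} =
    measure P {\<omega>\<in>space P. (\<lambda>u\<in>{0..s}. H u \<omega>) \<in> C \<and> H s \<omega> < \<infinity>} * measure P {\<omega>\<in>space P. H t \<omega> \<in> B}"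
  using H[unfolded bernstein_subordinator_def, THEN conjunct2, THEN conjunct2, THEN conjunct2, THEN conjunct1]
    assms by (elim allE impE ballE) auto

text \<open>By monotonicity, survival at all integer times is survival at all times. This is why
  \<open>real_version\<close> tests integers only: the test is then a countable, hence measurable,
  condition.\<close>

lemma subordinator_finite:
  assumes "\<omega> \<in> space P" "\<forall>n. H (real n) \<omega> < \<infinity>" "t \<ge> 0"
  shows "H t \<omega> < \<infinity>"
proof -
  have "H t \<omega> \<le> H (real (nat \<lceil>t\<rceil>)) \<omega>" by (rule subordinator_mono) (use assms in \<open>auto intro: real_nat_ceiling_ge\<close>)
  then show ?thesis using assms(2) by (auto intro: le_less_trans)
qed

lemma ennreal_real_version:
  assumes "\<omega> \<in> space P" "\<forall>n. H (real n) \<omega> < \<infinity>" "t \<ge> 0"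
  shows "H t \<omega> = ennreal (real_version H t \<omega>)"
  using subordinator_finite[OF assms] assms(2) by (simp add: real_version_def)

lemma real_version_0: "\<omega> \<in> space P \<Longrightarrow> real_version H 0 \<omega> = 0"
  using H by (simp add: real_version_def bernstein_subordinator_def)

lemma real_version_mono:
  assumes "\<omega> \<in> space P" shows "mono_on {0..} (\<lambda>t. real_version H t \<omega>)"
proof (cases "\<forall>n. H (real n) \<omega> < \<infinity>")
  case True
  show ?thesis
  proof (rule mono_onI)
    fix r s :: real assume rs: "r \<in> {0..}" "s \<in> {0..}" "r \<le> s"
    have "enn2real (H r \<omega>) \<le> enn2real (H s \<omega>)"
      by (rule enn2real_mono) (use subordinator_mono[of \<omega> r s] subordinator_finite[OF assms True, of s] assms rs in auto)
    then show "real_version H r \<omega> \<le> real_version H s \<omega>" by (simp add: real_version_def True)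
  qed
qed (auto simp: real_version_def mono_on_def)

lemma real_version_continuous:
  assumes "\<omega> \<in> space P" "t \<ge> 0"
  shows "continuous (at_right t) (\<lambda>t. real_version H t \<omega>)"
proof (cases "\<forall>n. H (real n) \<omega> < \<infinity>")
  case True
  have "((\<lambda>s. H s \<omega>) \<longlongrightarrow> H t \<omega>) (at_right t)"
    using H assms by (auto simp: bernstein_subordinator_def continuous_within)
  moreover have "H t \<omega> = ennreal (real_version H t \<omega>)" by (rule ennreal_real_version[OF assms(1) True assms(2)])
  ultimately have "((\<lambda>s. enn2real (H s \<omega>)) \<longlongrightarrow> real_version H t \<omega>) (at_right t)"
    by (intro tendsto_enn2real) (auto simp: real_version_def)
  moreover have "(\<lambda>s. enn2real (H s \<omega>)) = (\<lambda>s. real_version H s \<omega>)"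
    using True by (simp add: real_version_def)
  ultimately show ?thesis by (simp add: continuous_within)
next
  case False
  then have "(\<lambda>t. real_version H t \<omega>) = (\<lambda>_. 0)"
    unfolding real_version_def by (simp only: if_not_P if_False)
  then show ?thesis by simp
qed

lemma real_version_measurable [measurable]:
  assumes [simp]: "t \<ge> 0" shows "real_version H t \<in> borel_measurable P"
  unfolding real_version_def by measurable

text \<open>The real version is a fixed measurable functional f of the whole path of H, since the
  survival test looks at countably many coordinates; independence of M is therefore
  inherited.\<close>

lemma indep_real_version:
  assumes ind: "indep_rv P (\<Pi>\<^sub>M t\<in>{0..}. borel) (trajectory H) cadlag_space (trajectory M)"
  shows "indep_rv P (\<Pi>\<^sub>M t\<in>{0..}. borel) (trajectory (real_version H)) cadlag_space (trajectory M)"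
proof -
  let ?S = "\<Pi>\<^sub>M t\<in>{0::real..}. (borel :: ennreal measure)"
  define f where "f x = (\<lambda>t\<in>{0..}. if \<forall>n. x (real n) < \<infinity> then enn2real (x t) else 0)" for x :: "real \<Rightarrow> ennreal"
  have f: "f \<in> measurable ?S (\<Pi>\<^sub>M t\<in>{0..}. borel)"
    unfolding f_def
  proof (rule measurable_restrict)
    fix t :: real assume t: "t \<in> {0..}"
    have m: "(\<lambda>x. x t) \<in> borel_measurable ?S" if "t \<ge> 0" for t
      using that by (intro measurable_component_singleton) auto
    have [measurable]: "(\<lambda>x. x t) \<in> borel_measurable ?S" "\<And>n. (\<lambda>x. x (real n)) \<in> borel_measurable ?S"
      using m t by auto
    show "(\<lambda>x. if \<forall>n. x (real n) < \<infinity> then enn2real (x t) else 0) \<in> borel_measurable ?S"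
      by measurable
  qed
  have "f (trajectory H \<omega>) = trajectory (real_version H) \<omega>" for \<omega>
    by (auto simp: f_def trajectory_def real_version_def fun_eq_iff)
  then show ?thesis
    using indep_rv_compose[OF P ind f measurable_ident] by (simp add: id_def)
qed

context
  assumes a: "a = 0"
begin

lemma subordinator_never_killed: "AE \<omega> in P. \<forall>n. H (real n) \<omega> < \<infinity>"
proof -
  interpret prob_space P by (rule P)
  have "AE \<omega> in P. H (real n) \<omega> < \<infinity>" for n
    using subordinator_alive[of "real n"] a by (subst prob_Collect_eq_1[symmetric]) auto
  then show ?thesis by (subst AE_all_countable) auto
qed

lemma laplace_real_version:
  assumes "t \<ge> 0" "\<mu> \<ge> 0"
  shows "(LINT \<omega>|P. exp (- \<mu> * real_version H t \<omega>)) = exp (- t * bernstein a b \<nu> \<mu>)"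
proof -
  have "(LINT \<omega>|P. exp (- \<mu> * real_version H t \<omega>)) =
    (LINT \<omega>|P. (if H t \<omega> = \<infinity> then 0 else exp (- \<mu> * enn2real (H t \<omega>))))"
  proof (rule integral_cong_AE)
    show "AE \<omega> in P. exp (- \<mu> * real_version H t \<omega>) = (if H t \<omega> = \<infinity> then 0 else exp (- \<mu> * enn2real (H t \<omega>)))"
      using subordinator_never_killed AE_space
    proof eventually_elim
      case (elim \<omega>)
      then have "H t \<omega> < \<infinity>" using subordinator_finite[OF _ _ assms(1)] by auto
      then show ?case using elim by (simp add: real_version_def)
    qed
  qed (use assms in auto)
  also have "\<dots> = exp (- t * bernstein a b \<nu> \<mu>)"
    using H assms unfolding bernstein_subordinator_def by blast
  finally show ?thesis .
qed

text \<open>The Markov clause separates only the last increment from the past, so the factorisation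
  is an induction on the number of increments, with \<tau> n as the present time. The
  \<open>max 0\<close> gives a probability law for negative u as well, because the time change asks
  for one at every u; durations that occur are nonnegative.\<close>

lemma real_version_increments:
  "has_increments P (real_version H) (\<lambda>u. distr P borel (real_version H (max 0 u)))"
  unfolding has_increments_def
proof (intro conjI allI impI)
  interpret prob_space P by (rule P)
  let ?h = "real_version H"
  show "?h t \<in> borel_measurable P" if "t \<ge> 0" for t using that by simp
  show "AE \<omega> in P. ?h 0 \<omega> = 0" using real_version_0 by (intro AE_I2)
  fix \<tau> :: "nat \<Rightarrow> real" and n and A :: "nat \<Rightarrow> real set"
  assume "0 \<le> \<tau> 0 \<and> (\<forall>i<n. \<tau> i \<le> \<tau> (Suc i)) \<and> (\<forall>i<n. A i \<in> sets borel)"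
  then have "prob {\<omega>\<in>space P. \<forall>i<n. ?h (\<tau> (Suc i)) \<omega> - ?h (\<tau> i) \<omega> \<in> A i} =
    (\<Prod>i<n. prob {\<omega>\<in>space P. ?h (\<tau> (Suc i) - \<tau> i) \<omega> \<in> A i})"
  proof (induction n)
    case 0 then show ?case by (simp add: prob_space)
  next
    case (Suc n)
    then have \<tau>: "0 \<le> \<tau> 0" "\<And>i. i < Suc n \<Longrightarrow> \<tau> i \<le> \<tau> (Suc i)" and A: "\<And>i. i < Suc n \<Longrightarrow> A i \<in> sets borel"
      by auto
    have nn: "0 \<le> \<tau> i" if "i \<le> Suc n" for i by (rule times_nonneg[of \<tau> "Suc n", OF \<tau> that])
    define s t where "s = \<tau> n" and "t = \<tau> (Suc n) - \<tau> n"
    have st: "s \<ge> 0" "t \<ge> 0" "s + t \<ge> 0" "s + t = \<tau> (Suc n)" using nn[of n] \<tau>(2)[of n] by (auto simp: s_def t_def)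
    have le_s: "\<tau> i \<le> s" if "i \<le> n" for i
      unfolding s_def by (rule mono_upto[of "Suc n"]) (use \<tau>(2) that in auto)
    let ?S = "\<Pi>\<^sub>M u\<in>{0..s}. (borel :: ennreal measure)"
    \<comment> \<open>The event about the first n increments, expressed for extended-real paths on
      {0..s} because this is the past that the Markov clause speaks of. On paths that are never
      killed it agrees with the event for the real version.\<close>
    define C where "C = {x\<in>space ?S. \<forall>i<n. enn2real (x (\<tau> (Suc i))) - enn2real (x (\<tau> i)) \<in> A i}"
    have C: "C \<in> sets ?S"
    proof -
      have "{x\<in>space ?S. \<forall>i\<in>{..<n}. enn2real (x (\<tau> (Suc i))) - enn2real (x (\<tau> i)) \<in> A i} \<in> sets ?S"
      proof (rule sets.sets_Collect_finite_All)
        fix i assume i: "i \<in> {..<n}"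
        have m: "(\<lambda>x. x (\<tau> j)) \<in> borel_measurable ?S" if "j \<le> n" for j
          using le_s[OF that] nn[of j] that by (intro measurable_component_singleton) auto
        have [measurable]: "A i \<in> sets borel" "(\<lambda>x. x (\<tau> i)) \<in> borel_measurable ?S" "(\<lambda>x. x (\<tau> (Suc i))) \<in> borel_measurable ?S"
          using A[of i] m i by auto
        show "{x\<in>space ?S. enn2real (x (\<tau> (Suc i))) - enn2real (x (\<tau> i)) \<in> A i} \<in> sets ?S" by measurable
      qed simp
      then show ?thesis by (simp only: Ball_def lessThan_iff C_def)
    qed
    define B where "B = {y :: ennreal. enn2real y \<in> A n}"
    have B [measurable]: "B \<in> sets borel"
    proof -
      have [measurable]: "A n \<in> sets borel" using A by simp
      have "{y \<in> space borel. enn2real y \<in> A n} \<in> sets borel" by measurable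
      then show ?thesis by (simp add: B_def)
    qed
    have tr: "(\<lambda>\<omega>. \<lambda>u\<in>{0..s}. H u \<omega>) \<in> measurable P ?S" by (rule measurable_restrict) auto
    have in_C: "(\<lambda>u\<in>{0..s}. H u \<omega>) \<in> C \<longleftrightarrow> (\<forall>i<n. enn2real (H (\<tau> (Suc i)) \<omega>) - enn2real (H (\<tau> i) \<omega>) \<in> A i)"
      if "\<omega> \<in> space P" for \<omega>
    proof -
      have "\<tau> i \<in> {0..s}" if "i \<le> n" for i using nn[of i] le_s[of i] that by auto
      then show ?thesis using measurable_space[OF tr that] by (auto simp: C_def Suc_le_eq)
    qed
    have hm: "?h (\<tau> i) \<in> borel_measurable P" if "i \<le> Suc n" for i using nn[OF that] by simp
    have rect: "{\<omega>\<in>space P. \<forall>i<m. ?h (\<tau> (Suc i)) \<omega> - ?h (\<tau> i) \<omega> \<in> A i} \<in> events" if m: "m \<le> Suc n" for m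
    proof -
      have "{\<omega>\<in>space P. \<forall>i\<in>{..<m}. ?h (\<tau> (Suc i)) \<omega> - ?h (\<tau> i) \<omega> \<in> A i} \<in> events"
      proof (rule sets.sets_Collect_finite_All)
        fix i assume i: "i \<in> {..<m}"
        have [measurable]: "A i \<in> sets borel" "?h (\<tau> i) \<in> borel_measurable P" "?h (\<tau> (Suc i)) \<in> borel_measurable P"
          using A[of i] hm i m by auto
        show "{\<omega>\<in>space P. ?h (\<tau> (Suc i)) \<omega> - ?h (\<tau> i) \<omega> \<in> A i} \<in> events" by measurable
      qed simp
      then show ?thesis by (simp only: Ball_def lessThan_iff)
    qed
    have Cm: "{\<omega>\<in>space P. (\<lambda>u\<in>{0..s}. H u \<omega>) \<in> C} \<in> events"
      using measurable_sets[OF tr C] by (simp add: vimage_def Int_def conj_commute)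
    have [measurable]: "H s \<in> borel_measurable P" "H t \<in> borel_measurable P" "H (s + t) \<in> borel_measurable P" using st by auto
    have C'm: "{\<omega>\<in>space P. (\<lambda>u\<in>{0..s}. H u \<omega>) \<in> C \<and> H s \<omega> < \<infinity>} \<in> events"
      "{\<omega>\<in>space P. (\<lambda>u\<in>{0..s}. H u \<omega>) \<in> C \<and> H s \<omega> < \<infinity> \<and> H (s + t) \<omega> - H s \<omega> \<in> B} \<in> events"
      by (intro sets.sets_Collect_conj Cm; measurable)+
    have hH: "?h u \<omega> = enn2real (H u \<omega>)" if "\<forall>n. H (real n) \<omega> < \<infinity>" for u \<omega>
      using that by (simp add: real_version_def)
    have "prob {\<omega>\<in>space P. \<forall>i<Suc n. ?h (\<tau> (Suc i)) \<omega> - ?h (\<tau> i) \<omega> \<in> A i} =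
      prob {\<omega>\<in>space P. (\<lambda>u\<in>{0..s}. H u \<omega>) \<in> C \<and> H s \<omega> < \<infinity> \<and> H (s + t) \<omega> - H s \<omega> \<in> B}"
    proof (rule measure_eq_AE)
      show "AE \<omega> in P. \<omega> \<in> {\<omega>\<in>space P. \<forall>i<Suc n. ?h (\<tau> (Suc i)) \<omega> - ?h (\<tau> i) \<omega> \<in> A i} \<longleftrightarrow>
        \<omega> \<in> {\<omega>\<in>space P. (\<lambda>u\<in>{0..s}. H u \<omega>) \<in> C \<and> H s \<omega> < \<infinity> \<and> H (s + t) \<omega> - H s \<omega> \<in> B}"
        using subordinator_never_killed AE_space
      proof eventually_elim
        case (elim \<omega>)
        have fin: "H s \<omega> < \<infinity>" using subordinator_finite[OF elim(2,1)] st by auto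
        \<comment> \<open>Truncated subtraction in the extended nonnegative reals is true
          subtraction here: both values are finite on a path that is never killed, and the path is
          monotone.\<close>
        have "H (s + t) \<omega> - H s \<omega> = ennreal (?h (s + t) \<omega> - ?h s \<omega>)"
          using ennreal_real_version[OF elim(2,1), of s] ennreal_real_version[OF elim(2,1), of "s + t"] st
          by (simp add: ennreal_minus)
        moreover have "?h s \<omega> \<le> ?h (s + t) \<omega>" using real_version_mono[OF elim(2)] st by (auto simp: mono_on_def)
        ultimately have "H (s + t) \<omega> - H s \<omega> \<in> B \<longleftrightarrow> ?h (\<tau> (Suc n)) \<omega> - ?h (\<tau> n) \<omega> \<in> A n"
          by (simp add: B_def st(4)) (simp add: s_def)
        then show ?case using elim(2) fin in_C[OF elim(2)] by (auto simp: less_Suc_eq hH[OF elim(1)])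
      qed
    qed (rule rect[OF order_refl], rule C'm(2))
    also have "\<dots> = prob {\<omega>\<in>space P. (\<lambda>u\<in>{0..s}. H u \<omega>) \<in> C \<and> H s \<omega> < \<infinity>} * prob {\<omega>\<in>space P. H t \<omega> \<in> B}"
      by (rule subordinator_markov[OF st(1,2) C B])
    also have "prob {\<omega>\<in>space P. (\<lambda>u\<in>{0..s}. H u \<omega>) \<in> C \<and> H s \<omega> < \<infinity>} =
      prob {\<omega>\<in>space P. \<forall>i<n. ?h (\<tau> (Suc i)) \<omega> - ?h (\<tau> i) \<omega> \<in> A i}"
    proof (rule measure_eq_AE)
      show "AE \<omega> in P. \<omega> \<in> {\<omega>\<in>space P. (\<lambda>u\<in>{0..s}. H u \<omega>) \<in> C \<and> H s \<omega> < \<infinity>} \<longleftrightarrow>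
        \<omega> \<in> {\<omega>\<in>space P. \<forall>i<n. ?h (\<tau> (Suc i)) \<omega> - ?h (\<tau> i) \<omega> \<in> A i}"
        using subordinator_never_killed AE_space
      proof eventually_elim
        case (elim \<omega>)
        then show ?case using subordinator_finite[OF elim(2,1), of s] st in_C[OF elim(2)] by (auto simp: hH[OF elim(1)])
      qed
    qed (rule C'm(1), rule rect, simp)
    also have "\<dots> = (\<Prod>i<n. prob {\<omega>\<in>space P. ?h (\<tau> (Suc i) - \<tau> i) \<omega> \<in> A i})"
      by (rule Suc.IH) (use \<tau> A in auto)
    also have "prob {\<omega>\<in>space P. H t \<omega> \<in> B} = prob {\<omega>\<in>space P. ?h (\<tau> (Suc n) - \<tau> n) \<omega> \<in> A n}"
    proof (rule measure_eq_AE)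
      show "AE \<omega> in P. \<omega> \<in> {\<omega>\<in>space P. H t \<omega> \<in> B} \<longleftrightarrow> \<omega> \<in> {\<omega>\<in>space P. ?h (\<tau> (Suc n) - \<tau> n) \<omega> \<in> A n}"
        using subordinator_never_killed AE_space
        by eventually_elim (simp add: B_def hH t_def)
      have [measurable]: "?h (\<tau> (Suc n) - \<tau> n) \<in> borel_measurable P" "A n \<in> sets borel"
        using st A by (auto simp: t_def)
      show "{\<omega>\<in>space P. ?h (\<tau> (Suc n) - \<tau> n) \<omega> \<in> A n} \<in> events" by measurable
    qed measurable
    finally show ?case by simp
  qed
  moreover have "emeasure (distr P borel (?h (max 0 (\<tau> (Suc i) - \<tau> i)))) (A i) =
      ennreal (prob {\<omega>\<in>space P. ?h (\<tau> (Suc i) - \<tau> i) \<omega> \<in> A i})" if "i < n" for i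
    using that \<open>0 \<le> \<tau> 0 \<and> _\<close>
    by (subst emeasure_distr) (auto simp: emeasure_eq_measure max_def vimage_def Int_def conj_commute)
  ultimately show "emeasure P {\<omega>\<in>space P. \<forall>i<n. ?h (\<tau> (Suc i)) \<omega> - ?h (\<tau> i) \<omega> \<in> A i} =
    (\<Prod>i<n. emeasure (distr P borel (?h (max 0 (\<tau> (Suc i) - \<tau> i)))) (A i))"
    by (simp add: emeasure_eq_measure prod_ennreal)
qed

end

end

section \<open>The jump distribution\<close>

text \<open>The probability that a Poisson variable of mean lam * w equals k + 1. The shift omits
  the value 0, whose probability exp (- lam * w) is not \<nu>-integrable when \<nu> is infinite; the
  remaining probabilities add up to 1 - exp (- lam * w), which is.\<close>

definition poisson_term :: "real \<Rightarrow> nat \<Rightarrow> real \<Rightarrow> real" where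
  "poisson_term lam k w = exp (- lam * w) * (lam * w) ^ Suc k / fact (Suc k)"

lemma poisson_term_measurable [measurable]: "poisson_term lam k \<in> borel_measurable borel"
  unfolding poisson_term_def by measurable

context
  fixes a b :: real and \<nu> :: "real measure"
  assumes \<nu>: "bernstein_triplet a b \<nu>"
begin

lemma triplet_sets [measurable_cong]: "sets \<nu> = sets borel"
  using \<nu> by (simp add: bernstein_triplet_def)

lemma triplet_nonneg: "0 \<le> a" "0 \<le> b"
  using \<nu> by (auto simp: bernstein_triplet_def)

lemma triplet_AE_pos: "AE w in \<nu>. w > 0"
  using \<nu> by (intro AE_I[of _ _ "{..0}"]) (auto simp: bernstein_triplet_def)

lemma triplet_integrable_min: "integrable \<nu> (\<lambda>w. min w 1)"
proof (rule integrableI_nonneg)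
  show "AE w in \<nu>. 0 \<le> min w 1" using triplet_AE_pos by eventually_elim auto
  show "(\<integral>\<^sup>+w. ennreal (min w 1) \<partial>\<nu>) < \<infinity>" using \<nu> by (simp add: bernstein_triplet_def)
qed measurable

text \<open>The constant max 1 x serves both regimes: 1 - exp (- x * w) \<le> x * w controls small
  w, and the bound 1 controls large w.\<close>

lemma triplet_integrable:
  assumes "x \<ge> 0" shows "integrable \<nu> (\<lambda>w. 1 - exp (- x * w))"
proof (rule Bochner_Integration.integrable_bound[of _ "\<lambda>w. max 1 x * min w 1"])
  show "integrable \<nu> (\<lambda>w. max 1 x * min w 1)" using triplet_integrable_min by simp
  show "AE w in \<nu>. norm (1 - exp (- x * w)) \<le> norm (max 1 x * min w 1)"
    using triplet_AE_pos
  proof eventually_elim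
    case (elim w)
    have *: "0 \<le> 1 - exp (- x * w)" using assms elim by (simp add: mult_nonneg_nonneg)
    have "1 + (- x * w) \<le> exp (- x * w)" by (rule exp_ge_add_one_self)
    moreover have "x * w \<le> max 1 x * w" using elim by (intro mult_right_mono) auto
    ultimately have 1: "1 - exp (- x * w) \<le> max 1 x * w" by linarith
    have 2: "1 - exp (- x * w) \<le> max 1 x"
      using exp_ge_zero[of "- x * w"] max.cobounded1[of 1 x] by linarith
    have "1 - exp (- x * w) \<le> max 1 x * min w 1"
      using 1 2 by (cases "w \<le> 1") (simp_all add: min_def)
    then show ?case using * by simp
  qed
qed measurable

text \<open>If f(lam) = 0, its three nonnegative parts vanish. Since 1 - exp (- lam * w) > 0 for w >
  0, the vanishing integral forces \<nu> to be the null measure, and then f is identically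
  0.\<close>

lemma bernstein_pos:
  assumes lam: "lam > 0" and ne: "\<exists>x\<ge>0. bernstein a b \<nu> x \<noteq> 0"
  shows "bernstein a b \<nu> lam > 0"
proof -
  have ge: "AE w in \<nu>. 0 \<le> 1 - exp (- lam * w)"
    using triplet_AE_pos by eventually_elim (use lam in simp)
  have 1: "0 \<le> (LINT w|\<nu>. 1 - exp (- lam * w))" by (rule integral_nonneg_AE[OF ge])
  have 2: "0 \<le> b * lam" using triplet_nonneg lam by simp
  have "bernstein a b \<nu> lam \<noteq> 0"
  proof
    assume "bernstein a b \<nu> lam = 0"
    then have "a = 0" "b = 0" "(LINT w|\<nu>. 1 - exp (- lam * w)) = 0"
      using 1 2 triplet_nonneg lam unfolding bernstein_def by (auto simp: add_nonneg_eq_0_iff)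
    then have "AE w in \<nu>. 1 - exp (- lam * w) = 0"
      using integral_nonneg_eq_0_iff_AE[OF triplet_integrable[of lam] ge] lam by simp
    then have "AE w in \<nu>. False"
      using triplet_AE_pos by eventually_elim (use lam in simp)
    then have "AE w in \<nu>. 1 - exp (- x * w) = 0" for x
      by (rule eventually_mono) simp
    then have "(LINT w|\<nu>. 1 - exp (- x * w)) = 0" for x
      by (rule integral_eq_zero_AE)
    then show False using ne \<open>a = 0\<close> \<open>b = 0\<close> by (auto simp: bernstein_def)
  qed
  then show ?thesis using 1 2 triplet_nonneg unfolding bernstein_def by linarith
qed

context
  fixes lam :: real
  assumes lam: "lam > 0" and pos: "bernstein a b \<nu> lam > 0"
begin

lemma poisson_term_sums: "(\<lambda>k. poisson_term lam k w) sums (1 - exp (- lam * w))"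
proof -
  have "(\<lambda>k. (lam * w) ^ k /\<^sub>R fact k) sums exp (lam * w)" by (rule exp_converges)
  then have "(\<lambda>k. (lam * w) ^ Suc k /\<^sub>R fact (Suc k)) sums (exp (lam * w) - 1)"
    by (subst sums_Suc_iff) simp
  then have "(\<lambda>k. exp (- lam * w) * ((lam * w) ^ Suc k /\<^sub>R fact (Suc k))) sums (exp (- lam * w) * (exp (lam * w) - 1))"
    by (rule sums_mult)
  also have "exp (- lam * w) * (exp (lam * w) - 1) = 1 - exp (- lam * w)"
    by (simp add: algebra_simps exp_add[symmetric])
  finally show ?thesis by (simp add: poisson_term_def field_simps)
qed

lemma poisson_term_nonneg: "w > 0 \<Longrightarrow> 0 \<le> poisson_term lam k w"
  using lam by (simp add: poisson_term_def)

lemma sum_poisson_term_le: "w > 0 \<Longrightarrow> (\<Sum>k<n. poisson_term lam k w) \<le> 1 - exp (- lam * w)"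
  using sum_le_suminf[OF sums_summable[OF poisson_term_sums], of "{..<n}" w] poisson_term_nonneg[of w]
    sums_unique[OF poisson_term_sums[of w]] by simp

lemma poisson_term_le: "w > 0 \<Longrightarrow> poisson_term lam k w \<le> 1 - exp (- lam * w)"
  using sum_poisson_term_le[of w "Suc k"] sum_nonneg[of "{..<k}" "\<lambda>k. poisson_term lam k w"] poisson_term_nonneg[of w]
  by simp

lemma poisson_term_integrable: "integrable \<nu> (poisson_term lam k)"
proof (rule Bochner_Integration.integrable_bound[OF triplet_integrable[of lam]])
  show "AE w in \<nu>. norm (poisson_term lam k w) \<le> norm (1 - exp (- lam * w))"
    using triplet_AE_pos
  proof eventually_elim
    case (elim w)
    show ?case using poisson_term_nonneg[OF elim, of k] poisson_term_le[OF elim, of k] by simp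
  qed
qed (use lam in auto)

lemma summable_poisson_term_integral: "summable (\<lambda>k. LINT w|\<nu>. poisson_term lam k w)"
proof (rule summableI_nonneg_bounded)
  show "0 \<le> (LINT w|\<nu>. poisson_term lam k w)" for k
    by (rule integral_nonneg_AE) (use triplet_AE_pos in eventually_elim, rule poisson_term_nonneg)
  show "(\<Sum>k<n. LINT w|\<nu>. poisson_term lam k w) \<le> (LINT w|\<nu>. 1 - exp (- lam * w))" for n
  proof -
    have "(\<Sum>k<n. LINT w|\<nu>. poisson_term lam k w) = (LINT w|\<nu>. (\<Sum>k<n. poisson_term lam k w))"
      by (rule Bochner_Integration.integral_sum[symmetric]) (rule poisson_term_integrable)
    also have "\<dots> \<le> (LINT w|\<nu>. 1 - exp (- lam * w))"
    proof (rule integral_mono_AE)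
      show "AE w in \<nu>. (\<Sum>k<n. poisson_term lam k w) \<le> 1 - exp (- lam * w)"
        using triplet_AE_pos by eventually_elim (rule sum_poisson_term_le)
    qed (use lam triplet_integrable[of lam] in \<open>auto intro!: poisson_term_integrable\<close>)
    finally show ?thesis .
  qed
qed

text \<open>The exchange of series and Levy integral is dominated by the case q = 1, whose partial
  sums stay below the integrable function 1 - exp (- lam * w). Absolute values are needed because
  powers of a negative s will occur as weights.\<close>

lemma poisson_term_series:
  fixes q :: "nat \<Rightarrow> real"
  assumes q: "\<And>k. \<bar>q k\<bar> \<le> 1"
  shows "integrable \<nu> (\<lambda>w. \<Sum>k. q k * poisson_term lam k w)"
    and "(\<lambda>k. q k * (LINT w|\<nu>. poisson_term lam k w)) sums (LINT w|\<nu>. (\<Sum>k. q k * poisson_term lam k w))"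
proof -
  have int: "integrable \<nu> (\<lambda>w. q k * poisson_term lam k w)" for k
    using poisson_term_integrable by simp
  have le: "\<bar>q k * poisson_term lam k w\<bar> \<le> poisson_term lam k w" if "w > 0" for k w
    using mult_right_mono[OF q poisson_term_nonneg[OF that]] poisson_term_nonneg[OF that, of k] by (simp add: abs_mult)
  have ae: "AE w in \<nu>. summable (\<lambda>k. norm (q k * poisson_term lam k w))"
    using triplet_AE_pos
  proof eventually_elim
    case (elim w)
    show ?case
      by (rule summable_comparison_test'[OF sums_summable[OF poisson_term_sums[of w]], of 0])
         (use le[OF elim] in simp)
  qed
  have sm: "summable (\<lambda>k. LINT w|\<nu>. norm (q k * poisson_term lam k w))"
  proof (rule summable_comparison_test'[OF summable_poisson_term_integral, of 0])
    fix k
    have "(LINT w|\<nu>. norm (q k * poisson_term lam k w)) \<le> (LINT w|\<nu>. poisson_term lam k w)"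
    proof (rule integral_mono_AE)
      show "AE w in \<nu>. norm (q k * poisson_term lam k w) \<le> poisson_term lam k w"
        using triplet_AE_pos by eventually_elim (use le in simp)
    qed (use int[of k] poisson_term_integrable[of k] in auto)
    then show "norm (LINT w|\<nu>. norm (q k * poisson_term lam k w)) \<le> (LINT w|\<nu>. poisson_term lam k w)" by simp
  qed
  show "integrable \<nu> (\<lambda>w. \<Sum>k. q k * poisson_term lam k w)"
    by (rule integrable_suminf[OF int ae sm])
  show "(\<lambda>k. q k * (LINT w|\<nu>. poisson_term lam k w)) sums (LINT w|\<nu>. (\<Sum>k. q k * poisson_term lam k w))"
    using sums_integral[OF int ae sm] by simp
qed

lemma jump_coeff_eq:
  "bernstein a b \<nu> lam * jump_coeff a b \<nu> lam (Suc k) = (LINT w|\<nu>. poisson_term lam k w)"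
proof -
  have "(LINT w|\<nu>. poisson_term lam k w) = (LINT w|\<nu>. lam ^ Suc k / fact (Suc k) * (exp (- lam * w) * w ^ Suc k))"
    by (simp add: poisson_term_def power_mult_distrib field_simps)
  also have "\<dots> = lam ^ Suc k / fact (Suc k) * (LINT w|\<nu>. exp (- lam * w) * w ^ Suc k)"
    by (rule integral_mult_right_zero)
  finally show ?thesis using pos by (simp add: jump_coeff_def)
qed

lemma jump_coeff'_nonneg: "0 \<le> jump_coeff' a b \<nu> lam (Suc k)"
proof -
  have "0 \<le> (LINT w|\<nu>. poisson_term lam k w)"
    by (rule integral_nonneg_AE) (use triplet_AE_pos in eventually_elim, rule poisson_term_nonneg)
  then have "0 \<le> jump_coeff a b \<nu> lam (Suc k)"
    using jump_coeff_eq[of k] pos by (metis zero_le_mult_iff not_less)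
  then show ?thesis using pos lam triplet_nonneg by (auto simp: jump_coeff'_def)
qed

text \<open>Three choices of the weights are needed: q = 1 gives the total mass of the jump law, q k
  = s^(k+1) its generating function, and probabilities of convolutions as q k turn the Levy integral
  of the generator into a convolution with F_f. The drift meets only q 0, since b enters only
  a'_1.\<close>

lemma jump_coeff'_sums:
  fixes q :: "nat \<Rightarrow> real"
  assumes q: "\<And>k. \<bar>q k\<bar> \<le> 1"
  shows "(\<lambda>k. q k * jump_coeff' a b \<nu> lam (Suc k)) sums
    ((b * lam * q 0 + (LINT w|\<nu>. (\<Sum>k. q k * poisson_term lam k w))) / bernstein a b \<nu> lam)"
proof -
  let ?c = "bernstein a b \<nu> lam"
  have "(\<lambda>k. (if k = 0 then b * lam * q 0 else 0) + q k * (LINT w|\<nu>. poisson_term lam k w)) sums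
     (b * lam * q 0 + (LINT w|\<nu>. (\<Sum>k. q k * poisson_term lam k w)))"
    by (intro sums_add poisson_term_series q) (rule sums_If_finite_set[of "{0}", simplified])
  then have "(\<lambda>k. ((if k = 0 then b * lam * q 0 else 0) + q k * (LINT w|\<nu>. poisson_term lam k w)) / ?c) sums
     ((b * lam * q 0 + (LINT w|\<nu>. (\<Sum>k. q k * poisson_term lam k w))) / ?c)"
    by (rule sums_divide)
  moreover have "((if k = 0 then b * lam * q 0 else 0) + q k * (LINT w|\<nu>. poisson_term lam k w)) / ?c =
    q k * jump_coeff' a b \<nu> lam (Suc k)" for k
    unfolding jump_coeff_eq[symmetric]
    using pos by (cases "k = 0") (auto simp: jump_coeff'_def field_simps)
  ultimately show ?thesis by simp
qed

text \<open>The weights a'_k add up to (f(lam) - a) / f(lam), which is 1 because a = 0.\<close>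

lemma jump_pmf_exists:
  assumes a: "a = 0"
  shows "\<exists>p. pmf p 0 = 0 \<and> (\<forall>k. pmf p (Suc k) = jump_coeff' a b \<nu> lam (Suc k))"
proof -
  \<comment> \<open>The value at 0 is set by hand: the weights start at k = 1, and the formula for
    a'_k evaluated at k = 0 is not one of them.\<close>
  define f where "f k = (if k = 0 then 0 else jump_coeff' a b \<nu> lam k)" for k
  have nn: "0 \<le> f k" for k by (cases k) (auto simp: f_def jump_coeff'_nonneg)
  have "(\<lambda>k. 1 * jump_coeff' a b \<nu> lam (Suc k)) sums
    ((b * lam * 1 + (LINT w|\<nu>. (\<Sum>k. 1 * poisson_term lam k w))) / bernstein a b \<nu> lam)"
    by (rule jump_coeff'_sums) simp
  also have "(LINT w|\<nu>. (\<Sum>k. 1 * poisson_term lam k w)) = (LINT w|\<nu>. 1 - exp (- lam * w))"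
    by (intro Bochner_Integration.integral_cong refl, subst sums_unique[OF poisson_term_sums]) simp
  also have "(b * lam * 1 + (LINT w|\<nu>. 1 - exp (- lam * w))) / bernstein a b \<nu> lam = 1"
    using a pos by (simp add: bernstein_def)
  finally have "(\<lambda>k. f (Suc k)) sums 1" by (simp add: f_def)
  then have "f sums 1" by (subst (asm) sums_Suc_iff) (simp add: f_def)
  then have "(\<integral>\<^sup>+k. ennreal (f k) \<partial>count_space UNIV) = 1"
    using nn by (simp add: nn_integral_count_space_nat suminf_ennreal2 sums_iff)
  then have "pmf (embed_pmf f) k = f k" for k by (intro pmf_embed_pmf nn)
  then show ?thesis by (intro exI[of _ "embed_pmf f"]) (simp add: f_def)
qed

lemma pgf_jump_pmf:
  assumes p: "pmf p 0 = 0" "\<And>k. pmf p (Suc k) = jump_coeff' a b \<nu> lam (Suc k)" and s: "\<bar>s\<bar> \<le> 1"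
  shows "of_real (bernstein a b \<nu> lam) * (1 - pgf p (of_real s)) = of_real (bernstein a b \<nu> (lam * (1 - s)))"
proof -
  let ?c = "bernstein a b \<nu> lam"
  have "(\<lambda>k. s ^ Suc k * jump_coeff' a b \<nu> lam (Suc k)) sums
    ((b * lam * s ^ Suc 0 + (LINT w|\<nu>. (\<Sum>k. s ^ Suc k * poisson_term lam k w))) / ?c)" (is "_ sums ?S")
    by (rule jump_coeff'_sums) (simp add: power_abs power_le_one s del: power_Suc)
  then have "(\<lambda>k. pmf p (Suc k) * s ^ Suc k) sums ?S" by (simp add: p mult.commute)
  then have "(\<lambda>k. pmf p k * s ^ k) sums ?S" by (subst (asm) sums_Suc_iff) (simp add: p)
  then have "(\<lambda>k. of_real (pmf p k * s ^ k) :: complex) sums of_real ?S" by (rule sums_of_real)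
  then have pgf: "pgf p (of_real s) = of_real ?S"
    using pgf_sums[of "of_real s" p] s by (simp add: sums_unique2)
  have 1: "(\<Sum>k. s ^ Suc k * poisson_term lam k w) = exp (- (lam * (1 - s)) * w) - exp (- lam * w)" for w
  proof -
    have "(\<lambda>k. (lam * w * s) ^ k /\<^sub>R fact k) sums exp (lam * w * s)" by (rule exp_converges)
    then have "(\<lambda>k. (lam * w * s) ^ Suc k /\<^sub>R fact (Suc k)) sums (exp (lam * w * s) - 1)"
      by (subst sums_Suc_iff) simp
    then have "(\<lambda>k. exp (- lam * w) * ((lam * w * s) ^ Suc k /\<^sub>R fact (Suc k))) sums (exp (- lam * w) * (exp (lam * w * s) - 1))"
      by (rule sums_mult)
    also have "exp (- lam * w) * (exp (lam * w * s) - 1) = exp (- (lam * (1 - s)) * w) - exp (- lam * w)"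
      by (simp add: algebra_simps exp_add[symmetric])
    finally show ?thesis
      by (intro sums_unique[symmetric]) (simp add: poisson_term_def power_mult_distrib field_simps)
  qed
  have "lam * (1 - s) \<ge> 0" using lam s by simp
  note int = triplet_integrable[OF this] triplet_integrable[OF less_imp_le[OF lam]]
  \<comment> \<open>The two exponentials need not be integrable one by one, so their difference is
    written with the functions 1 - exp, each integrable because its rate is nonnegative. The
    constant a then cancels between the two values of f.\<close>
  have "(LINT w|\<nu>. (\<Sum>k. s ^ Suc k * poisson_term lam k w)) =
    (LINT w|\<nu>. (1 - exp (- lam * w)) - (1 - exp (- (lam * (1 - s)) * w)))"
    by (intro Bochner_Integration.integral_cong refl, subst 1) simp
  also have "\<dots> = (LINT w|\<nu>. 1 - exp (- lam * w)) - (LINT w|\<nu>. 1 - exp (- (lam * (1 - s)) * w))"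
    by (rule Bochner_Integration.integral_diff[OF int(2,1)])
  finally have "?c * (1 - ?S) = bernstein a b \<nu> (lam * (1 - s))"
    using pos by (simp add: right_diff_distrib) (simp add: bernstein_def algebra_simps)
  then have "of_real (?c * (1 - ?S)) = (of_real (bernstein a b \<nu> (lam * (1 - s))) :: complex)" by (rule arg_cong)
  then show ?thesis unfolding pgf by simp
qed

end

end

section \<open>Poisson laws with a random parameter, and the jump measure\<close>

lemma pmf_poisson0_measurable [measurable]:
  "(\<lambda>u. pmf (poisson0 u) n) \<in> borel_measurable borel"
proof -
  have "(\<lambda>u. if u \<ge> 0 then u ^ n / fact n * exp (- u) else if n = 0 then 1 else 0 :: real) \<in> borel_measurable borel"
    by measurable
  also have "(\<lambda>u. if u \<ge> 0 then u ^ n / fact n * exp (- u) else if n = 0 then 1 else 0) = (\<lambda>u. pmf (poisson0 u) n)"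
    by (auto simp: fun_eq_iff pmf_poisson0) (auto simp: poisson0_def)
  finally show ?thesis .
qed

lemma emeasure_mixture_poisson0_measurable:
  assumes F: "real_distribution F" and B: "B \<in> sets borel"
  shows "(\<lambda>u. emeasure (mixture (poisson0 (lam * u)) F) B) \<in> borel_measurable borel"
  unfolding emeasure_mixture_suminf[OF F B] by measurable

text \<open>K is the law of a Poisson variable whose parameter is the random variable h. By Tonelli
  its weights add up to 1, and averaging the Poisson generating function exp (- (1 - s) * x) over x
  = h gives the Laplace transform of h at 1 - s.\<close>

lemma mixed_poisson:
  assumes P: "prob_space P" and h [measurable]: "h \<in> borel_measurable P" and h0: "\<And>\<omega>. h \<omega> \<ge> 0"
  shows "\<exists>K. (\<forall>n. (\<integral>\<^sup>+\<omega>. ennreal (pmf (poisson0 (h \<omega>)) n) \<partial>P) = ennreal (pmf K n)) \<and>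
    (\<forall>s. \<bar>s\<bar> \<le> 1 \<longrightarrow> pgf K (of_real s) = of_real (LINT \<omega>|P. exp (- (1 - s) * h \<omega>)))"
proof -
  interpret prob_space P by fact
  define f where "f n = (LINT \<omega>|P. pmf (poisson0 (h \<omega>)) n)" for n
  have int: "integrable P (\<lambda>\<omega>. pmf (poisson0 (h \<omega>)) n)" for n
    by (rule integrable_const_bound[of _ 1]) (auto simp: pmf_le_1 abs_le_iff intro: order_trans[OF _ pmf_nonneg])
  have nn: "(\<integral>\<^sup>+\<omega>. ennreal (pmf (poisson0 (h \<omega>)) n) \<partial>P) = ennreal (f n)" for n
    unfolding f_def by (rule nn_integral_eq_integral[OF int]) simp
  have f0: "0 \<le> f n" for n unfolding f_def by simp
  have "(\<Sum>n. ennreal (f n)) = (\<integral>\<^sup>+\<omega>. (\<Sum>n. ennreal (pmf (poisson0 (h \<omega>)) n)) \<partial>P)"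
    by (subst nn_integral_suminf) (auto simp: nn)
  also have "\<dots> = (\<integral>\<^sup>+\<omega>. 1 \<partial>P)"
    by (intro nn_integral_cong, subst nn_integral_count_space_nat[symmetric]) (rule nn_integral_pmf_eq_1)
  finally have f1: "(\<Sum>n. ennreal (f n)) = 1" by (simp add: emeasure_space_1)
  then have pmf: "pmf (embed_pmf f) n = f n" for n
    by (intro pmf_embed_pmf f0) (simp add: nn_integral_count_space_nat)
  have fs: "summable f" using f1 f0 by (intro summable_suminf_not_top) auto
  have "pgf (embed_pmf f) (of_real s) = of_real (LINT \<omega>|P. exp (- (1 - s) * h \<omega>))" if s: "\<bar>s\<bar> \<le> 1" for s
  proof -
    have *: "(\<lambda>n. pmf (poisson0 x) n * s ^ n) sums exp (- (1 - s) * x)" if "x \<ge> 0" for x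
    proof -
      have "(\<lambda>n. of_real (pmf (poisson0 x) n * s ^ n) :: complex) sums of_real (exp (- (1 - s) * x))"
        using pgf_sums[of "of_real s" "poisson0 x"] pgf_poisson0[OF that, of "of_real s"] s
        by (simp add: exp_of_real[symmetric] algebra_simps)
      then show ?thesis by (simp only: sums_of_real_iff)
    qed
    have le: "\<bar>pmf (poisson0 x) n * s ^ n\<bar> \<le> pmf (poisson0 x) n" for x n
      using s by (simp add: abs_mult power_abs mult_left_le power_le_one)
    have "(\<lambda>n. LINT \<omega>|P. pmf (poisson0 (h \<omega>)) n * s ^ n) sums (LINT \<omega>|P. (\<Sum>n. pmf (poisson0 (h \<omega>)) n * s ^ n))"
    proof (rule sums_integral)
      show "integrable P (\<lambda>\<omega>. pmf (poisson0 (h \<omega>)) n * s ^ n)" for n using int by simp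
      have "summable (\<lambda>n. norm (pmf (poisson0 x) n * s ^ n))" if "x \<ge> 0" for x
      proof (rule summable_comparison_test')
        show "summable (pmf (poisson0 x))"
          using sums_summable[OF integral_pmf_nat_sums[of "\<lambda>_. 1 :: real" 1 "poisson0 x"]] by simp
        show "norm (norm (pmf (poisson0 x) n * s ^ n)) \<le> pmf (poisson0 x) n" for n
          using le[of x n] by simp
      qed
      then show "AE \<omega> in P. summable (\<lambda>n. norm (pmf (poisson0 (h \<omega>)) n * s ^ n))" using h0 by simp
      show "summable (\<lambda>n. LINT \<omega>|P. norm (pmf (poisson0 (h \<omega>)) n * s ^ n))"
      proof (rule summable_comparison_test'[OF fs, of 0])
        fix n
        have "(LINT \<omega>|P. norm (pmf (poisson0 (h \<omega>)) n * s ^ n)) \<le> f n"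
          unfolding f_def
        proof (rule integral_mono)
          show "norm (pmf (poisson0 (h \<omega>)) n * s ^ n) \<le> pmf (poisson0 (h \<omega>)) n" for \<omega>
            using le[of "h \<omega>" n] by simp
        qed (intro integrable_norm integrable_mult_left int, rule int)
        then show "norm (LINT \<omega>|P. norm (pmf (poisson0 (h \<omega>)) n * s ^ n)) \<le> f n" by simp
      qed
    qed
    then have "(\<lambda>n. pmf (embed_pmf f) n * s ^ n) sums (LINT \<omega>|P. exp (- (1 - s) * h \<omega>))"
      using sums_unique[OF *[OF h0]] by (simp add: pmf f_def)
    then have "(\<lambda>n. of_real (pmf (embed_pmf f) n * s ^ n) :: complex) sums of_real (LINT \<omega>|P. exp (- (1 - s) * h \<omega>))"
      by (rule sums_of_real)
    then show ?thesis using pgf_sums[of "of_real s" "embed_pmf f"] s by (simp add: sums_unique2)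
  qed
  then show ?thesis using nn pmf by (intro exI[of _ "embed_pmf f"]) simp
qed

text \<open>\<open>measure_of\<close> returns the given set function only if that is countably
  additive. Here it agrees on Borel sets with a genuine measure, the mixture, whose additional term
  k = 0 has weight 0.\<close>

lemma jump_measure_eq_mixture:
  assumes F: "real_distribution F"
    and p: "pmf p 0 = 0" "\<And>k. pmf p (Suc k) = jump_coeff' a b \<nu> lam (Suc k)"
  shows "jump_measure a b \<nu> lam F = mixture p F"
proof -
  interpret real_distribution "mixture p F" by (rule real_distribution_mixture[OF F])
  have eq: "(\<Sum>k. ennreal (jump_coeff' a b \<nu> lam (Suc k)) * emeasure (convolution_power F (Suc k)) B) = emeasure (mixture p F) B"
    if "B \<in> sets borel" for B
  proof -
    have "(\<Sum>k. ennreal (pmf p (Suc k)) * emeasure (convolution_power F (Suc k)) B) =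
      (\<Sum>k. ennreal (pmf p k) * emeasure (convolution_power F k) B)"
      using suminf_offset[of "\<lambda>k. ennreal (pmf p k) * emeasure (convolution_power F k) B" 1] p(1) by simp
    then show ?thesis by (simp only: emeasure_mixture_suminf[OF F that] p)
  qed
  have "jump_measure a b \<nu> lam F = measure_of UNIV (sets borel) (emeasure (mixture p F))"
    unfolding jump_measure_def
  proof (rule measure_of_eq)
    fix B :: "real set" assume "B \<in> sigma_sets UNIV (sets borel)"
    then have "B \<in> sets borel" using sets.sigma_sets_eq[of "borel :: real measure"] by simp
    then show "(\<Sum>k. ennreal (jump_coeff' a b \<nu> lam (Suc k)) * emeasure (convolution_power F (Suc k)) B) =
        emeasure (mixture p F) B"
      by (rule eq)
  qed simp
  also have "\<dots> = mixture p F"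
    using measure_of_of_measure[of "mixture p F"] by simp
  finally show ?thesis .
qed

section \<open>Transport along measure-preserving maps, and witnesses on product spaces\<close>

lemma indep_vars_transfer:
  assumes Q: "prob_space Q" and R: "prob_space R" and d: "d \<in> measurable Q R" "distr Q R d = R"
    and ind: "prob_space.indep_vars R M' X I"
  shows "prob_space.indep_vars Q M' (\<lambda>i \<omega>. X i (d \<omega>)) I"
proof (cases "I = {}")
  case True
  interpret prob_space Q by fact
  show ?thesis by (simp add: indep_vars_def indep_sets_def True)
next
  case False
  interpret Q: prob_space Q by fact
  interpret R: prob_space R by fact
  have X: "X i \<in> measurable R (M' i)" if "i \<in> I" for i
    using ind that by (auto simp: R.indep_vars_def)
  \<comment> \<open>Independence means that the joint law is the product of the marginals; a
    measure-preserving d changes neither side.\<close>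
  have "distr Q (\<Pi>\<^sub>M i\<in>I. M' i) (\<lambda>\<omega>. \<lambda>i\<in>I. X i (d \<omega>)) = distr (distr Q R d) (\<Pi>\<^sub>M i\<in>I. M' i) (\<lambda>\<omega>. \<lambda>i\<in>I. X i \<omega>)"
    by (subst distr_distr) (use d X in \<open>auto intro!: measurable_restrict simp: comp_def\<close>)
  also have "\<dots> = (\<Pi>\<^sub>M i\<in>I. distr R (M' i) (X i))"
    unfolding d(2) by (rule R.indep_vars_iff_distr_eq_PiM'[OF False X, THEN iffD1, OF _ ind])
  also have "\<dots> = (\<Pi>\<^sub>M i\<in>I. distr Q (M' i) (\<lambda>\<omega>. X i (d \<omega>)))"
  proof (rule PiM_cong[OF refl])
    fix i assume "i \<in> I"
    then have "distr (distr Q R d) (M' i) (X i) = distr Q (M' i) (\<lambda>\<omega>. X i (d \<omega>))"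
      by (subst distr_distr) (use d X in \<open>auto simp: comp_def\<close>)
    then show "distr R (M' i) (X i) = distr Q (M' i) (\<lambda>\<omega>. X i (d \<omega>))" unfolding d(2) .
  qed
  finally show ?thesis
    by (subst Q.indep_vars_iff_distr_eq_PiM'[OF False]) (auto intro: measurable_compose[OF d(1)] X)
qed

lemma distr_transfer:
  assumes "d \<in> measurable Q R" "distr Q R d = R" "f \<in> measurable R N"
  shows "distr Q N (\<lambda>\<omega>. f (d \<omega>)) = distr R N f"
  using distr_distr[OF assms(3,1)] assms(2) by (simp add: comp_def)

lemma iid_transfer:
  assumes Q: "prob_space Q" and R: "prob_space R" and d: "d \<in> measurable Q R" "distr Q R d = R"
    and X: "iid R F X"
  shows "iid Q F (\<lambda>k \<omega>. X k (d \<omega>))"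
  using indep_vars_transfer[OF Q R d, of "\<lambda>_. borel" X "{1..}"] X distr_transfer[OF d iid_measurable[OF R X]]
  by (simp add: iid_def)

lemma indep_rv_transfer:
  assumes Q: "prob_space Q" and R: "prob_space R" and d: "d \<in> measurable Q R" "distr Q R d = R"
    and ind: "indep_rv R S X T Y"
  shows "indep_rv Q S (\<lambda>\<omega>. X (d \<omega>)) T (\<lambda>\<omega>. Y (d \<omega>))"
proof -
  interpret Q: prob_space Q by fact
  interpret R: prob_space R by fact
  have X: "X \<in> measurable R S" and Y: "Y \<in> measurable R T"
    and iset: "R.indep_set {X -` B \<inter> space R |B. B \<in> sets S} {Y -` B \<inter> space R |B. B \<in> sets T}"
    using ind by (auto simp: indep_rv_def)
  have m: "measure Q {\<omega>\<in>space Q. d \<omega> \<in> E} = measure R E" if "E \<in> sets R" for E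
  proof -
    have "measure R E = measure (distr Q R d) E" by (simp add: d(2))
    also have "\<dots> = measure Q (d -` E \<inter> space Q)" by (rule measure_distr[OF d(1) that])
    also have "d -` E \<inter> space Q = {\<omega>\<in>space Q. d \<omega> \<in> E}" by auto
    finally show ?thesis by simp
  qed
  show ?thesis
  proof (rule indep_rvI[OF Q measurable_compose[OF d(1) X] measurable_compose[OF d(1) Y]])
    fix A B assume AB: "A \<in> sets S" "B \<in> sets T"
    have sp: "d \<omega> \<in> space R" if "\<omega> \<in> space Q" for \<omega> using measurable_space[OF d(1) that] .
    have "R.prob ((X -` A \<inter> space R) \<inter> (Y -` B \<inter> space R)) = R.prob (X -` A \<inter> space R) * R.prob (Y -` B \<inter> space R)"
      by (rule R.indep_setD[OF iset]) (use AB in blast)+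
    moreover have "{\<omega>\<in>space Q. d \<omega> \<in> (X -` A \<inter> space R) \<inter> (Y -` B \<inter> space R)} = {\<omega>\<in>space Q. X (d \<omega>) \<in> A \<and> Y (d \<omega>) \<in> B}"
      "{\<omega>\<in>space Q. d \<omega> \<in> X -` A \<inter> space R} = {\<omega>\<in>space Q. X (d \<omega>) \<in> A}"
      "{\<omega>\<in>space Q. d \<omega> \<in> Y -` B \<inter> space R} = {\<omega>\<in>space Q. Y (d \<omega>) \<in> B}"
      using sp by auto
    moreover have "X -` A \<inter> space R \<in> sets R" "Y -` B \<inter> space R \<in> sets R"
      using AB measurable_sets[OF X] measurable_sets[OF Y] by auto
    ultimately show "measure Q {\<omega>\<in>space Q. X (d \<omega>) \<in> A \<and> Y (d \<omega>) \<in> B} =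
      measure Q {\<omega>\<in>space Q. X (d \<omega>) \<in> A} * measure Q {\<omega>\<in>space Q. Y (d \<omega>) \<in> B}"
      using m[of "(X -` A \<inter> space R) \<inter> (Y -` B \<inter> space R)"] m[of "X -` A \<inter> space R"] m[of "Y -` B \<inter> space R"]
      by auto
  qed
qed

lemma poisson_process_transfer:
  assumes Q: "prob_space Q" and R: "prob_space R" and d: "d \<in> measurable Q R" "distr Q R d = R"
    and N: "poisson_process R lam N"
  shows "poisson_process Q lam (\<lambda>t \<omega>. N t (d \<omega>))"
proof -
  have sp: "d \<omega> \<in> space R" if "\<omega> \<in> space Q" for \<omega> using measurable_space[OF d(1) that] .
  have m: "N t \<in> measurable R (count_space UNIV)" if "t \<ge> 0" for t
    using N that by (simp add: poisson_process_def)
  show ?thesis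
    unfolding poisson_process_def
  proof (intro conjI allI impI ballI)
    fix \<tau> :: "nat \<Rightarrow> real" and n assume "0 \<le> \<tau> 0 \<and> (\<forall>i<n. \<tau> i \<le> \<tau> (Suc i))"
    then show "prob_space.indep_vars Q (\<lambda>_. count_space UNIV)
        (\<lambda>i \<omega>. N (\<tau> (Suc i)) (d \<omega>) - N (\<tau> i) (d \<omega>)) {..<n}"
      using N by (intro indep_vars_transfer[OF Q R d, where X="\<lambda>i \<omega>. N (\<tau> (Suc i)) \<omega> - N (\<tau> i) \<omega>"])
        (simp add: poisson_process_def)
  next
    fix s t :: real assume st: "s \<ge> 0" "t > s"
    have "(\<lambda>\<omega>. N t \<omega> - N s \<omega>) \<in> measurable R (count_space UNIV)"
    proof -
      have [measurable]: "N s \<in> measurable R (count_space UNIV)" "N t \<in> measurable R (count_space UNIV)"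
        using m st by auto
      show ?thesis by measurable
    qed
    then have "distr Q (count_space UNIV) (\<lambda>\<omega>. N t (d \<omega>) - N s (d \<omega>)) = distr R (count_space UNIV) (\<lambda>\<omega>. N t \<omega> - N s \<omega>)"
      by (rule distr_transfer[OF d])
    then show "distr Q (count_space UNIV) (\<lambda>\<omega>. N t (d \<omega>) - N s (d \<omega>)) = measure_pmf (poisson_pmf (lam * (t - s)))"
      using N st by (simp add: poisson_process_def)
  next
    show "(\<lambda>\<omega>. N t (d \<omega>)) \<in> measurable Q (count_space UNIV)" if "t \<ge> 0" for t
      by (rule measurable_compose[OF d(1) m[OF that]])
  qed (use N sp in \<open>simp_all add: poisson_process_def\<close>)
qed

lemma poisson_process_rescale:
  assumes N: "poisson_process Q lam N" and k: "k > 0"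
  shows "poisson_process Q (lam * k) (\<lambda>t \<omega>. N (k * t) \<omega>)"
  unfolding poisson_process_def
proof (intro conjI allI impI ballI)
  show "N (k * t) \<in> measurable Q (count_space UNIV)" if "t \<ge> 0" for t
    using N that k by (simp add: poisson_process_def)
  fix \<omega> assume \<omega>: "\<omega> \<in> space Q"
  show "N (k * 0) \<omega> = 0" using N \<omega> by (simp add: poisson_process_def)
  show "mono_on {0..} (\<lambda>t. N (k * t) \<omega>)"
    using N \<omega> k by (auto simp: poisson_process_def mono_on_def)
  fix t :: real assume t: "t \<ge> 0"
  have "((\<lambda>s. N s \<omega>) \<longlongrightarrow> N (k * t) \<omega>) (at_right (k * t))"
    using N \<omega> k t by (simp add: poisson_process_def continuous_within)
  moreover have "filterlim (\<lambda>s. k * s) (at_right (k * t)) (at_right t)"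
    unfolding filterlim_at
  proof (intro conjI)
    show "eventually (\<lambda>s. k * s \<in> {k * t<..} \<and> k * s \<noteq> k * t) (at_right t)"
      using eventually_at_right_less[of t] by eventually_elim (use k in auto)
    show "((\<lambda>s. k * s) \<longlongrightarrow> k * t) (at_right t)" by (intro tendsto_intros)
  qed
  ultimately have "((\<lambda>s. N (k * s) \<omega>) \<longlongrightarrow> N (k * t) \<omega>) (at_right t)" by (rule filterlim_compose)
  then show "continuous (at_right t) (\<lambda>s. N (k * s) \<omega>)" by (simp add: continuous_within)
next
  fix \<tau> :: "nat \<Rightarrow> real" and n assume "0 \<le> \<tau> 0 \<and> (\<forall>i<n. \<tau> i \<le> \<tau> (Suc i))"
  then show "prob_space.indep_vars Q (\<lambda>_. count_space UNIV) (\<lambda>i \<omega>. N (k * \<tau> (Suc i)) \<omega> - N (k * \<tau> i) \<omega>) {..<n}"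
    using N[unfolded poisson_process_def, THEN conjunct2, THEN conjunct2, THEN conjunct1, rule_format, of "\<lambda>i. k * \<tau> i" n] k
    by simp
next
  fix s t :: real assume st: "s \<ge> 0" "t > s"
  have "distr Q (count_space UNIV) (\<lambda>\<omega>. N (k * t) \<omega> - N (k * s) \<omega>) = measure_pmf (poisson_pmf (lam * (k * t - k * s)))"
    using N k st by (simp add: poisson_process_def)
  then show "distr Q (count_space UNIV) (\<lambda>\<omega>. N (k * t) \<omega> - N (k * s) \<omega>) = measure_pmf (poisson_pmf (lam * k * (t - s)))"
    by (simp add: algebra_simps)
qed

lemma iid_PiM:
  assumes G: "real_distribution G"
  shows "iid (\<Pi>\<^sub>M k\<in>{1::nat..}. G) G (\<lambda>k x. x k)" "prob_space (\<Pi>\<^sub>M k\<in>{1::nat..}. G)"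
proof -
  interpret G: real_distribution G by fact
  interpret product_prob_space "\<lambda>_. G" "{1::nat..}" ..
  show "prob_space (\<Pi>\<^sub>M k\<in>{1::nat..}. G)" by (rule prob_space_axioms)
  have s: "sets (\<Pi>\<^sub>M k\<in>{1::nat..}. G) = sets (\<Pi>\<^sub>M k\<in>{1::nat..}. borel)"
    by (intro sets_PiM_cong) auto
  have c: "distr (\<Pi>\<^sub>M k\<in>{1::nat..}. G) borel (\<lambda>x. x k) = G" if "k \<ge> 1" for k
  proof -
    have "distr (\<Pi>\<^sub>M k\<in>{1::nat..}. G) G (\<lambda>x. x k) = G" by (rule PiM_component) (use that in simp)
    moreover have "distr (\<Pi>\<^sub>M k\<in>{1::nat..}. G) G (\<lambda>x. x k) = distr (\<Pi>\<^sub>M k\<in>{1::nat..}. G) borel (\<lambda>x. x k)"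
      by (intro distr_cong) auto
    ultimately show ?thesis by simp
  qed
  have m: "(\<lambda>x. x k) \<in> borel_measurable (\<Pi>\<^sub>M k\<in>{1::nat..}. G)" if "k \<in> {1::nat..}" for k
    using measurable_component_singleton[OF that, of "\<lambda>_. G"] by (simp add: measurable_cong_sets[OF refl G.events_eq_borel])
  have "indep_vars (\<lambda>_. borel) (\<lambda>k x. x k) {1..}"
  proof (subst indep_vars_iff_distr_eq_PiM'[OF _ m])
    have "distr (\<Pi>\<^sub>M k\<in>{1::nat..}. G) (\<Pi>\<^sub>M k\<in>{1::nat..}. borel) (\<lambda>x. \<lambda>k\<in>{1::nat..}. x k) =
      distr (\<Pi>\<^sub>M k\<in>{1::nat..}. G) (\<Pi>\<^sub>M k\<in>{1::nat..}. borel) (\<lambda>x. x)"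
      by (rule distr_cong) (auto simp: space_PiM PiE_def extensional_restrict)
    also have "\<dots> = (\<Pi>\<^sub>M k\<in>{1::nat..}. G)" by (rule distr_id2) (rule s[symmetric])
    also have "\<dots> = (\<Pi>\<^sub>M k\<in>{1::nat..}. distr (\<Pi>\<^sub>M k\<in>{1::nat..}. G) borel (\<lambda>x. x k))"
      by (intro PiM_cong refl c[symmetric]) simp
    finally show "distr (\<Pi>\<^sub>M k\<in>{1::nat..}. G) (\<Pi>\<^sub>M k\<in>{1::nat..}. borel) (\<lambda>x. \<lambda>k\<in>{1::nat..}. x k) =
      (\<Pi>\<^sub>M k\<in>{1::nat..}. distr (\<Pi>\<^sub>M k\<in>{1::nat..}. G) borel (\<lambda>x. x k))" .
  qed auto
  then show "iid (\<Pi>\<^sub>M k\<in>{1::nat..}. G) G (\<lambda>k x. x k)" using c by (simp add: iid_def)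
qed

lemma pair_prob_space_projections:
  assumes A: "prob_space A" and B: "prob_space B"
  shows "prob_space (A \<Otimes>\<^sub>M B)" "distr (A \<Otimes>\<^sub>M B) A fst = A" "distr (A \<Otimes>\<^sub>M B) B snd = B"
    "indep_rv (A \<Otimes>\<^sub>M B) A fst B snd"
proof -
  interpret A: prob_space A by fact
  interpret B: prob_space B by fact
  interpret AB: pair_prob_space A B ..
  show "prob_space (A \<Otimes>\<^sub>M B)" by (rule AB.prob_space_axioms)
  show 1: "distr (A \<Otimes>\<^sub>M B) A fst = A" by (rule B.distr_pair_fst)
  show 2: "distr (A \<Otimes>\<^sub>M B) B snd = B"
  proof (rule measure_eqI)
    fix X assume "X \<in> sets (distr (A \<Otimes>\<^sub>M B) B snd)"
    then have X: "X \<in> sets B" by simp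
    have "snd -` X \<inter> space (A \<Otimes>\<^sub>M B) = space A \<times> X"
      using sets.sets_into_space[OF X] by (auto simp: space_pair_measure)
    then show "emeasure (distr (A \<Otimes>\<^sub>M B) B snd) X = emeasure B X"
      using X by (simp add: emeasure_distr B.emeasure_pair_measure_Times A.emeasure_space_1)
  qed simp
  show "indep_rv (A \<Otimes>\<^sub>M B) A fst B snd"
  proof (rule indep_rvI[OF AB.prob_space_axioms])
    fix X Y assume XY: "X \<in> sets A" "Y \<in> sets B"
    have "{\<omega>\<in>space (A \<Otimes>\<^sub>M B). fst \<omega> \<in> X \<and> snd \<omega> \<in> Y} = X \<times> Y"
      "{\<omega>\<in>space (A \<Otimes>\<^sub>M B). fst \<omega> \<in> X} = X \<times> space B" "{\<omega>\<in>space (A \<Otimes>\<^sub>M B). snd \<omega> \<in> Y} = space A \<times> Y"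
      using sets.sets_into_space[OF XY(1)] sets.sets_into_space[OF XY(2)] by (auto simp: space_pair_measure)
    then show "AB.prob {\<omega>\<in>space (A \<Otimes>\<^sub>M B). fst \<omega> \<in> X \<and> snd \<omega> \<in> Y} =
      AB.prob {\<omega>\<in>space (A \<Otimes>\<^sub>M B). fst \<omega> \<in> X} * AB.prob {\<omega>\<in>space (A \<Otimes>\<^sub>M B). snd \<omega> \<in> Y}"
      using XY
      by (simp add: measure_def B.emeasure_pair_measure_Times A.emeasure_space_1 B.emeasure_space_1 enn2real_mult)
  qed auto
qed

text \<open>A point of the product is stored in one sequence of pairs: the first component at the even
  places, the second one in the first coordinates at the odd places.\<close>

lemma prob_space_encode:
  fixes R :: "((nat \<Rightarrow> real \<times> real) \<times> (nat \<Rightarrow> real)) measure"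
  assumes R: "prob_space R" and ext: "\<And>z. z \<in> space R \<Longrightarrow> snd z \<in> extensional {1..}"
  shows "\<exists>(Q :: (nat \<Rightarrow> real \<times> real) measure) d. prob_space Q \<and> d \<in> measurable Q R \<and> distr Q R d = R"
proof -
  interpret prob_space R by fact
  define dec :: "(nat \<Rightarrow> real \<times> real) \<Rightarrow> (nat \<Rightarrow> real \<times> real) \<times> (nat \<Rightarrow> real)"
    where "dec \<omega> = (\<lambda>n. \<omega> (2 * n), \<lambda>n\<in>{1..}. fst (\<omega> (2 * n + 1)))" for \<omega>
  define enc :: "(nat \<Rightarrow> real \<times> real) \<times> (nat \<Rightarrow> real) \<Rightarrow> (nat \<Rightarrow> real \<times> real)"
    where "enc z n = (if even n then fst z (n div 2) else (snd z (n div 2), 0))" for z n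
  have de: "dec (enc z) = z" if "z \<in> space R" for z
    using ext[OF that] by (auto simp: dec_def enc_def prod_eq_iff fun_eq_iff extensional_def)
  \<comment> \<open>With the sigma-algebra pulled back along \<open>dec\<close>, the map
    \<open>dec\<close> is measurable by construction, and \<open>enc\<close> is measurable because
    \<open>dec\<close> inverts it on the space of R.\<close>
  define V where "V = vimage_algebra (dec -` space R) dec R"
  have d: "dec \<in> measurable V R" unfolding V_def by (rule measurable_vimage_algebra1) auto
  have "(\<lambda>x. dec (enc x)) \<in> measurable R R"
    using measurable_ident de by (subst measurable_cong[of R _ "\<lambda>x. x"]) (auto simp: id_def)
  then have e: "enc \<in> measurable R V" unfolding V_def by (intro measurable_vimage_algebra2) (auto simp: de)
  have d': "dec \<in> measurable (distr R V enc) R" using d by simp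
  have "distr (distr R V enc) R dec = distr R R (\<lambda>x. x)"
    by (subst distr_distr[OF d e], rule distr_cong) (auto simp: de)
  then have "distr (distr R V enc) R dec = R" by simp
  with d' prob_space_distr[OF e] show ?thesis by blast
qed

text \<open>No Poisson process has to be constructed: the one of the target rate is a rescaling of the one
  that witnesses that M is compound Poisson.\<close>

lemma compound_poissonI:
  fixes Q0 :: "(nat \<Rightarrow> real \<times> real) measure"
  assumes Q0: "prob_space Q0" "poisson_process Q0 lam N0" and lam: "lam > 0"
    and P: "prob_space P" and m: "trajectory Z \<in> measurable P cadlag_space"
    and Z: "has_increments P Z (\<lambda>u. mixture (poisson0 (c * u)) G)"
    and c: "c > 0" and G: "real_distribution G"
  shows "compound_poisson P Z c G"
proof -
  let ?PX = "\<Pi>\<^sub>M k\<in>{1::nat..}. G" and ?S = "\<Pi>\<^sub>M t\<in>{0::real..}. count_space (UNIV :: nat set)"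
    and ?T = "\<Pi>\<^sub>M k\<in>{1::nat..}. (borel :: real measure)"
  interpret G: real_distribution G by fact
  note PX = iid_PiM[OF G]
  define R where "R = Q0 \<Otimes>\<^sub>M ?PX"
  note pp = pair_prob_space_projections[OF Q0(1) PX(2), folded R_def]
  have "snd z \<in> extensional {1..}" if "z \<in> space R" for z
    using that by (auto simp: R_def space_pair_measure space_PiM PiE_def)
  from prob_space_encode[OF pp(1) this] obtain Q :: "(nat \<Rightarrow> real \<times> real) measure" and d
    where Q: "prob_space Q" and d: "d \<in> measurable Q R" "distr Q R d = R" by auto
  have fs: "fst \<in> measurable R Q0" "snd \<in> measurable R ?PX" unfolding R_def by auto
  define N where "N = (\<lambda>t \<omega>. N0 (c / lam * t) (fst (d \<omega>)))"
  define X where "X = (\<lambda>k \<omega>. snd (d \<omega>) k)"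
  have pc: "poisson_process Q0 c (\<lambda>t. N0 (c / lam * t))"
    using poisson_process_rescale[OF Q0(2), of "c / lam"] lam c by simp
  have N: "poisson_process Q c N"
    using poisson_process_transfer[OF Q pp(1) d poisson_process_transfer[OF pp(1) Q0(1) fs(1) pp(2) pc]]
    by (simp add: N_def)
  have X: "iid Q G X"
    using iid_transfer[OF Q pp(1) d iid_transfer[OF pp(1) PX(2) fs(2) pp(3) PX(1)]]
    by (simp add: X_def)
  have f1: "trajectory (\<lambda>t. N0 (c / lam * t)) \<in> measurable Q0 ?S"
    by (rule measurable_trajectory) (use pc in \<open>simp add: poisson_process_def\<close>)
  have f2: "(\<lambda>x. \<lambda>k\<in>{1..}. x k) \<in> measurable ?PX ?T"
    by (rule measurable_restrict) (rule iid_measurable[OF PX(2,1)], simp)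
  have ind: "indep_rv Q ?S (trajectory N) ?T (\<lambda>\<omega>. \<lambda>k\<in>{1..}. X k \<omega>)"
    using indep_rv_transfer[OF Q pp(1) d indep_rv_compose[OF pp(1) pp(4) f1 f2]]
    by (simp add: N_def X_def trajectory_def[abs_def])
  note * = Q c N X G ind
  have "distr P cadlag_space (trajectory Z) = distr Q cadlag_space (trajectory (\<lambda>t \<omega>. \<Sum>k=1..N t \<omega>. X k \<omega>))"
    by (rule has_increments_law[OF P Q Z compound_sum_increments[OF *] real_distribution_mixture[OF G] m
          compound_sum_trajectory[OF *]])
  then show ?thesis
    unfolding compound_poisson_def compound_poisson_law_def using m Q N X ind by blast
qed

lemma emeasure_subordinated:
  assumes P: "prob_space P" and \<nu>: "bernstein_triplet 0 b \<nu>" and H: "bernstein_subordinator P 0 b \<nu> H"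
    and lam: "lam > 0" and pos: "bernstein 0 b \<nu> lam > 0" and F: "real_distribution F"
    and p: "pmf p 0 = 0" "\<And>k. pmf p (Suc k) = jump_coeff' 0 b \<nu> lam (Suc k)"
    and u: "u \<ge> 0" and B: "B \<in> sets borel"
  shows "emeasure (mixture (poisson0 (bernstein 0 b \<nu> lam * u)) (mixture p F)) B =
    (\<integral>\<^sup>+x. emeasure (mixture (poisson0 (lam * x)) F) B \<partial>distr P borel (real_version H (max 0 u)))"
proof -
  let ?c = "bernstein 0 b \<nu> lam" and ?h = "real_version H u"
  have [measurable]: "?h \<in> borel_measurable P" by (rule real_version_measurable[OF P H u])
  have h0: "lam * ?h \<omega> \<ge> 0" for \<omega> using lam by simp
  have hm: "(\<lambda>\<omega>. lam * ?h \<omega>) \<in> borel_measurable P" by measurable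
  obtain K where K: "\<And>n. (\<integral>\<^sup>+\<omega>. ennreal (pmf (poisson0 (lam * ?h \<omega>)) n) \<partial>P) = ennreal (pmf K n)"
    "\<And>s. \<bar>s\<bar> \<le> 1 \<Longrightarrow> pgf K (of_real s) = of_real (LINT \<omega>|P. exp (- (1 - s) * (lam * ?h \<omega>)))"
    using mixed_poisson[of P "\<lambda>\<omega>. lam * ?h \<omega>", OF P hm h0] by blast
  \<comment> \<open>For \<bar>s\<bar> < 1 the argument lam * (1 - s) is positive, hence in the range
    where the Laplace transform of H is known; agreement of the generating functions there already
    identifies the weights.\<close>
  have "K = bind_pmf (poisson0 (?c * u)) (sum_pmf p)"
  proof (rule pgf_inject)
    fix s :: real assume s: "\<bar>s\<bar> < 1"
    have "- (1 - s) * (lam * x) = - (lam * (1 - s)) * x" for x by (simp add: algebra_simps)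
    then have "pgf K (of_real s) = of_real (LINT \<omega>|P. exp (- (lam * (1 - s)) * ?h \<omega>))"
      using K(2)[of s] s by (simp only: less_imp_le)
    also have "(LINT \<omega>|P. exp (- (lam * (1 - s)) * ?h \<omega>)) = exp (- u * bernstein 0 b \<nu> (lam * (1 - s)))"
      by (rule laplace_real_version[OF P H refl u]) (use lam s in simp)
    also have "of_real (exp (- u * bernstein 0 b \<nu> (lam * (1 - s)))) =
      exp (- of_real u * (of_real (bernstein 0 b \<nu> (lam * (1 - s))) :: complex))"
      by (simp add: exp_of_real[symmetric])
    also have "(of_real (bernstein 0 b \<nu> (lam * (1 - s))) :: complex) = of_real ?c * (1 - pgf p (of_real s))"
      using pgf_jump_pmf[OF \<nu> lam pos p] s by simp
    also have "exp (- of_real u * (of_real ?c * (1 - pgf p (of_real s)))) = pgf (bind_pmf (poisson0 (?c * u)) (sum_pmf p)) (of_real s)"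
      using pos u s by (subst pgf_poisson0_sum) (auto simp: mult_ac)
    finally show "pgf K (of_real s) = pgf (bind_pmf (poisson0 (?c * u)) (sum_pmf p)) (of_real s)" .
  qed
  then have "emeasure (mixture (poisson0 (?c * u)) (mixture p F)) B = emeasure (mixture K F) B"
    using mixture_poisson0_mixture[OF F, of "?c * u" p] pos u by simp
  also have "\<dots> = (\<Sum>n. (\<integral>\<^sup>+\<omega>. ennreal (pmf (poisson0 (lam * ?h \<omega>)) n) \<partial>P) * emeasure (convolution_power F n) B)"
    by (simp add: emeasure_mixture_suminf[OF F B] K)
  also have "\<dots> = (\<Sum>n. \<integral>\<^sup>+\<omega>. ennreal (pmf (poisson0 (lam * ?h \<omega>)) n) * emeasure (convolution_power F n) B \<partial>P)"
    by (intro suminf_cong nn_integral_multc[symmetric]) measurable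
  also have "\<dots> = (\<integral>\<^sup>+\<omega>. (\<Sum>n. ennreal (pmf (poisson0 (lam * ?h \<omega>)) n) * emeasure (convolution_power F n) B) \<partial>P)"
    by (rule nn_integral_suminf[symmetric]) measurable
  also have "\<dots> = (\<integral>\<^sup>+\<omega>. emeasure (mixture (poisson0 (lam * ?h \<omega>)) F) B \<partial>P)"
    by (simp add: emeasure_mixture_suminf[OF F B])
  also have "\<dots> = (\<integral>\<^sup>+x. emeasure (mixture (poisson0 (lam * x)) F) B \<partial>distr P borel (real_version H (max 0 u)))"
    using u emeasure_mixture_poisson0_measurable[OF F B, of lam] by (subst nn_integral_distr) (auto simp: max_def)
  finally show ?thesis .
qed

section \<open>The subordinated process\<close>

lemma has_increments_marginal:
  assumes Q: "prob_space Q" and Z: "has_increments Q Z \<kappa>" and t: "t \<ge> 0" and B: "B \<in> sets borel"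
  shows "emeasure Q {\<omega>\<in>space Q. Z t \<omega> \<in> B} = emeasure (\<kappa> t) B"
proof -
  let ?\<tau> = "\<lambda>i::nat. if i = 0 then 0 else t"
  have [measurable]: "Z t \<in> borel_measurable Q" "Z 0 \<in> borel_measurable Q" using Z t by (auto simp: has_increments_def)
  have "emeasure Q {\<omega>\<in>space Q. \<forall>i<1. Z (?\<tau> (Suc i)) \<omega> - Z (?\<tau> i) \<omega> \<in> (\<lambda>_. B) i} =
    (\<Prod>i<1. emeasure (\<kappa> (?\<tau> (Suc i) - ?\<tau> i)) ((\<lambda>_. B) i))"
    by (rule Z[unfolded has_increments_def, THEN conjunct2, THEN conjunct2, rule_format, of ?\<tau> 1 "\<lambda>_. B"])
       (use t B in auto)
  then have "emeasure (\<kappa> t) B = emeasure Q {\<omega>\<in>space Q. Z t \<omega> - Z 0 \<omega> \<in> B}" by simp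
  also have "\<dots> = emeasure Q {\<omega>\<in>space Q. Z t \<omega> \<in> B}"
  proof (rule emeasure_eq_AE)
    have "AE \<omega> in Q. Z 0 \<omega> = 0" using Z by (simp add: has_increments_def)
    then show "AE \<omega> in Q. \<omega> \<in> {\<omega>\<in>space Q. Z t \<omega> - Z 0 \<omega> \<in> B} \<longleftrightarrow> \<omega> \<in> {\<omega>\<in>space Q. Z t \<omega> \<in> B}"
      by eventually_elim simp
  qed (use B in measurable)
  finally show ?thesis by simp
qed

context
  fixes P :: "'a measure" and F \<nu> :: "real measure" and lam b :: real
    and M :: "real \<Rightarrow> 'a \<Rightarrow> real" and H :: "real \<Rightarrow> 'a \<Rightarrow> ennreal" and p :: "nat pmf"
  assumes P: "prob_space P" and lam: "lam > 0" and F: "real_distribution F"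
    and M: "compound_poisson P M lam F" and \<nu>: "bernstein_triplet 0 b \<nu>"
    and pos: "bernstein 0 b \<nu> lam > 0" and H: "bernstein_subordinator P 0 b \<nu> H"
    and ind: "indep_rv P (\<Pi>\<^sub>M t\<in>{0..}. borel) (trajectory H) cadlag_space (trajectory M)"
    and p: "pmf p 0 = 0" "\<And>k. pmf p (Suc k) = jump_coeff' 0 b \<nu> lam (Suc k)"
begin

lemma trajectory_base: "trajectory M \<in> measurable P cadlag_space"
  using M by (simp add: compound_poisson_def)

lemma subordinated_increments:
  "has_increments P (\<lambda>t \<omega>. M (real_version H t \<omega>) \<omega>)
    (\<lambda>u. mixture (poisson0 (bernstein 0 b \<nu> lam * u)) (mixture p F))"
proof (rule has_increments_time_change[where M=M and h="real_version H" and \<kappa>="\<lambda>u. mixture (poisson0 (lam * u)) F"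
      and \<sigma>="\<lambda>u. distr P borel (real_version H (max 0 u))"])
  show "prob_space P" by (rule P)
  show "has_increments P M (\<lambda>u. mixture (poisson0 (lam * u)) F)"
    by (rule compound_poisson_increments[OF lam F M])
  show "trajectory M \<in> measurable P cadlag_space" by (rule trajectory_base)
  show "(\<lambda>u. emeasure (mixture (poisson0 (lam * u)) F) B) \<in> borel_measurable borel" if "B \<in> sets borel" for B
    by (rule emeasure_mixture_poisson0_measurable[OF F that])
  show "has_increments P (real_version H) (\<lambda>u. distr P borel (real_version H (max 0 u)))"
    by (rule real_version_increments[OF P H refl])
  show "real_distribution (distr P borel (real_version H (max 0 u)))" for u
    by (rule prob_space.real_distribution_distr[OF P]) (rule real_version_measurable[OF P H], simp)
  show "mono_on {0..} (\<lambda>t. real_version H t \<omega>)" "real_version H 0 \<omega> = 0" if "\<omega> \<in> space P" for \<omega>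
    by (rule real_version_mono[OF P H that], rule real_version_0[OF P H that])
  show "indep_rv P (\<Pi>\<^sub>M t\<in>{0..}. borel) (trajectory (real_version H)) cadlag_space (trajectory M)"
    by (rule indep_real_version[OF P H ind])
  show "emeasure (mixture (poisson0 (bernstein 0 b \<nu> lam * u)) (mixture p F)) B =
    (\<integral>\<^sup>+x. emeasure (mixture (poisson0 (lam * x)) F) B \<partial>distr P borel (real_version H (max 0 u)))"
    if "u \<ge> 0" "B \<in> sets borel" for u B
    by (rule emeasure_subordinated[OF P \<nu> H lam pos F p that])
qed

lemma subordinated_trajectory:
  "trajectory (\<lambda>t \<omega>. M (real_version H t \<omega>) \<omega>) \<in> measurable P cadlag_space"
  unfolding measurable_cadlag_space_iff
proof (intro conjI allI impI ballI)
  show "(\<lambda>\<omega>. M (real_version H t \<omega>) \<omega>) \<in> borel_measurable P" if "t \<ge> 0" for t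
    using subordinated_increments that by (simp add: has_increments_def)
  fix \<omega> assume \<omega>: "\<omega> \<in> space P"
  have "cadlag (\<lambda>t\<in>{0..}. trajectory M \<omega> (real_version H t \<omega>))"
  proof (rule cadlag_time_change[where h="\<lambda>t. real_version H t \<omega>"])
    show "cadlag (trajectory M \<omega>)" using trajectory_base \<omega> by (simp add: measurable_cadlag_space_iff)
  qed (use real_version_mono[OF P H \<omega>] real_version_0[OF P H \<omega>] real_version_continuous[OF P H \<omega>] in auto)
  also have "(\<lambda>t\<in>{0..}. trajectory M \<omega> (real_version H t \<omega>)) = trajectory (\<lambda>t \<omega>. M (real_version H t \<omega>) \<omega>) \<omega>"
    by (auto simp: trajectory_def fun_eq_iff)
  finally show "cadlag (trajectory (\<lambda>t \<omega>. M (real_version H t \<omega>) \<omega>) \<omega>)" .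
qed

lemma subordinate_real_version:
  "AE \<omega> in P. \<forall>t\<ge>0. subordinate M H t \<omega> = Some (M (real_version H t \<omega>) \<omega>)"
  using subordinator_never_killed[OF P H refl] AE_space
proof eventually_elim
  case (elim \<omega>)
  have "H t \<omega> \<noteq> \<infinity>" if "t \<ge> 0" for t
    using subordinator_finite[OF P H elim(2,1) that] by simp
  moreover have "real_version H t \<omega> = enn2real (H t \<omega>)" for t
    using elim(1) by (simp only: real_version_def if_True simp_thms)
  ultimately show ?case by (simp add: subordinate_def)
qed

lemma killed_compound_poisson_subordinate:
  "killed_compound_poisson P (subordinate M H) (bernstein 0 b \<nu> lam) (mixture p F)"
proof -
  from M obtain Q0 :: "(nat \<Rightarrow> real \<times> real) measure" and N0 where Q0: "prob_space Q0" "poisson_process Q0 lam N0"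
    unfolding compound_poisson_def compound_poisson_law_def by blast
  have "compound_poisson P (\<lambda>t \<omega>. M (real_version H t \<omega>) \<omega>) (bernstein 0 b \<nu> lam) (mixture p F)"
    by (rule compound_poissonI[OF Q0 lam P subordinated_trajectory subordinated_increments pos real_distribution_mixture[OF F]])
  then show ?thesis unfolding killed_compound_poisson_def using subordinate_real_version by blast
qed

lemma subordinate_law_eq:
  assumes t: "t \<ge> 0" and B: "B \<in> sets borel"
  shows "subordinate_law P M H t B = measure (mixture (poisson0 (bernstein 0 b \<nu> lam * t)) (mixture p F)) B"
proof -
  have [measurable]: "H t \<in> borel_measurable P" by (rule subordinator_measurable[OF P H t])
  have [measurable]: "(\<lambda>\<omega>. M (real_version H t \<omega>) \<omega>) \<in> borel_measurable P"
    using subordinated_increments t by (simp add: has_increments_def)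
  \<comment> \<open>\<open>enn2real\<close> sends \<infinity> to 0, so this evaluation is measurable
    on the whole space; killed paths are excluded separately in \<open>eq\<close>.\<close>
  have "(\<lambda>\<omega>. (\<lambda>z. fst z (max 0 (snd z))) (trajectory M \<omega>, enn2real (H t \<omega>))) \<in> borel_measurable P"
    by (intro measurable_compose[OF measurable_Pair measurable_eval_joint] trajectory_base) measurable
  then have [measurable]: "(\<lambda>\<omega>. M (enn2real (H t \<omega>)) \<omega>) \<in> borel_measurable P"
    by (simp add: trajectory_def max_def)
  have eq: "{\<omega>\<in>space P. subordinate M H t \<omega> \<in> Some ` B} = {\<omega>\<in>space P. H t \<omega> \<noteq> \<infinity> \<and> M (enn2real (H t \<omega>)) \<omega> \<in> B}"
    by (auto simp: subordinate_def)
  have "subordinate_law P M H t B = measure P {\<omega>\<in>space P. M (real_version H t \<omega>) \<omega> \<in> B}"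
    unfolding subordinate_law_def
  proof (rule measure_eq_AE)
    show "AE \<omega> in P. \<omega> \<in> {\<omega>\<in>space P. subordinate M H t \<omega> \<in> Some ` B} \<longleftrightarrow>
      \<omega> \<in> {\<omega>\<in>space P. M (real_version H t \<omega>) \<omega> \<in> B}"
      using subordinate_real_version by eventually_elim (use t in auto)
    show "{\<omega>\<in>space P. subordinate M H t \<omega> \<in> Some ` B} \<in> sets P"
      unfolding eq using B by measurable
    show "{\<omega>\<in>space P. M (real_version H t \<omega>) \<omega> \<in> B} \<in> sets P"
      using B by measurable
  qed
  then show ?thesis
    using has_increments_marginal[OF P subordinated_increments t B] by (simp add: measure_def)
qed

end

section \<open>The generator\<close>

lemma emeasure_shift_measurable:
  assumes N: "real_distribution N" and B: "B \<in> sets borel"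
  shows "(\<lambda>x. emeasure N {a. a + x \<in> B}) \<in> borel_measurable borel"
proof -
  interpret N: real_distribution N by fact
  have "{z \<in> space (borel \<Otimes>\<^sub>M borel). snd z + fst z \<in> B} \<in> sets (borel \<Otimes>\<^sub>M (borel :: real measure))"
    using B by measurable
  then have "{z. snd z + fst z \<in> B} \<in> sets (borel \<Otimes>\<^sub>M N)"
    by (simp add: space_pair_measure cong: sets_pair_measure_cong)
  from N.measurable_emeasure_Pair[OF this] show ?thesis by (simp add: vimage_def)
qed

lemma sets_shift: "B \<in> sets borel \<Longrightarrow> {a. a + x \<in> B} \<in> sets borel" for x :: real
proof -
  assume B: "B \<in> sets borel"
  have "{a \<in> space borel. a + x \<in> B} \<in> sets borel" using B by measurable
  then show ?thesis by simp
qed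

lemma real_distribution_finite:
  assumes "real_distribution N"
  shows "finite_measure N" "sets N = sets borel" "space N = UNIV"
proof -
  interpret real_distribution N by fact
  show "finite_measure N" "sets N = sets borel" "space N = UNIV" by (auto intro: finite_measure_axioms)
qed

lemma emeasure_convolution_shift:
  assumes "real_distribution G" "real_distribution N" "B \<in> sets borel"
  shows "emeasure (convolution G N) B = (\<integral>\<^sup>+x. emeasure N {a. a + x \<in> B} \<partial>G)"
  using assms real_distribution_finite by (intro convolution_emeasure) auto

lemma measure_convolution_shift:
  assumes G: "real_distribution G" and N: "real_distribution N" and B: "B \<in> sets borel"
  shows "measure (convolution G N) B = (LINT x|G. measure N {a. a + x \<in> B})"
proof -
  interpret G: real_distribution G by fact
  interpret N: real_distribution N by fact
  interpret GN: real_distribution "convolution G N" by (rule real_distribution_convolution[OF G N])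
  have "(\<lambda>x. measure N {a. a + x \<in> B}) \<in> borel_measurable borel"
    using emeasure_shift_measurable[OF N B] unfolding measure_def by measurable
  then have m: "(\<lambda>x. measure N {a. a + x \<in> B}) \<in> borel_measurable G"
    by (simp cong: measurable_cong_sets)
  have int: "integrable G (\<lambda>x. measure N {a. a + x \<in> B})"
    by (rule G.integrable_const_bound[of _ 1]) (use m in auto)
  have "ennreal (measure (convolution G N) B) = (\<integral>\<^sup>+x. ennreal (measure N {a. a + x \<in> B}) \<partial>G)"
    using emeasure_convolution_shift[OF G N B] by (simp add: GN.emeasure_eq_measure N.emeasure_eq_measure)
  also have "\<dots> = ennreal (LINT x|G. measure N {a. a + x \<in> B})"
    by (rule nn_integral_eq_integral[OF int]) simp
  finally show ?thesis by simp
qed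

text \<open>Convolution acts linearly and so passes through a mixture. This serves the time
  derivative, where a jump law is convolved with its own Poisson mixture, and the generator, where
  the law at time t is convolved with F_f.\<close>

lemma measure_convolution_mixture_sums:
  assumes G: "real_distribution G" and F: "real_distribution F" and B: "B \<in> sets borel"
  shows "(\<lambda>n. pmf p n * measure (convolution G (convolution_power F n)) B) sums measure (convolution G (mixture p F)) B"
proof -
  interpret real_distribution "convolution G (mixture p F)"
    by (intro real_distribution_convolution G real_distribution_mixture F)
  note Fn = real_distribution_convolution_power[OF F]
  have *: "emeasure (convolution G (convolution_power F n)) B = ennreal (measure (convolution G (convolution_power F n)) B)" for n
  proof -
    interpret c: real_distribution "convolution G (convolution_power F n)"
      by (intro real_distribution_convolution G Fn)
    show ?thesis by (rule c.emeasure_eq_measure)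
  qed
  have m: "(\<lambda>x. emeasure (convolution_power F n) {a. a + x \<in> B}) \<in> borel_measurable G" for n
    using emeasure_shift_measurable[OF Fn B, of n] real_distribution_finite(2)[OF G] by (simp cong: measurable_cong_sets)
  have "ennreal (measure (convolution G (mixture p F)) B) = (\<integral>\<^sup>+x. emeasure (mixture p F) {a. a + x \<in> B} \<partial>G)"
    using emeasure_convolution_shift[OF G real_distribution_mixture[OF F, of p] B] by (simp add: emeasure_eq_measure)
  also have "\<dots> = (\<integral>\<^sup>+x. (\<Sum>n. ennreal (pmf p n) * emeasure (convolution_power F n) {a. a + x \<in> B}) \<partial>G)"
    by (simp add: emeasure_mixture_suminf[OF F] sets_shift B)
  also have "\<dots> = (\<Sum>n. \<integral>\<^sup>+x. ennreal (pmf p n) * emeasure (convolution_power F n) {a. a + x \<in> B} \<partial>G)"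
    by (rule nn_integral_suminf) (use m in measurable)
  also have "\<dots> = (\<Sum>n. ennreal (pmf p n) * emeasure (convolution G (convolution_power F n)) B)"
    by (simp add: nn_integral_cmult m emeasure_convolution_shift[OF G Fn B])
  finally have "(\<Sum>n. ennreal (pmf p n * measure (convolution G (convolution_power F n)) B)) = ennreal (measure (convolution G (mixture p F)) B)"
    by (simp add: * ennreal_mult')
  moreover have "(\<lambda>n. ennreal (pmf p n * measure (convolution G (convolution_power F n)) B)) sums
     (\<Sum>n. ennreal (pmf p n * measure (convolution G (convolution_power F n)) B))" by (rule summable_sums) auto
  ultimately show ?thesis by (simp add: sums_ennreal)
qed

text \<open>On a fixed Borel set the law is exp (- u) times a power series in u = c s with
  coefficients r n / n!. Differentiating the series replaces r n by r (n + 1), which is one more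
  convolution with G; differentiating the exponential gives the term with the minus sign.
  Boundedness of r makes the series converge everywhere.\<close>

lemma measure_mixture_poisson0_deriv:
  assumes G: "real_distribution G" and c: "c \<ge> 0" and t: "t \<ge> 0" and B: "B \<in> sets borel"
  shows "((\<lambda>s. measure (mixture (poisson0 (c * s)) G) B) has_real_derivative
    c * (measure (convolution G (mixture (poisson0 (c * t)) G)) B - measure (mixture (poisson0 (c * t)) G) B)) (at t within {0..})"
proof -
  define r where "r n = measure (convolution_power G n) B" for n
  define \<phi> where "\<phi> u = (\<Sum>n. r n / fact n * u ^ n)" for u :: real
  define \<psi> where "\<psi> u = (\<Sum>n. r (Suc n) / fact n * u ^ n)" for u :: real
  have r: "0 \<le> r n" "r n \<le> 1" for n
  proof -
    interpret real_distribution "convolution_power G n" by (rule real_distribution_convolution_power[OF G])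
    show "0 \<le> r n" "r n \<le> 1" by (auto simp: r_def)
  qed
  have sm: "summable (\<lambda>n. r (k n) / fact n * u ^ n)" for u :: real and k
  proof (rule summable_comparison_test)
    show "\<exists>N. \<forall>n\<ge>N. norm (r (k n) / fact n * u ^ n) \<le> inverse (fact n) * \<bar>u\<bar> ^ n"
      using r by (auto intro!: exI[of _ 0] simp: abs_mult power_abs field_simps mult_left_le_one_le)
    show "summable (\<lambda>n. inverse (fact n) * \<bar>u\<bar> ^ n)" by (rule summable_exp)
  qed
  have "diffs (\<lambda>n. r n / fact n) = (\<lambda>n. r (Suc n) / fact n)"
    by (simp add: diffs_def fun_eq_iff del: of_nat_Suc)
  then have \<phi>': "(\<phi> has_real_derivative \<psi> u) (at u)" for u
    using termdiffs_strong_converges_everywhere[OF sm, of "\<lambda>n. n" u] unfolding \<phi>_def \<psi>_def by simp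
  have 1: "measure (mixture (poisson0 u) G) B = exp (- u) * \<phi> u" if "u \<ge> 0" for u
  proof -
    have "(\<lambda>n. exp (- u) * (r n / fact n * u ^ n)) sums (exp (- u) * \<phi> u)"
      unfolding \<phi>_def by (intro sums_mult summable_sums sm)
    moreover have "(\<lambda>n. exp (- u) * (r n / fact n * u ^ n)) sums measure (mixture (poisson0 u) G) B"
      using measure_mixture_sums[OF G B, of "poisson0 u"] that by (simp add: pmf_poisson0 r_def mult_ac)
    ultimately show ?thesis by (simp add: sums_unique2)
  qed
  have 2: "measure (convolution G (mixture (poisson0 u) G)) B = exp (- u) * \<psi> u" if "u \<ge> 0" for u
  proof -
    have "(\<lambda>n. exp (- u) * (r (Suc n) / fact n * u ^ n)) sums (exp (- u) * \<psi> u)"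
      unfolding \<psi>_def by (intro sums_mult summable_sums sm)
    moreover have "(\<lambda>n. exp (- u) * (r (Suc n) / fact n * u ^ n)) sums measure (convolution G (mixture (poisson0 u) G)) B"
      using measure_convolution_mixture_sums[OF G G B, of "poisson0 u"] that by (simp add: pmf_poisson0 r_def mult_ac)
    ultimately show ?thesis by (simp add: sums_unique2)
  qed
  have "((\<lambda>s. exp (- (c * s)) * \<phi> (c * s)) has_real_derivative
      c * (exp (- (c * t)) * \<psi> (c * t) - exp (- (c * t)) * \<phi> (c * t))) (at t)"
    by (auto intro!: derivative_eq_intros DERIV_chain2[OF \<phi>'] simp: algebra_simps)
  then have "((\<lambda>s. exp (- (c * s)) * \<phi> (c * s)) has_real_derivative
      c * (exp (- (c * t)) * \<psi> (c * t) - exp (- (c * t)) * \<phi> (c * t))) (at t within {0..})"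
    by (rule has_field_derivative_at_within)
  \<comment> \<open>The series represents the law for s \<ge> 0 only, since \<open>poisson0\<close>
    is degenerate at negative parameters; this is why the derivative is taken within {0..},
    one-sided at 0.\<close>
  then have "((\<lambda>s. measure (mixture (poisson0 (c * s)) G) B) has_real_derivative
      c * (exp (- (c * t)) * \<psi> (c * t) - exp (- (c * t)) * \<phi> (c * t))) (at t within {0..})"
    by (rule has_field_derivative_transform_within[of _ _ _ _ 1]) (use c t 1 in auto)
  then show ?thesis using c t by (simp add: 1 2)
qed

section \<open>The operator f(\<lambda>(I - C_F)) on probability laws\<close>

lemma convolution_return_0:
  assumes N: "real_distribution N" shows "convolution (return borel 0) N = N"
proof (rule Levy_uniqueness)
  show "char (convolution (return borel 0) N) = char N"
    by (simp add: fun_eq_iff char_convolution[OF real_distribution_return N]) (simp add: char_def integral_return)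
qed (intro real_distribution_convolution real_distribution_return N)+

text \<open>Agreement of q with a law is assumed on Borel sets only, which is what is known of
  \<open>subordinate_law\<close>. The induction stays inside them because translates of Borel sets
  are Borel; associativity absorbs the new factor F into the power.\<close>

lemma convolution_operator_power:
  assumes F: "real_distribution F" and N: "real_distribution N" and q: "\<And>B. B \<in> sets borel \<Longrightarrow> q B = measure N B"
  shows "B \<in> sets borel \<Longrightarrow> (convolution_operator F ^^ k) q B = measure (convolution (convolution_power F k) N) B"
proof (induction k arbitrary: B)
  case 0 then show ?case by (simp add: q convolution_return_0[OF N])
next
  case (Suc k)
  note Fk = real_distribution_convolution_power[OF F, of k]
  have "(convolution_operator F ^^ Suc k) q B = (LINT y|F. measure (convolution (convolution_power F k) N) {x. x + y \<in> B})"
    by (simp add: convolution_operator_def Suc sets_shift)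
  also have "\<dots> = measure (convolution F (convolution (convolution_power F k) N)) B"
    by (rule measure_convolution_shift[OF F real_distribution_convolution[OF Fk N] Suc.prems, symmetric])
  also have "convolution F (convolution (convolution_power F k) N) = convolution (convolution_power F (Suc k)) N"
    using convolution_associative[of "convolution_power F k" N F] real_distribution_finite[OF F] real_distribution_finite[OF N]
      real_distribution_finite[OF Fk] by simp
  finally show ?case .
qed

text \<open>Splitting off k = 0 from every Poisson average leaves f(lam) times the identity; the
  terms k \<ge> 1, with the drift joining k = 1, add up to f(lam) times convolution with F_f. So the
  operator is the negative generator of the compound Poisson flow with rate f(lam) and jump law
  F_f.\<close>

lemma bernstein_operator_eq:
  assumes \<nu>: "bernstein_triplet 0 b \<nu>" and lam: "lam > 0" and pos: "bernstein 0 b \<nu> lam > 0"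
    and F: "real_distribution F" and N: "real_distribution N"
    and p: "pmf p 0 = 0" "\<And>k. pmf p (Suc k) = jump_coeff' 0 b \<nu> lam (Suc k)"
    and q: "\<And>B. B \<in> sets borel \<Longrightarrow> q B = measure N B" and B: "B \<in> sets borel"
  shows "bernstein_operator 0 b \<nu> lam F q B =
    bernstein 0 b \<nu> lam * (measure N B - measure (convolution (mixture p F) N) B)"
proof -
  let ?c = "bernstein 0 b \<nu> lam"
  define m where "m k = measure (convolution (convolution_power F k) N) B" for k
  have C: "(convolution_operator F ^^ k) q B = m k" for k
    using convolution_operator_power[OF F N q B] by (simp add: m_def)
  have m: "0 \<le> m k" "m k \<le> 1" for k
  proof -
    interpret real_distribution "convolution (convolution_power F k) N"
      by (intro real_distribution_convolution real_distribution_convolution_power F N)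
    show "0 \<le> m k" "m k \<le> 1" by (auto simp: m_def)
  qed
  have m': "\<bar>m (Suc k)\<bar> \<le> 1" for k using m[of "Suc k"] by simp
  have q0: "q B = m 0" using C[of 0] by simp
  have q1: "convolution_operator F q B = m 1" using C[of 1] by simp
  \<comment> \<open>Without this splitting the integral could not be separated, as \<nu> may be
    infinite. Afterwards both pieces are integrable, being dominated by 1 - exp (- lam * w) for w >
    0.\<close>
  have integrand: "q B - exp (- lam * w) * (\<Sum>k. (lam * w) ^ k / fact k * (convolution_operator F ^^ k) q B) =
    m 0 * (1 - exp (- lam * w)) - (\<Sum>k. m (Suc k) * poisson_term lam k w)" for w
  proof -
    have sm: "summable (\<lambda>k. (lam * w) ^ k / fact k * m k)"
    proof (rule summable_comparison_test)
      show "\<exists>N. \<forall>n\<ge>N. norm ((lam * w) ^ n / fact n * m n) \<le> inverse (fact n) * \<bar>lam * w\<bar> ^ n"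
        using m by (auto intro!: exI[of _ 0] mult_left_le_one_le simp: abs_mult power_abs divide_inverse mult_ac)
      show "summable (\<lambda>n. inverse (fact n) * \<bar>lam * w\<bar> ^ n)" by (rule summable_exp)
    qed
    have "exp (- lam * w) * (\<Sum>k. (lam * w) ^ Suc k / fact (Suc k) * m (Suc k)) =
      (\<Sum>k. exp (- lam * w) * ((lam * w) ^ Suc k / fact (Suc k) * m (Suc k)))"
      using sm by (intro suminf_mult[symmetric]) (subst summable_Suc_iff[of "\<lambda>k. (lam * w) ^ k / fact k * m k"])
    also have "\<dots> = (\<Sum>k. m (Suc k) * poisson_term lam k w)"
      by (intro suminf_cong) (simp add: poisson_term_def)
    finally have "exp (- lam * w) * ((\<Sum>k. (lam * w) ^ k / fact k * m k) - m 0) = (\<Sum>k. m (Suc k) * poisson_term lam k w)"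
      using suminf_split_head[OF sm] by simp
    then show ?thesis unfolding C q0 by (simp add: algebra_simps)
  qed
  have "(LINT w|\<nu>. q B - exp (- lam * w) * (\<Sum>k. (lam * w) ^ k / fact k * (convolution_operator F ^^ k) q B)) =
    m 0 * (LINT w|\<nu>. 1 - exp (- lam * w)) - (LINT w|\<nu>. (\<Sum>k. m (Suc k) * poisson_term lam k w))"
    unfolding integrand
    using triplet_integrable[OF \<nu>, of lam] lam poisson_term_series(1)[OF \<nu> lam pos, of "\<lambda>k. m (Suc k)", OF m']
    by (subst Bochner_Integration.integral_diff) auto
  then have op: "bernstein_operator 0 b \<nu> lam F q B =
    m 0 * ?c - (b * lam * m 1 + (LINT w|\<nu>. (\<Sum>k. m (Suc k) * poisson_term lam k w)))"
    unfolding bernstein_operator_def q1 unfolding q0 by (simp add: bernstein_def algebra_simps)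
  have "(\<lambda>k. m (Suc k) * pmf p (Suc k)) sums ((b * lam * m 1 + (LINT w|\<nu>. (\<Sum>k. m (Suc k) * poisson_term lam k w))) / ?c)"
    using jump_coeff'_sums[OF \<nu> lam pos, of "\<lambda>k. m (Suc k)", OF m'] by (simp add: p)
  then have "(\<lambda>k. m k * pmf p k) sums ((b * lam * m 1 + (LINT w|\<nu>. (\<Sum>k. m (Suc k) * poisson_term lam k w))) / ?c)"
    by (subst (asm) sums_Suc_iff) (simp add: p)
  moreover have "(\<lambda>k. m k * pmf p k) sums measure (convolution (mixture p F) N) B"
  proof -
    have "convolution (convolution_power F k) N = convolution N (convolution_power F k)" for k
      using real_distribution_finite[OF N] real_distribution_finite[OF real_distribution_convolution_power[OF F], of k]
      by (intro convolution_commutative) auto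
    moreover have "convolution (mixture p F) N = convolution N (mixture p F)"
      using real_distribution_finite[OF N] real_distribution_finite[OF real_distribution_mixture[OF F], of p]
      by (intro convolution_commutative) auto
    ultimately show ?thesis using measure_convolution_mixture_sums[OF N F B, of p] by (simp add: m_def mult.commute)
  qed
  ultimately have "(b * lam * m 1 + (LINT w|\<nu>. (\<Sum>k. m (Suc k) * poisson_term lam k w))) / ?c = measure (convolution (mixture p F) N) B"
    by (rule sums_unique2)
  then have "b * lam * m 1 + (LINT w|\<nu>. (\<Sum>k. m (Suc k) * poisson_term lam k w)) = ?c * measure (convolution (mixture p F) N) B"
    using pos by (simp add: field_simps)
  then show ?thesis unfolding op using q0 q[OF B] by (simp add: algebra_simps)
qed

section \<open>Random sums and the extension of the probability space\<close>

text \<open>Only the probabilities at k \<ge> 1 are prescribed. They already have total mass 1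
  because p has no mass at 0, so A vanishes with probability 0.\<close>

lemma distr_eq_pmf:
  assumes Q: "prob_space Q" and A: "A \<in> measurable Q (count_space UNIV)"
    and eq: "\<And>k. k \<ge> 1 \<Longrightarrow> measure Q {\<omega>\<in>space Q. A \<omega> = k} = pmf p k" and p0: "pmf p (0 :: nat) = 0"
  shows "distr Q (count_space UNIV) A = measure_pmf p"
proof -
  interpret prob_space Q by fact
  let ?D = "distr Q (count_space UNIV) A"
  interpret D: prob_space ?D by (rule prob_space_distr[OF A])
  have k: "emeasure ?D {k} = emeasure (measure_pmf p) {k}" if "k \<noteq> 0" for k
  proof -
    have "emeasure ?D {k} = emeasure Q {\<omega>\<in>space Q. A \<omega> = k}"
      by (subst emeasure_distr[OF A]) (auto intro!: arg_cong[where f="emeasure Q"])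
    then show ?thesis using eq[of k] that by (simp add: emeasure_eq_measure emeasure_pmf_single)
  qed
  have "emeasure ?D (- {0}) = (\<integral>\<^sup>+k. emeasure ?D {k} \<partial>count_space (- {0}))"
    by (rule emeasure_countable_singleton) auto
  also have "\<dots> = (\<integral>\<^sup>+k. emeasure (measure_pmf p) {k} \<partial>count_space (- {0}))"
    by (intro nn_integral_cong k) simp
  also have "\<dots> = emeasure (measure_pmf p) (- {0})"
    by (rule emeasure_countable_singleton[symmetric]) auto
  finally have "D.prob (- {0}) = measure (measure_pmf p) (- {0})"
    by (simp add: measure_def)
  then have "D.prob {0} = pmf p 0"
    using D.prob_compl[of "{0}"] measure_pmf.prob_compl[of "{0}" p] by (simp add: Compl_eq_Diff_UNIV measure_pmf_single)
  then have "emeasure ?D {k} = emeasure (measure_pmf p) {k}" for k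
    using k[of k] by (cases "k = 0") (auto simp: D.emeasure_eq_measure emeasure_pmf_single)
  then show ?thesis by (intro measure_eqI_countable[of _ UNIV]) auto
qed

lemma distr_random_sum:
  assumes Q: "prob_space Q" and X: "iid Q F X" and F: "real_distribution F"
    and ind: "indep_rv Q (count_space UNIV) A (\<Pi>\<^sub>M h\<in>{1..}. borel) (\<lambda>\<omega>. \<lambda>h\<in>{1..}. X h \<omega>)"
    and eq: "\<And>k. k \<ge> 1 \<Longrightarrow> measure Q {\<omega>\<in>space Q. A \<omega> = k} = pmf p k" and p0: "pmf p 0 = 0"
  shows "distr Q borel (random_sum X A) = mixture p F"
proof (rule measure_eqI)
  let ?T = "\<Pi>\<^sub>M h\<in>{1::nat..}. (borel :: real measure)"
  let ?V = "\<lambda>\<omega>. \<lambda>h\<in>{1..}. X h \<omega>"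
  interpret mix: real_distribution "mixture p F" by (rule real_distribution_mixture[OF F])
  show "sets (distr Q borel (random_sum X A)) = sets (mixture p F)" by simp
  have A: "A \<in> measurable Q (count_space UNIV)" using ind by (simp add: indep_rv_def)
  have V: "?V \<in> measurable Q ?T" using ind by (simp add: indep_rv_def)
  have dA: "distr Q (count_space UNIV) A = measure_pmf p" by (rule distr_eq_pmf[OF Q A eq p0])
  have rs: "random_sum X A \<in> borel_measurable Q"
    unfolding random_sum_def[abs_def]
    by (rule measurable_compose_countable[OF _ A]) (intro borel_measurable_sum iid_measurable[OF Q X], simp)
  fix B assume "B \<in> sets (distr Q borel (random_sum X A))"
  then have B: "B \<in> sets borel" by simp
  define E where "E = {z\<in>space (count_space UNIV \<Otimes>\<^sub>M ?T). (\<Sum>h=1..fst z. snd z h) \<in> B}"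
  have "(\<lambda>z. \<Sum>h=1..fst z. snd z h) \<in> borel_measurable (count_space UNIV \<Otimes>\<^sub>M ?T)"
    by (rule measurable_compose_countable[OF _ measurable_fst])
       (intro borel_measurable_sum measurable_compose[OF measurable_snd measurable_component_singleton], simp)
  then have E: "E \<in> sets (count_space UNIV \<Otimes>\<^sub>M ?T)" unfolding E_def using B by measurable
  \<comment> \<open>The sum from 1 to A \<omega> is rewritten as the block after index 0, the form
    to which \<open>distr_block_sum\<close> applies with m = 0.\<close>
  have in_E: "(A \<omega>, ?V \<omega>') \<in> E \<longleftrightarrow> (\<Sum>h\<in>{0<..0 + A \<omega>}. X h \<omega>') \<in> B" if "\<omega>' \<in> space Q" for \<omega> \<omega>'
  proof -
    have "(\<Sum>h=1..A \<omega>. ?V \<omega>' h) = (\<Sum>h\<in>{0<..0 + A \<omega>}. X h \<omega>')"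
      by (intro sum.cong) auto
    then show ?thesis using measurable_space[OF V that] by (simp add: E_def space_pair_measure)
  qed
  have bm: "(\<lambda>\<omega>. \<Sum>h\<in>{0<..0 + n}. X h \<omega>) \<in> borel_measurable Q" for n
    by (intro borel_measurable_sum iid_measurable[OF Q X]) auto
  have "emeasure (distr Q borel (random_sum X A)) B = emeasure Q (random_sum X A -` B \<inter> space Q)"
    by (rule emeasure_distr[OF rs B])
  also have "random_sum X A -` B \<inter> space Q = {\<omega>\<in>space Q. (A \<omega>, ?V \<omega>) \<in> E}"
  proof -
    have "{1..n} = {0<..0 + n}" for n :: nat by auto
    then show ?thesis by (auto simp: in_E random_sum_def simp del: One_nat_def)
  qed
  also have "emeasure Q \<dots> = (\<integral>\<^sup>+\<omega>. emeasure Q {\<omega>'\<in>space Q. (A \<omega>, ?V \<omega>') \<in> E} \<partial>Q)"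
    by (rule indep_rv_emeasure[OF Q ind E])
  also have "\<dots> = (\<integral>\<^sup>+\<omega>. emeasure (convolution_power F (A \<omega>)) B \<partial>Q)"
  proof (rule nn_integral_cong)
    fix \<omega>
    have "{\<omega>'\<in>space Q. (A \<omega>, ?V \<omega>') \<in> E} = (\<lambda>\<omega>'. \<Sum>h\<in>{0<..0 + A \<omega>}. X h \<omega>') -` B \<inter> space Q"
      using in_E[of _ \<omega>] by blast
    then have "emeasure Q {\<omega>'\<in>space Q. (A \<omega>, ?V \<omega>') \<in> E} =
        emeasure (distr Q borel (\<lambda>\<omega>'. \<Sum>h\<in>{0<..0 + A \<omega>}. X h \<omega>')) B"
      by (simp only: emeasure_distr[OF bm B])
    then show "emeasure Q {\<omega>'\<in>space Q. (A \<omega>, ?V \<omega>') \<in> E} = emeasure (convolution_power F (A \<omega>)) B"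
      by (simp only: distr_block_sum[OF Q X])
  qed
  also have "\<dots> = (\<integral>\<^sup>+k. emeasure (convolution_power F k) B \<partial>distr Q (count_space UNIV) A)"
    by (rule nn_integral_distr[OF A, symmetric]) simp
  also have "\<dots> = emeasure (mixture p F) B"
    unfolding dA by (rule emeasure_mixture[OF F B, symmetric])
  finally show "emeasure (distr Q borel (random_sum X A)) B = emeasure (mixture p F) B" .
qed

text \<open>The given space may be too small to carry X and A independent of M, so P is enlarged by
  independent factors for them; the first projection recovers P, and hence M.\<close>

lemma extension_exists:
  fixes P :: "'a measure" and p :: "nat pmf"
  assumes P: "prob_space P" and F: "real_distribution F" and m: "trajectory M \<in> measurable P cadlag_space"
  shows "\<exists>(Q :: ('a \<times> (nat \<Rightarrow> real) \<times> nat) measure) X A.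
    prob_space Q \<and> fst \<in> measurable Q P \<and> distr Q P fst = P \<and> iid Q F X \<and>
    indep_rv Q (count_space UNIV) A ((\<Pi>\<^sub>M h\<in>{1..}. borel) \<Otimes>\<^sub>M cadlag_space)
      (\<lambda>\<omega>. (\<lambda>h\<in>{1..}. X h \<omega>, trajectory M (fst \<omega>))) \<and>
    (\<forall>k. measure Q {\<omega>\<in>space Q. A \<omega> = k} = pmf p k)"
proof -
  let ?PX = "\<Pi>\<^sub>M k\<in>{1::nat..}. F"
  note PX = iid_PiM[OF F]
  note pw = pair_prob_space_projections[OF P PX(2)]
  note pr = pair_prob_space_projections[OF measure_pmf.prob_space_axioms[of p] pw(1)]
  \<comment> \<open>In R the coordinate of A is one factor and everything else the other, so joint
    independence of A from X and M is immediate. Q is R with the coordinates reordered so that the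
    first projection lands in P; the map d undoes the reordering and transports the properties of R
    to Q.\<close>
  define R where "R = measure_pmf p \<Otimes>\<^sub>M (P \<Otimes>\<^sub>M ?PX)"
  define Q where "Q = distr R (P \<Otimes>\<^sub>M (?PX \<Otimes>\<^sub>M measure_pmf p)) (\<lambda>z. (fst (snd z), snd (snd z), fst z))"
  define d :: "'a \<times> (nat \<Rightarrow> real) \<times> nat \<Rightarrow> nat \<times> 'a \<times> (nat \<Rightarrow> real)"
    where "d z = (snd (snd z), fst z, fst (snd z))" for z
  have e: "(\<lambda>z. (fst (snd z), snd (snd z), fst z)) \<in> measurable R (P \<Otimes>\<^sub>M (?PX \<Otimes>\<^sub>M measure_pmf p))"
    unfolding R_def by measurable
  have d0: "d \<in> measurable (P \<Otimes>\<^sub>M (?PX \<Otimes>\<^sub>M measure_pmf p)) R"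
    unfolding R_def d_def[abs_def] by measurable
  have Q: "prob_space Q" unfolding Q_def by (rule prob_space.prob_space_distr[OF pr(1)[folded R_def] e])
  have d: "d \<in> measurable Q R" unfolding Q_def using d0 by simp
  have dd: "distr Q R d = R"
  proof -
    have "distr Q R d = distr R R (\<lambda>z. z)"
      unfolding Q_def by (subst distr_distr[OF d0 e], rule distr_cong) (auto simp: d_def)
    then show ?thesis by simp
  qed
  note pr' = pr[folded R_def]
  have m1: "snd \<in> measurable R (P \<Otimes>\<^sub>M ?PX)" "fst \<in> measurable R (measure_pmf p)"
    unfolding R_def by (rule measurable_snd measurable_fst)+
  define X where "X = (\<lambda>k \<omega>. snd (snd (d \<omega>)) k)"
  define A where "A = (\<lambda>\<omega>. fst (d \<omega>))"
  have "fst \<in> measurable Q P" unfolding Q_def by simp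
  moreover have "distr Q P fst = P"
  proof -
    have "distr Q P (\<lambda>\<omega>. fst (snd (d \<omega>))) = distr R P (\<lambda>z. fst (snd z))"
      by (rule distr_transfer[OF d dd]) (rule measurable_compose[OF m1(1) measurable_fst])
    also have "\<dots> = distr (P \<Otimes>\<^sub>M ?PX) P fst"
      by (rule distr_transfer[OF m1(1) pr'(3)]) simp
    also have "\<dots> = P" by (rule pw(2))
    finally show ?thesis by (simp add: d_def)
  qed
  moreover have "iid Q F X"
    unfolding X_def
    by (rule iid_transfer[OF Q pr'(1) d dd, where X="\<lambda>k z. snd (snd z) k"],
        rule iid_transfer[OF pr'(1) pw(1) m1(1) pr'(3), where X="\<lambda>k z. snd z k"],
        rule iid_transfer[OF pw(1) PX(2) measurable_snd pw(3) PX(1)])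
  moreover have "indep_rv Q (count_space UNIV) A ((\<Pi>\<^sub>M h\<in>{1..}. borel) \<Otimes>\<^sub>M cadlag_space)
      (\<lambda>\<omega>. (\<lambda>h\<in>{1..}. X h \<omega>, trajectory M (fst \<omega>)))"
  proof -
    let ?g = "\<lambda>z. (\<lambda>h\<in>{1..}. snd z h, trajectory M (fst z))"
    have "(\<lambda>x. \<lambda>k\<in>{1..}. x k) \<in> measurable ?PX (\<Pi>\<^sub>M h\<in>{1..}. borel)"
      by (rule measurable_restrict) (rule iid_measurable[OF PX(2,1)], simp)
    then have g: "?g \<in> measurable (P \<Otimes>\<^sub>M ?PX) ((\<Pi>\<^sub>M h\<in>{1..}. borel) \<Otimes>\<^sub>M cadlag_space)"
      by (intro measurable_Pair measurable_compose[OF measurable_snd] measurable_compose[OF measurable_fst m])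
    have "indep_rv R (count_space UNIV) (\<lambda>z. id (fst z)) ((\<Pi>\<^sub>M h\<in>{1..}. borel) \<Otimes>\<^sub>M cadlag_space) (\<lambda>z. ?g (snd z))"
      by (rule indep_rv_compose[OF pr'(1) pr'(4) _ g]) simp
    from indep_rv_transfer[OF Q pr'(1) d dd this] show ?thesis
      by (simp add: A_def X_def d_def)
  qed
  moreover have "measure Q {\<omega>\<in>space Q. A \<omega> = k} = pmf p k" for k
  proof -
    have Am: "A \<in> measurable Q (measure_pmf p)"
      unfolding A_def by (rule measurable_compose[OF d m1(2)])
    have "distr Q (measure_pmf p) A = measure_pmf p"
      unfolding A_def using distr_transfer[OF d dd m1(2)] pr'(2) by simp
    then have "pmf p k = measure (distr Q (measure_pmf p) A) {k}" by (simp add: measure_pmf_single)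
    also have "\<dots> = measure Q (A -` {k} \<inter> space Q)" by (rule measure_distr[OF Am]) simp
    also have "A -` {k} \<inter> space Q = {\<omega>\<in>space Q. A \<omega> = k}" by auto
    finally show ?thesis by simp
  qed
  ultimately show ?thesis using Q by blast
qed

lemma killed_compound_poisson_rate_0:
  assumes P: "prob_space P" and H: "bernstein_subordinator P a b \<nu> H"
    and Y: "killed_compound_poisson P (subordinate M H) c G"
  shows "a = 0"
proof -
  interpret prob_space P by fact
  obtain Z where Z: "AE \<omega> in P. \<forall>t\<ge>0. subordinate M H t \<omega> = Some (Z t \<omega>)"
    using Y by (auto simp: killed_compound_poisson_def)
  have [measurable]: "H 1 \<in> borel_measurable P" by (rule subordinator_measurable[OF P H]) simp
  have "AE \<omega> in P. H 1 \<omega> < \<infinity>"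
    using Z
  proof eventually_elim
    case (elim \<omega>)
    then have "subordinate M H 1 \<omega> = Some (Z 1 \<omega>)" by simp
    then show ?case by (auto simp: subordinate_def less_top split: if_splits)
  qed
  then have "prob {\<omega>\<in>space P. H 1 \<omega> < \<infinity>} = 1" by (subst prob_Collect_eq_1) auto
  then have "exp (- a) = 1" using subordinator_alive[OF P H, of 1] by simp
  then show "a = 0" by simp
qed

theorem theorem3p3:
  fixes P :: "'a measure" and F \<nu> :: "real measure" and lam a b :: real
    and M :: "real \<Rightarrow> 'a \<Rightarrow> real" and H :: "real \<Rightarrow> 'a \<Rightarrow> ennreal"
  assumes "prob_space P"
    and "lam > 0"
    and "real_distribution F"
    and "compound_poisson P M lam F"
    and "bernstein_triplet a b \<nu>"
    and "\<exists>x\<ge>0. bernstein a b \<nu> x \<noteq> 0"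
    and "bernstein_subordinator P a b \<nu> H"
    and "indep_rv P (\<Pi>\<^sub>M t\<in>{0..}. borel) (trajectory H) cadlag_space (trajectory M)"
  shows
    \<comment> \<open>(i)\<close>
    "(a = 0 \<longleftrightarrow>
        real_distribution (jump_measure a b \<nu> lam F) \<and>
        killed_compound_poisson P (subordinate M H) (bernstein a b \<nu> lam) (jump_measure a b \<nu> lam F))
     \<and>
     (a = 0 \<longrightarrow>
        \<comment> \<open>an extension of P carries X and A, with A independent of (X, M)\<close>
        (\<exists>(Q :: ('a \<times> (nat \<Rightarrow> real) \<times> nat) measure) X A.
           prob_space Q \<and> fst \<in> measurable Q P \<and> distr Q P fst = P \<and> iid Q F X \<and>
           indep_rv Q (count_space UNIV) A
             ((\<Pi>\<^sub>M h\<in>{1..}. borel) \<Otimes>\<^sub>M cadlag_space)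
             (\<lambda>\<omega>. (\<lambda>h\<in>{1..}. X h \<omega>, trajectory M (fst \<omega>))) \<and>
           (\<forall>k\<ge>1. measure Q {\<omega>\<in>space Q. A \<omega> = k} = jump_coeff' a b \<nu> lam k)) \<and>
        \<comment> \<open>for all such X and A, on any space, the jumps are distributed as the random sum\<close>
        (\<forall>(Q :: 'q measure) X A.
           prob_space Q \<and> iid Q F X \<and>
           indep_rv Q (count_space UNIV) A
             (\<Pi>\<^sub>M h\<in>{1..}. borel) (\<lambda>\<omega>. \<lambda>h\<in>{1..}. X h \<omega>) \<and>
           (\<forall>k\<ge>1. measure Q {\<omega>\<in>space Q. A \<omega> = k} = jump_coeff' a b \<nu> lam k) \<longrightarrow>
           distr Q borel (random_sum X A) = jump_measure a b \<nu> lam F \<and>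
           killed_compound_poisson P (subordinate M H) (bernstein a b \<nu> lam)
             (distr Q borel (random_sum X A))))
     \<and>
     \<comment> \<open>(ii)\<close>
     (a = 0 \<longrightarrow>
        (\<forall>t\<ge>0. \<forall>B\<in>sets borel.
           ((\<lambda>s. subordinate_law P M H s B) has_real_derivative
              - bernstein_operator a b \<nu> lam F (subordinate_law P M H t) B) (at t within {0..})) \<and>
        (\<forall>B\<in>sets borel. subordinate_law P M H 0 B = measure (return borel 0) B))"
proof (cases "a = 0")
  \<comment> \<open>The second conjunct on the right of the equivalence in (i) forces a = 0, so both
    sides fail; the remaining claims assume a = 0.\<close>
  case False
  then show ?thesis
    using killed_compound_poisson_rate_0[OF assms(1,7)] by blast
next
  case True
  note lam = assms(2) and F = assms(3) and \<nu> = assms(5)[unfolded True] and H = assms(7)[unfolded True]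
  have pos: "bernstein 0 b \<nu> lam > 0" using bernstein_pos[OF \<nu> lam] assms(6) by (simp add: True)
  obtain p where p: "pmf p 0 = 0" "\<And>k. pmf p (Suc k) = jump_coeff' 0 b \<nu> lam (Suc k)"
    using jump_pmf_exists[OF \<nu> lam pos refl] by blast
  have p1: "pmf p k = jump_coeff' 0 b \<nu> lam k" if "k \<ge> 1" for k
    using p(2)[of "k - 1"] that by simp
  have jm: "jump_measure 0 b \<nu> lam F = mixture p F" by (rule jump_measure_eq_mixture[OF F p])
  note ctx = assms(1) lam F assms(4) \<nu> pos H assms(8) p
  have killed: "killed_compound_poisson P (subordinate M H) (bernstein 0 b \<nu> lam) (mixture p F)"
    by (rule killed_compound_poisson_subordinate[OF ctx])
  have mix: "real_distribution (mixture p F)" by (rule real_distribution_mixture[OF F])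
  have sums: "distr Q borel (random_sum X A) = mixture p F"
    if "prob_space Q" "iid Q F X"
      "indep_rv Q (count_space UNIV) A (\<Pi>\<^sub>M h\<in>{1..}. borel) (\<lambda>\<omega>. \<lambda>h\<in>{1..}. X h \<omega>)"
      "\<forall>k\<ge>1. measure Q {\<omega>\<in>space Q. A \<omega> = k} = jump_coeff' 0 b \<nu> lam k"
    for Q :: "'q measure" and X A
    by (rule distr_random_sum[OF that(1,2) F that(3) _ p(1)]) (use that(4) p1 in simp)
  obtain Q :: "('a \<times> (nat \<Rightarrow> real) \<times> nat) measure" and X A where ext: "prob_space Q"
    "fst \<in> measurable Q P" "distr Q P fst = P" "iid Q F X"
    "indep_rv Q (count_space UNIV) A ((\<Pi>\<^sub>M h\<in>{1..}. borel) \<Otimes>\<^sub>M cadlag_space)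
      (\<lambda>\<omega>. (\<lambda>h\<in>{1..}. X h \<omega>, trajectory M (fst \<omega>)))"
    "\<And>k. measure Q {\<omega>\<in>space Q. A \<omega> = k} = pmf p k"
    using extension_exists[OF assms(1) F trajectory_base[OF ctx], of p] by blast
  have deriv: "((\<lambda>s. subordinate_law P M H s B) has_real_derivative
      - bernstein_operator 0 b \<nu> lam F (subordinate_law P M H t) B) (at t within {0..})"
    if t: "t \<ge> 0" and B: "B \<in> sets borel" for t B
  proof -
    let ?c = "bernstein 0 b \<nu> lam" and ?N = "\<lambda>s. mixture (poisson0 (bernstein 0 b \<nu> lam * s)) (mixture p F)"
    have "((\<lambda>s. measure (?N s) B) has_real_derivative
        ?c * (measure (convolution (mixture p F) (?N t)) B - measure (?N t) B)) (at t within {0..})"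
      by (rule measure_mixture_poisson0_deriv[OF mix less_imp_le[OF pos] t B])
    then have "((\<lambda>s. subordinate_law P M H s B) has_real_derivative
        ?c * (measure (convolution (mixture p F) (?N t)) B - measure (?N t) B)) (at t within {0..})"
      by (rule has_field_derivative_transform_within[of _ _ _ _ 1])
         (use t subordinate_law_eq[OF ctx _ B] in auto)
    moreover have "bernstein_operator 0 b \<nu> lam F (subordinate_law P M H t) B =
        ?c * (measure (?N t) B - measure (convolution (mixture p F) (?N t)) B)"
      by (rule bernstein_operator_eq[OF \<nu> lam pos F real_distribution_mixture[OF mix] p
            subordinate_law_eq[OF ctx t] B])
    ultimately show ?thesis by (simp only: minus_mult_right minus_diff_eq)
  qed
  \<comment> \<open>At t = 0 the Poisson parameter is 0, so the mixture reduces to the zeroth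
    convolution power, the unit mass at 0.\<close>
  have init: "subordinate_law P M H 0 B = measure (return borel 0) B" if B: "B \<in> sets borel" for B
    using subordinate_law_eq[OF ctx _ B, of 0] emeasure_mixture[OF mix B, of "poisson0 0"]
    by (simp add: poisson0_def measure_def)
  show ?thesis
    unfolding True jm
  proof (intro conjI impI allI ballI iffI refl mix killed deriv init; (elim conjE)?)
    show "\<exists>(Q :: ('a \<times> (nat \<Rightarrow> real) \<times> nat) measure) X A.
           prob_space Q \<and> fst \<in> measurable Q P \<and> distr Q P fst = P \<and> iid Q F X \<and>
           indep_rv Q (count_space UNIV) A
             ((\<Pi>\<^sub>M h\<in>{1..}. borel) \<Otimes>\<^sub>M cadlag_space)
             (\<lambda>\<omega>. (\<lambda>h\<in>{1..}. X h \<omega>, trajectory M (fst \<omega>))) \<and>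
           (\<forall>k\<ge>1. measure Q {\<omega>\<in>space Q. A \<omega> = k} = jump_coeff' 0 b \<nu> lam k)"
      using ext p1 by (intro exI[of _ Q] exI[of _ X] exI[of _ A]) simp
  qed (simp_all add: sums killed)
qed

end
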